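(* Let $N\ge 1$ and let $a\in\Phi_r(K_1^1)\cap\Phi_l(K_1^1)$ be an $N\times N$ matrix function. Then for all $n\in\mathbf Z$ and $s\in\mathbf C$, $$\det\bigl(I+sP-sL(a)Q_nL(a^{-1})\bigr)=(1+s)^{nN}\det\bigl(I-s^2Q_nL(a^{-1})QL(a)Q_n\bigr)\quad\text{if } s\ne-1,$$ and $$\det\bigl(I+sP-sL(a)Q_nL(a^{-1})\bigr)=(1-s)^{-nN}\det\bigl(I-s^2(I-Q_n)L(a^{-1})PL(a)(I-Q_n)\bigr)\quad\text{if } s\ne1.$$ All operators act on $\ell^2(\mathbf Z,\mathbf C^N)$.
   Context: $\mathbf T$ is the complex unit circle and $L^\infty=L^\infty_{N\times N}$ is the algebra of all $N\times N$ matrix functions with entries in $L^\infty(\mathbf T)$. For $a\in L^\infty$, $a_k=\frac1{2\pi}\int_0^{2\pi}a(e^{i\theta})e^{-ik\theta}\,d\theta$ ($k\in\mathbf Z$) are the Fourier coefficients. Fix any matrix norm $\|\cdot\|$ on $\mathbf C^{N\times N}$. Put $K_1^1=\{a\in L^\infty:\sum_{n\in\mathbf Z}(|n|+1)\|a_n\|<\infty\}$ and $H^\infty_\pm=\{a\in L^\infty: a_{\mp n}=0\text{ for } n>0\}$. For a subset $E\subset L^\infty$, $a\in\Phi_r(E)$ means $a=u_-u_+$ with $u_-,u_-^{-1}\in E\cap H^\infty_-$ and $u_+,u_+^{-1}\in E\cap H^\infty_+$ (right canonical Wiener-Hopf factorization in $E$); $a\in\Phi_l(E)$ means $a=v_+v_-$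 with $v_-,v_-^{-1}\in E\cap H^\infty_-$ and $v_+,v_+^{-1}\in E\cap H^\infty_+$ (left canonical Wiener-Hopf factorization in $E$). $L(a)=(a_{j-k})_{j,k=-\infty}^\infty$ is the block Laurent operator on $\ell^2(\mathbf Z,\mathbf C^N)$. Projections on $\ell^2(\mathbf Z,\mathbf C^N)$: $(Px)_k=x_k$ for $k\ge0$ and $0$ for $k<0$; $Q=I-P$; for $n\in\mathbf Z$, $(Q_nx)_k=x_k$ for $k\ge n$ and $0$ for $k<n$. Determinants are Fredholm determinants of identity plus trace class operators. *)

theory Defs
  imports "HOL-Analysis.Analysis" "HOL-Library.Function_Algebras"
begin

section \<open>Matrix functions on the unit circle\<close>

text \<open>
  A matrix function on the circle is a function \<^typ>\<open>complex \<Rightarrow> complex^'n^'n\<close> of which only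
  the values at \<open>cis \<theta>\<close>, \<open>0 \<le> \<theta> \<le> 2\<pi>\<close>, matter. Elements of \<open>L\<^sup>\<infinity>\<close> are represented by functions, not
  by equivalence classes, so equations between them are stated almost everywhere. The matrix size
  is \<open>N = CARD('n)\<close>.
\<close>

abbreviation angle_measure :: "real measure" where
  "angle_measure \<equiv> lebesgue_on {0..2*pi}"

definition L_inf :: "(complex \<Rightarrow> complex^'n^'n) set" where
  "L_inf = {a. (\<lambda>\<theta>. a (cis \<theta>)) \<in> borel_measurable angle_measure \<and>
               (\<exists>C. AE \<theta> in angle_measure. norm (a (cis \<theta>)) \<le> C)}"

definition fourier_coeff :: "(complex \<Rightarrow> complex^'n^'n) \<Rightarrow> int \<Rightarrow> complex^'n^'n" where
  "fourier_coeff a k =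
     (\<chi> i j. 1 / (2 * pi) * (LINT \<theta>|angle_measure. a (cis \<theta>) $ i $ j * cis (- (of_int k * \<theta>))))"

text \<open>The norm of \<^typ>\<open>complex^'n^'n\<close> is the Frobenius norm; since all norms on this space are
  equivalent, any other one gives the same set.\<close>

definition K11 :: "(complex \<Rightarrow> complex^'n^'n) set" where
  "K11 = {a \<in> L_inf. (\<lambda>n::int. (of_int \<bar>n\<bar> + 1) * norm (fourier_coeff a n)) summable_on UNIV}"

definition H_plus :: "(complex \<Rightarrow> complex^'n^'n) set" where
  "H_plus = {a \<in> L_inf. \<forall>n>0. fourier_coeff a (- n) = 0}"

definition H_minus :: "(complex \<Rightarrow> complex^'n^'n) set" where
  "H_minus = {a \<in> L_inf. \<forall>n>0. fourier_coeff a n = 0}"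

definition ptw_inv :: "(complex \<Rightarrow> complex^'n^'n) \<Rightarrow> complex \<Rightarrow> complex^'n^'n" where
  "ptw_inv a = (\<lambda>t. matrix_inv (a t))"

text \<open>\<open>u, u\<^sup>-\<^sup>1 \<in> F\<close>. The invertibility condition is needed because \<^const>\<open>matrix_inv\<close> is
  unspecified at singular matrices.\<close>

definition units_in ::
  "(complex \<Rightarrow> complex^'n^'n) set \<Rightarrow> (complex \<Rightarrow> complex^'n^'n) set" where
  "units_in F = {u \<in> F. (AE \<theta> in angle_measure. invertible (u (cis \<theta>))) \<and> ptw_inv u \<in> F}"

definition Phi_r ::
  "(complex \<Rightarrow> complex^'n^'n) set \<Rightarrow> (complex \<Rightarrow> complex^'n^'n) set" where
  "Phi_r E = {a \<in> L_inf. \<exists>u_minus \<in> units_in (E \<inter> H_minus). \<exists>u_plus \<in> units_in (E \<inter> H_plus).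
     AE \<theta> in angle_measure. a (cis \<theta>) = u_minus (cis \<theta>) ** u_plus (cis \<theta>)}"

definition Phi_l ::
  "(complex \<Rightarrow> complex^'n^'n) set \<Rightarrow> (complex \<Rightarrow> complex^'n^'n) set" where
  "Phi_l E = {a \<in> L_inf. \<exists>v_plus \<in> units_in (E \<inter> H_plus). \<exists>v_minus \<in> units_in (E \<inter> H_minus).
     AE \<theta> in angle_measure. a (cis \<theta>) = v_plus (cis \<theta>) ** v_minus (cis \<theta>)}"


section \<open>Operators on \<open>\<ell>\<^sup>2(\<int>, \<complex>\<^sup>N)\<close>\<close>

text \<open>
  Sequences and operators are total functions; an operator is meaningful only on the carrier
  \<open>l2\<close>. Sums and differences of sequences and of operators are the pointwise ones from
  \<^theory>\<open>HOL-Library.Function_Algebras\<close>, and the identity operator is \<^const>\<open>id\<close>.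
\<close>

type_synonym 'n sequence = "int \<Rightarrow> complex^'n"
type_synonym 'n operator = "'n sequence \<Rightarrow> 'n sequence"

definition l2 :: "'n::finite sequence set" where
  "l2 = {x. (\<lambda>k. (norm (x k))\<^sup>2) summable_on UNIV}"

definition l2_norm :: "'n::finite sequence \<Rightarrow> real" where
  "l2_norm x = sqrt (\<Sum>\<^sub>\<infinity>k. (norm (x k))\<^sup>2)"

definition seq_scale :: "complex \<Rightarrow> 'n::finite sequence \<Rightarrow> 'n sequence" where
  "seq_scale c x = (\<lambda>k. c *s x k)"

definition op_scale :: "complex \<Rightarrow> 'n::finite operator \<Rightarrow> 'n operator" (infixr "*\<^sub>o" 75) where
  "c *\<^sub>o A = (\<lambda>x. seq_scale c (A x))"

definition laurent :: "(complex \<Rightarrow> complex^'n^'n) \<Rightarrow> 'n::finite operator" where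
  "laurent a x = (\<lambda>j. \<Sum>\<^sub>\<infinity>k. fourier_coeff a (j - k) *v x k)"

definition proj_Qn :: "int \<Rightarrow> 'n::finite operator" where
  "proj_Qn n x = (\<lambda>k. if k \<ge> n then x k else 0)"

definition proj_P :: "'n::finite operator" where
  "proj_P x = (\<lambda>k. if k \<ge> 0 then x k else 0)"

definition proj_Q :: "'n::finite operator" where
  "proj_Q = id - proj_P"


section \<open>Trace class operators and Fredholm determinants\<close>

definition bounded_op :: "'n::finite operator \<Rightarrow> bool" where
  "bounded_op A \<longleftrightarrow>
     (\<forall>x\<in>l2. A x \<in> l2) \<and>
     (\<forall>x\<in>l2. \<forall>y\<in>l2. A (x + y) = A x + A y) \<and>
     (\<forall>c. \<forall>x\<in>l2. A (seq_scale c x) = seq_scale c (A x)) \<and>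
     (\<exists>K. \<forall>x\<in>l2. l2_norm (A x) \<le> K * l2_norm x)"

definition op_norm :: "'n::finite operator \<Rightarrow> real" where
  "op_norm A = Sup {l2_norm (A x) | x. x \<in> l2 \<and> l2_norm x \<le> 1}"

definition rank_le :: "nat \<Rightarrow> 'n::finite operator \<Rightarrow> bool" where
  "rank_le k F \<longleftrightarrow> (\<exists>B \<subseteq> l2. finite B \<and> card B \<le> k \<and>
     (\<forall>x\<in>l2. \<exists>c. F x = (\<Sum>b\<in>B. seq_scale (c b) b)))"

text \<open>The singular values (approximation numbers) are counted from \<open>0\<close>: \<open>sing_val A 0\<close> is the
  operator norm of \<open>A\<close>.\<close>

definition sing_val :: "'n::finite operator \<Rightarrow> nat \<Rightarrow> real" where
  "sing_val A k = Inf {op_norm (A - F) | F. bounded_op F \<and> rank_le k F}"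

definition trace_class :: "'n::finite operator \<Rightarrow> bool" where
  "trace_class A \<longleftrightarrow> bounded_op A \<and> summable (sing_val A)"

definition unit_seq :: "int \<times> 'n \<Rightarrow> 'n::finite sequence" where
  "unit_seq q = (\<lambda>k. if k = fst q then axis (snd q) 1 else 0)"

definition op_entry :: "'n::finite operator \<Rightarrow> int \<times> 'n \<Rightarrow> int \<times> 'n \<Rightarrow> complex" where
  "op_entry A p q = A (unit_seq q) (fst p) $ snd p"

definition principal_minor :: "'n::finite operator \<Rightarrow> (int \<times> 'n) set \<Rightarrow> complex" where
  "principal_minor A S = (\<Sum>\<pi> | \<pi> permutes S. of_int (sign \<pi>) * (\<Prod>p\<in>S. op_entry A p (\<pi> p)))"

text \<open>
  Fredholm's series \<open>det (I + A) = \<Sum>\<^sub>m tr (\<Lambda>\<^sup>m A)\<close> for the argument \<open>T = I + A\<close>: in the standard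
  orthonormal basis, \<open>tr (\<Lambda>\<^sup>m A)\<close> is the sum of the principal \<open>m \<times> m\<close> minors of \<open>A\<close>. For trace
  class \<open>A\<close> the sum over all finite index sets converges absolutely; otherwise the value of
  \<open>fredholm_det\<close> carries no meaning.
\<close>

definition fredholm_det :: "'n::finite operator \<Rightarrow> complex" where
  "fredholm_det T = (\<Sum>\<^sub>\<infinity>S\<in>{S. finite S}. principal_minor (T - id) S)"

definition id_plus_trace_class :: "'n::finite operator \<Rightarrow> bool" where
  "id_plus_trace_class T \<longleftrightarrow> trace_class (T - id)"

end

theory Submission
  imports Defs "Jordan_Normal_Form.Determinant"
begin

text \<open>
  Let \<open>A\<close> and \<open>B\<close> be the Laurent matrices of \<open>a\<close> and \<open>a\<^sup>-\<^sup>1\<close>, so \<open>A B = B A = 1\<close>, let \<open>P\<close> be the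
  projection onto the nonnegative half-line and \<open>R = Q\<^sub>n\<close>. Put \<open>F = A R B\<close>, \<open>p = 1 + s P\<close> and
  \<open>r = 1 + s R\<close>. As \<open>P\<close> and \<open>F\<close> are idempotent,

  \<open>(1 + s P - s F) (1 + s F) = (1 + s P) W\<close> with \<open>W = 1 - s\<^sup>2 (1 - P) F\<close>,

  and \<open>1 + s F = A r B\<close>. For \<open>s \<noteq> -1\<close> this gives \<open>1 + s P - s F = (p W p\<^sup>-\<^sup>1) (p A r\<^sup>-\<^sup>1 B)\<close>. By the cyclic
  invariance \<open>det (1 + K M) = det (1 + M K)\<close> the first factor has the determinant of
  \<open>1 - s\<^sup>2 R B (1 - P) A R\<close>. The second factor is \<open>(p A p\<^sup>-\<^sup>1 B) (A p r\<^sup>-\<^sup>1 B)\<close>: the matrix \<open>p r\<^sup>-\<^sup>1\<close> is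
  diagonal, differs from \<open>1\<close> in finitely many places and contributes \<open>(1 + s) powi (n N)\<close>, while
  \<open>p A p\<^sup>-\<^sup>1 B\<close> has determinant \<open>1\<close>. The last point is where the factorization of \<open>a\<close> enters. It
  provides \<open>A = V U\<close> with \<open>V\<close> block upper and \<open>U\<close> block lower triangular, and conjugation by \<open>V\<close> turns
  \<open>p A p\<^sup>-\<^sup>1 B\<close> into \<open>(V\<^sup>-\<^sup>1 p V p\<^sup>-\<^sup>1) (p U p\<^sup>-\<^sup>1 U\<^sup>-\<^sup>1)\<close>, a product of two unipotent triangular matrices.
  This is \<open>det_idempotent_difference\<close>. The second formula is the first one for the
  complementary projections \<open>1 - P\<close>, \<open>1 - R\<close> and \<open>-s\<close> in place of \<open>s\<close>.

  For the algebra above to make sense, the matrices with uniformly bounded absolute row and column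
  sums are made into a ring \<open>'i smat\<close>, in which the matrices with absolutely summable entries form
  a two-sided ideal. On that ideal the Fredholm series is absolutely convergent, and
  multiplicativity and cyclic invariance pass from finite sections to the limit by dominated
  convergence (\<open>fdet_limit\<close>, \<open>fdet_mult\<close>, \<open>fdet_sylvester\<close>). The
  commutators of \<open>P\<close> with \<open>U\<close> and \<open>V\<close> lie in the ideal because the symbol \<open>u\<close> of each factor has
  \<open>\<bar>k\<bar> \<parallel>u\<^sub>k\<parallel>\<close> summable, and the \<open>k\<close>-th diagonal crosses the corner in \<open>\<bar>k\<bar>\<close> blocks
  (\<open>l1mat_hankel\<close>).

  That \<open>L\<close> is multiplicative follows from the uniqueness of Fourier coefficients
  (\<open>null_spectrum_orthogonal\<close>), itself a consequence of the Stone-Weierstrass theorem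
  on the circle. Finally, the operators are trace class in the sense of approximation numbers
  because \<open>P - A Q\<^sub>n B = (P A (1 - Q\<^sub>n) - (1 - P) A Q\<^sub>n) B\<close> is built from Hankel blocks, and cutting such
  a block after \<open>M\<close> block rows leaves an error of at most the sum of \<open>\<parallel>a\<^sub>k\<parallel>\<close> over \<open>\<bar>k\<bar> > M - \<bar>n\<bar>\<close>,
  which is summable over \<open>M\<close> (\<open>fast_approx_hankel\<close>).
\<close>

section \<open>Determinants over finite index sets\<close>

definition minor :: "('i \<Rightarrow> 'i \<Rightarrow> 'a) \<Rightarrow> 'i set \<Rightarrow> 'a::comm_ring_1" where
  "minor M F = (\<Sum>\<pi> | \<pi> permutes F. of_int (sign \<pi>) * (\<Prod>p\<in>F. M p (\<pi> p)))"

text \<open>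
  Through an enumeration of the index set, multiplicativity and block triangular reduction are
  inherited from determinants of numbered matrices.
\<close>

lemma minor_reindex_mat:
  assumes f: "bij_betw f {0..<n} F"
  shows "minor M F = det (mat n n (\<lambda>(i, j). M (f i) (f j)))"
proof -
  let ?I = "{0..<n}" and ?g = "map_permutation {0..<n} f"
  have inj: "inj_on f ?I" and img: "f ` ?I = F" using f by (auto simp: bij_betw_def)
  have bij: "bij_betw ?g {\<sigma>. \<sigma> permutes ?I} {\<pi>. \<pi> permutes F}"
  proof (rule bij_betw_byWitness[where f' = "map_permutation F (inv_into ?I f)"])
    show "\<forall>\<sigma>\<in>{\<sigma>. \<sigma> permutes ?I}. map_permutation F (inv_into ?I f) (?g \<sigma>) = \<sigma>"
      using f inj by (auto intro!: map_permutation_compose_inv)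
    show "\<forall>\<pi>\<in>{\<pi>. \<pi> permutes F}. ?g (map_permutation F (inv_into ?I f) \<pi>) = \<pi>"
      using f bij_betw_inv_into[OF f] img
      by (auto intro!: map_permutation_compose_inv simp: f_inv_into_f)
    show "?g ` {\<sigma>. \<sigma> permutes ?I} \<subseteq> {\<pi>. \<pi> permutes F}"
      using map_permutation_permutes[OF f] by auto
    show "map_permutation F (inv_into ?I f) ` {\<pi>. \<pi> permutes F} \<subseteq> {\<sigma>. \<sigma> permutes ?I}"
      using map_permutation_permutes[OF bij_betw_inv_into[OF f]] by auto
  qed
  have term_eq: "of_int (sign \<sigma>) * (\<Prod>i\<in>?I. mat n n (\<lambda>(i, j). M (f i) (f j)) $$ (i, \<sigma> i)) =
        of_int (sign (?g \<sigma>)) * (\<Prod>p\<in>F. M p (?g \<sigma> p))" if s: "\<sigma> permutes ?I" for \<sigma>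
  proof -
    have "(\<Prod>p\<in>F. M p (?g \<sigma> p)) = (\<Prod>i\<in>?I. M (f i) (?g \<sigma> (f i)))"
      by (rule prod.reindex_bij_betw[OF f, symmetric])
    also have "\<dots> = (\<Prod>i\<in>?I. mat n n (\<lambda>(i, j). M (f i) (f j)) $$ (i, \<sigma> i))"
    proof (rule prod.cong[OF refl])
      fix i assume i: "i \<in> ?I"
      then have "\<sigma> i < n" using permutes_in_image[OF s, of i] by simp
      with i show "M (f i) (?g \<sigma> (f i)) = mat n n (\<lambda>(i, j). M (f i) (f j)) $$ (i, \<sigma> i)"
        using map_permutation_apply[OF inj i, of \<sigma>] by simp
    qed
    finally show ?thesis
      using sign_map_permutation[OF inj s] by simp
  qed
  have "det (mat n n (\<lambda>(i, j). M (f i) (f j))) =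
      (\<Sum>\<sigma> | \<sigma> permutes ?I. of_int (sign (?g \<sigma>)) * (\<Prod>p\<in>F. M p (?g \<sigma> p)))"
    using term_eq by (simp add: det_def)
  also have "\<dots> = minor M F"
    unfolding minor_def by (rule sum.reindex_bij_betw[OF bij])
  finally show ?thesis ..
qed

lemma minor_mult:
  assumes "finite F"
  shows "minor (\<lambda>p q. \<Sum>r\<in>F. M p r * N r q) F = minor M F * minor N F"
proof -
  obtain f where f: "bij_betw f {0..<card F} F"
    using ex_bij_betw_nat_finite[OF assms] by blast
  let ?n = "card F"
  define m where "m M = mat ?n ?n (\<lambda>(i, j). M (f i) (f j) :: 'b)" for M
  have "m (\<lambda>p q. \<Sum>r\<in>F. M p r * N r q) = m M * m N"
    by (rule eq_matI)
       (auto simp: m_def scalar_prod_def sum.reindex_bij_betw[OF f, symmetric])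
  then show ?thesis
    unfolding minor_reindex_mat[OF f] m_def[symmetric]
    by (simp add: det_mult[of _ ?n] m_def)
qed

text \<open>
  The block matrix with rows \<open>(1, X)\<close> and \<open>(-Y, 1)\<close> can be reduced to triangular form by a
  unipotent factor on its left or on its right. The two results have the diagonal blocks
  \<open>1 + X Y\<close>, \<open>1\<close> and \<open>1\<close>, \<open>1 + Y X\<close>.
\<close>

lemma minor_sylvester:
  fixes M N :: "'i \<Rightarrow> 'i \<Rightarrow> 'a::idom"
  assumes "finite F"
  shows "minor (\<lambda>p q. of_bool (p = q) + (\<Sum>r\<in>F. M p r * N r q)) F =
         minor (\<lambda>p q. of_bool (p = q) + (\<Sum>r\<in>F. N p r * M r q)) F"
proof -
  obtain f where f: "bij_betw f {0..<card F} F"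
    using ex_bij_betw_nat_finite[OF assms] by blast
  let ?n = "card F"
  define m where "m M = mat ?n ?n (\<lambda>(i, j). M (f i) (f j) :: 'a)" for M
  have m_carrier [simp]: "m M \<in> carrier_mat ?n ?n" for M by (simp add: m_def)
  have m_uminus [simp]: "- m M \<in> carrier_mat ?n ?n" for M by (simp add: m_def)
  have inj: "f i = f j \<longleftrightarrow> i = j" if "i < ?n" "j < ?n" for i j
    using f that by (auto simp: bij_betw_def inj_on_def)
  have m_eq: "m (\<lambda>p q. of_bool (p = q) + (\<Sum>r\<in>F. M p r * N r q)) = 1\<^sub>m ?n + m M * m N" for M N
    by (rule eq_matI)
       (auto simp: m_def scalar_prod_def sum.reindex_bij_betw[OF f, symmetric] inj)
  let ?X = "m M" and ?Y = "m N" and ?I = "1\<^sub>m ?n :: 'a mat" and ?O = "0\<^sub>m ?n ?n :: 'a mat"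
  let ?L = "four_block_mat ?I ?O (- ?Y) ?I"
  have cancel: "(?I + Z) + - Z = ?I" "- Z + (?I + Z) = ?I" if "Z \<in> carrier_mat ?n ?n" for Z
    using that by (auto intro!: eq_matI)
  have car [simp]: "?I + m A * m B \<in> carrier_mat ?n ?n" for A B
    by (intro add_carrier_mat mult_carrier_mat[of _ ?n ?n]) auto
  have neg: "?X * - ?Y = - (?X * ?Y)" "- ?Y * ?X = - (?Y * ?X)"
    by (simp_all add: m_def)
  have "four_block_mat (?I + ?X * ?Y) ?X ?O ?I * ?L = four_block_mat ?I ?X (- ?Y) ?I"
    by (subst mult_four_block_mat[where ?n1.0="?n" and ?n2.0="?n" and ?nr1.0="?n" and ?nr2.0="?n" and ?nc1.0="?n" and ?nc2.0="?n"])
       (simp_all add: neg cancel[OF mult_carrier_mat[of _ ?n ?n]] m_uminus right_mult_zero_mat[of _ ?n ?n] left_mult_zero_mat[of _ ?n ?n] right_mult_one_mat[of _ ?n ?n] left_mult_one_mat[of _ ?n ?n] right_add_zero_mat[of _ ?n ?n] left_add_zero_mat[of _ ?n ?n])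
  moreover have "?L * four_block_mat ?I ?X ?O (?I + ?Y * ?X) = four_block_mat ?I ?X (- ?Y) ?I"
    by (subst mult_four_block_mat[where ?n1.0="?n" and ?n2.0="?n" and ?nr1.0="?n" and ?nr2.0="?n" and ?nc1.0="?n" and ?nc2.0="?n"])
       (simp_all add: neg cancel[OF mult_carrier_mat[of _ ?n ?n]] m_uminus right_mult_zero_mat[of _ ?n ?n] left_mult_zero_mat[of _ ?n ?n] right_mult_one_mat[of _ ?n ?n] left_mult_one_mat[of _ ?n ?n] right_add_zero_mat[of _ ?n ?n] left_add_zero_mat[of _ ?n ?n])
  ultimately have "det (four_block_mat (?I + ?X * ?Y) ?X ?O ?I * ?L) =
      det (?L * four_block_mat ?I ?X ?O (?I + ?Y * ?X))" by simp
  moreover have "det ?L = 1"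
    by (subst det_four_block_mat_upper_right_zero[of _ ?n _ ?n]) (auto simp: det_one)
  ultimately have "det (?I + ?X * ?Y) = det (?I + ?Y * ?X)"
    by (simp add: det_mult[of _ "?n + ?n"] det_four_block_mat_lower_left_zero[of _ ?n _ ?n] det_one)
  then have "det (m (\<lambda>p q. of_bool (p = q) + (\<Sum>r\<in>F. M p r * N r q))) =
      det (m (\<lambda>p q. of_bool (p = q) + (\<Sum>r\<in>F. N p r * M r q)))"
    by (simp only: m_eq)
  then show ?thesis
    unfolding minor_reindex_mat[OF f] m_def .
qed

text \<open>
  In the expansion of \<open>\<Prod>p\<in>F. (of_bool (p = \<pi> p) + K p (\<pi> p))\<close> the term in which \<open>K\<close> is chosen
  exactly on \<open>S\<close> vanishes unless \<open>\<pi>\<close> fixes \<open>F - S\<close> pointwise, that is, unless \<open>\<pi>\<close> permutes \<open>S\<close>.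
\<close>

lemma sum_minors:
  assumes "finite F"
  shows "(\<Sum>S\<in>Pow F. minor K S) = minor (\<lambda>p q. of_bool (p = q) + K p q) F"
proof -
  have fin: "finite {\<pi>. \<pi> permutes S}" if "S \<subseteq> F" for S
    using finite_permutations finite_subset[OF that assms] by blast
  have "minor (\<lambda>p q. of_bool (p = q) + K p q) F =
      (\<Sum>\<pi> | \<pi> permutes F. \<Sum>S\<in>Pow F. of_int (sign \<pi>) * ((\<Prod>p\<in>S. K p (\<pi> p)) * (\<Prod>p\<in>F-S. of_bool (p = \<pi> p))))"
    unfolding minor_def using prod_add[OF assms, of "\<lambda>p. K p (_ p)" "\<lambda>p. of_bool (p = _ p)"]
    by (simp add: add.commute sum_distrib_left)
  also have "\<dots> = (\<Sum>S\<in>Pow F. \<Sum>\<pi> | \<pi> permutes F. of_int (sign \<pi>) * ((\<Prod>p\<in>S. K p (\<pi> p)) * (\<Prod>p\<in>F-S. of_bool (p = \<pi> p))))"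
    by (rule sum.swap)
  also have "\<dots> = (\<Sum>S\<in>Pow F. minor K S)"
  proof (rule sum.cong[OF refl])
    fix S assume S: "S \<in> Pow F"
    have "(\<Sum>\<pi> | \<pi> permutes F. of_int (sign \<pi>) * ((\<Prod>p\<in>S. K p (\<pi> p)) * (\<Prod>p\<in>F-S. of_bool (p = \<pi> p))))
        = (\<Sum>\<pi> | \<pi> permutes S. of_int (sign \<pi>) * ((\<Prod>p\<in>S. K p (\<pi> p)) * (\<Prod>p\<in>F-S. of_bool (p = \<pi> p))))"
    proof (rule sum.mono_neutral_right)
      show "finite {\<pi>. \<pi> permutes F}" using fin by blast
      show "{\<pi>. \<pi> permutes S} \<subseteq> {\<pi>. \<pi> permutes F}" using S by (auto intro: permutes_subset)
      show "\<forall>\<pi>\<in>{\<pi>. \<pi> permutes F} - {\<pi>. \<pi> permutes S}.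
          of_int (sign \<pi>) * ((\<Prod>p\<in>S. K p (\<pi> p)) * (\<Prod>p\<in>F-S. of_bool (p = \<pi> p))) = 0"
      proof
        fix \<pi> assume pi: "\<pi> \<in> {\<pi>. \<pi> permutes F} - {\<pi>. \<pi> permutes S}"
        have "\<exists>p\<in>F-S. \<pi> p \<noteq> p"
        proof (rule ccontr)
          assume "\<not> ?thesis"
          then have "\<pi> permutes S"
            using pi by (intro permutes_superset[of \<pi> F S]) blast+
          with pi show False by simp
        qed
        then have "(\<Prod>p\<in>F-S. of_bool (p = \<pi> p)) = (0::'b)"
          using assms by (intro prod_zero) (auto, metis Diff_iff)
        then show "of_int (sign \<pi>) * ((\<Prod>p\<in>S. K p (\<pi> p)) * (\<Prod>p\<in>F-S. of_bool (p = \<pi> p))) = 0"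
          by simp
      qed
    qed
    also have "\<dots> = minor K S"
      unfolding minor_def
      by (intro sum.cong refl) (auto simp: permutes_not_in intro!: prod.neutral)
    finally show "(\<Sum>\<pi> | \<pi> permutes F. of_int (sign \<pi>) * ((\<Prod>p\<in>S. K p (\<pi> p)) * (\<Prod>p\<in>F-S. of_bool (p = \<pi> p)))) = minor K S" .
  qed
  finally show ?thesis ..
qed

text \<open>
  Permutations of \<open>S\<close> are among the maps \<open>S \<Rightarrow> F\<close>, so the left-hand side is at most the sum over
  \<open>S\<close> of the products over \<open>S\<close> of the row sums, which is the product of \<open>1 + \<close>(row sum) over \<open>F\<close>.
  The exponent is bounded uniformly in \<open>F\<close> when the entries are summable.
\<close>

lemma minor_perm_bound:
  fixes Z :: "'i \<Rightarrow> 'i \<Rightarrow> real"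
  assumes "finite F" and nn: "\<And>p q. Z p q \<ge> 0"
  shows "(\<Sum>S\<in>Pow F. \<Sum>\<pi> | \<pi> permutes S. \<Prod>p\<in>S. Z p (\<pi> p)) \<le> exp (\<Sum>p\<in>F. \<Sum>q\<in>F. Z p q)"
proof -
  have "(\<Sum>\<pi> | \<pi> permutes S. \<Prod>p\<in>S. Z p (\<pi> p)) \<le> (\<Prod>p\<in>S. \<Sum>q\<in>F. Z p q)" if S: "S \<in> Pow F" for S
  proof -
    have finS: "finite S" using S assms finite_subset by blast
    let ?r = "\<lambda>\<pi>. restrict \<pi> S"
    have inj: "inj_on ?r {\<pi>. \<pi> permutes S}"
    proof (rule inj_onI)
      fix \<pi> \<sigma> assume "\<pi> \<in> {\<pi>. \<pi> permutes S}" "\<sigma> \<in> {\<pi>. \<pi> permutes S}" "?r \<pi> = ?r \<sigma>"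
      then show "\<pi> = \<sigma>"
        by (metis (no_types, lifting) ext mem_Collect_eq permutes_not_in restrict_apply')
    qed
    have "(\<Sum>\<pi> | \<pi> permutes S. \<Prod>p\<in>S. Z p (\<pi> p)) = (\<Sum>g\<in>?r ` {\<pi>. \<pi> permutes S}. \<Prod>p\<in>S. Z p (g p))"
      by (subst sum.reindex[OF inj]) simp
    also have "\<dots> \<le> (\<Sum>g\<in>PiE S (\<lambda>_. F). \<Prod>p\<in>S. Z p (g p))"
    proof (rule sum_mono2)
      show "finite (PiE S (\<lambda>_. F))" using finS assms by (intro finite_PiE) auto
      show "?r ` {\<pi>. \<pi> permutes S} \<subseteq> PiE S (\<lambda>_. F)"
        using S permutes_in_image by (fastforce simp: PiE_def Pi_def)
    qed (auto intro: prod_nonneg nn)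
    also have "\<dots> = (\<Prod>p\<in>S. \<Sum>q\<in>F. Z p q)"
      using finS assms by (subst prod_sum_PiE) auto
    finally show ?thesis .
  qed
  then have "(\<Sum>S\<in>Pow F. \<Sum>\<pi> | \<pi> permutes S. \<Prod>p\<in>S. Z p (\<pi> p)) \<le> (\<Sum>S\<in>Pow F. \<Prod>p\<in>S. \<Sum>q\<in>F. Z p q)"
    by (rule sum_mono)
  also have "\<dots> = (\<Prod>p\<in>F. (\<Sum>q\<in>F. Z p q) + 1)"
    by (subst prod_add[OF assms(1)]) simp
  also have "\<dots> \<le> (\<Prod>p\<in>F. exp (\<Sum>q\<in>F. Z p q))"
    by (rule prod_mono) (auto simp: add.commute exp_ge_add_one_self intro!: sum_nonneg add_nonneg_nonneg nn)
  also have "\<dots> = exp (\<Sum>p\<in>F. \<Sum>q\<in>F. Z p q)"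
    by (simp add: exp_sum assms(1))
  finally show ?thesis .
qed

section \<open>Fredholm series of matrices with absolutely summable entries\<close>

lemma abs_summable_bounded:
  fixes f :: "'a \<Rightarrow> 'b::banach"
  assumes "\<And>F. finite F \<Longrightarrow> F \<subseteq> A \<Longrightarrow> (\<Sum>x\<in>F. norm (f x)) \<le> C"
  shows "f abs_summable_on A" "f summable_on A" "(\<Sum>\<^sub>\<infinity>x\<in>A. norm (f x)) \<le> C"
proof -
  show 1: "f abs_summable_on A"
    unfolding abs_summable_iff_bdd_above by (rule bdd_aboveI2[where M=C]) (use assms in auto)
  show "f summable_on A" using 1 by (rule abs_summable_summable)
  show "(\<Sum>\<^sub>\<infinity>x\<in>A. norm (f x)) \<le> C"
    using 1 assms by (intro infsum_le_finite_sums) auto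
qed

text \<open>
  Outside a large finite set both sums are at most the tail of \<open>h\<close>.
\<close>

lemma infsum_dominated_convergence:
  fixes f :: "'b \<Rightarrow> 'a \<Rightarrow> 'c::banach" and h :: "'a \<Rightarrow> real"
  assumes lim: "\<And>x. x \<in> A \<Longrightarrow> ((\<lambda>b. f b x) \<longlongrightarrow> g x) G"
    and bound: "\<And>b x. x \<in> A \<Longrightarrow> norm (f b x) \<le> h x"
    and h: "h summable_on A" and G: "G \<noteq> bot"
  shows "((\<lambda>b. infsum (f b) A) \<longlongrightarrow> infsum g A) G"
proof -
  have gbound: "norm (g x) \<le> h x" if "x \<in> A" for x
    using tendsto_upperbound[OF tendsto_norm[OF lim[OF that]] _ G] bound[OF that] by auto
  have sub: "h summable_on B" if "B \<subseteq> A" for B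
    using summable_on_subset_banach[OF h that] .
  have abs: "k abs_summable_on B" if "B \<subseteq> A" "\<And>x. x \<in> A \<Longrightarrow> norm (k x) \<le> h x" for k :: "'a \<Rightarrow> 'c" and B
    using that by (intro summable_on_comparison_test[OF sub[OF that(1)]]) auto
  have tail: "norm (infsum k B) \<le> infsum h B" if "B \<subseteq> A" "\<And>x. x \<in> A \<Longrightarrow> norm (k x) \<le> h x" for k :: "'a \<Rightarrow> 'c" and B
    using norm_infsum_bound[OF abs[OF that]] infsum_mono[OF abs[OF that] sub[OF that(1)]] that by force
  have split: "infsum k A = sum k X + infsum k (A - X)"
    if "X \<subseteq> A" "finite X" "\<And>x. x \<in> A \<Longrightarrow> norm (k x) \<le> h x" for k :: "'a \<Rightarrow> 'c" and X
  proof -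
    have "k summable_on A" using abs[OF order.refl that(3)] by (rule abs_summable_summable)
    then show ?thesis using infsum_Diff[of k A X] that(1,2) by simp
  qed
  show ?thesis
  proof (rule tendstoI)
    fix e :: real assume e: "e > 0"
    obtain X where X: "finite X" "X \<subseteq> A" "dist (sum h X) (infsum h A) \<le> e/4"
      using infsum_finite_approximation[OF h, of "e/4"] e by auto
    have hX: "infsum h (A - X) \<le> e/4"
    proof -
      have "infsum h (A - X) = infsum h A - sum h X"
        using infsum_Diff[OF h _ X(2)] X(1) by simp
      with X(3) show ?thesis unfolding dist_real_def by arith
    qed
    have "((\<lambda>b. sum (f b) X) \<longlongrightarrow> sum g X) G"
      using X by (intro tendsto_sum lim) auto
    then have "eventually (\<lambda>b. dist (sum (f b) X) (sum g X) < e/2) G"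
      using e by (intro tendstoD) auto
    then show "eventually (\<lambda>b. dist (infsum (f b) A) (infsum g A) < e) G"
    proof eventually_elim
      case (elim b)
      have "infsum (f b) A - infsum g A =
          (sum (f b) X - sum g X) + (infsum (f b) (A - X) - infsum g (A - X))"
        by (subst split[OF X(2,1) bound[of _ b]], simp, subst split[OF X(2,1) gbound]) auto
      then have "norm (infsum (f b) A - infsum g A) \<le>
          norm (sum (f b) X - sum g X) + (norm (infsum (f b) (A - X)) + norm (infsum g (A - X)))"
        by (simp only:) (rule order_trans[OF norm_triangle_ineq add_left_mono[OF norm_triangle_ineq4]])
      moreover have "norm (infsum (f b) (A - X)) \<le> e/4" "norm (infsum g (A - X)) \<le> e/4"
        using tail[of "A - X" "f b"] tail[of "A - X" g] bound gbound hX by auto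
      ultimately show ?case using elim by (simp add: dist_norm)
    qed
  qed
qed

lemma has_sum_finite_sum:
  fixes f :: "'b \<Rightarrow> 'a \<Rightarrow> 'c::topological_comm_monoid_add"
  assumes "finite F" "\<And>i. i \<in> F \<Longrightarrow> (f i has_sum s i) A"
  shows "((\<lambda>x. \<Sum>i\<in>F. f i x) has_sum (\<Sum>i\<in>F. s i)) A"
  using assms by (induction F rule: finite_induct) (auto intro: has_sum_add)

lemma summable_on_finite_sum:
  fixes f :: "'b \<Rightarrow> 'a \<Rightarrow> real"
  assumes "finite F" "\<And>i. i \<in> F \<Longrightarrow> f i summable_on A"
  shows "(\<lambda>x. \<Sum>i\<in>F. f i x) summable_on A"
    and "(\<Sum>\<^sub>\<infinity>x\<in>A. \<Sum>i\<in>F. f i x) = (\<Sum>i\<in>F. \<Sum>\<^sub>\<infinity>x\<in>A. f i x)"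
  using has_sum_finite_sum[of F f A "\<lambda>i. infsum (f i) A"] assms
  by (auto simp: has_sum_iff)

text \<open>
  The Fredholm determinant of \<open>1 + K\<close>.
\<close>

definition fdet :: "('i \<Rightarrow> 'i \<Rightarrow> complex) \<Rightarrow> complex" where
  "fdet K = (\<Sum>\<^sub>\<infinity>S\<in>{S. finite S}. minor K S)"

definition row_le :: "real \<Rightarrow> ('i \<Rightarrow> 'j \<Rightarrow> complex) \<Rightarrow> bool" where
  "row_le C M \<longleftrightarrow> (\<forall>p F. finite F \<longrightarrow> (\<Sum>q\<in>F. norm (M p q)) \<le> C)"

definition l1_le :: "real \<Rightarrow> ('i \<Rightarrow> 'i \<Rightarrow> real) \<Rightarrow> bool" where
  "l1_le C Z \<longleftrightarrow> (\<forall>p q. 0 \<le> Z p q) \<and> (\<forall>F. finite F \<longrightarrow> (\<Sum>p\<in>F. \<Sum>q\<in>F. Z p q) \<le> C)"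

text \<open>
  The sections on the left are \<open>\<Sum>S\<subseteq>F. minor (X F) S\<close> by \<open>sum_minors\<close>, and
  \<open>minor_perm_bound\<close> supplies a summable bound for the minors that is
  independent of \<open>F\<close>. The matrix \<open>X F\<close> may vary with \<open>F\<close>, because the sections of a
  product of matrices contain only partial sums of the entries of the product.
\<close>

lemma fdet_limit:
  fixes K :: "'i \<Rightarrow> 'i \<Rightarrow> complex" and X :: "'i set \<Rightarrow> 'i \<Rightarrow> 'i \<Rightarrow> complex"
  assumes Z: "l1_le C Z"
    and bound: "\<And>F p q. norm (X F p q) \<le> Z p q"
    and lim: "\<And>p q. ((\<lambda>F. X F p q) \<longlongrightarrow> K p q) (finite_subsets_at_top UNIV)"
  shows "((\<lambda>F. minor (\<lambda>p q. of_bool (p = q) + X F p q) F) \<longlongrightarrow> fdet K) (finite_subsets_at_top UNIV)"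
proof -
  define h where "h S = (\<Sum>\<pi> | \<pi> permutes S. \<Prod>p\<in>S. Z p (\<pi> p))" for S
  have nn: "0 \<le> Z p q" for p q using Z by (simp add: l1_le_def)
  have hnn: "0 \<le> h S" for S unfolding h_def by (intro sum_nonneg prod_nonneg nn)
  have hsum: "h summable_on {S. finite S}"
  proof (rule nonneg_bdd_above_summable_on)
    show "bdd_above (sum h ` {\<S>. \<S> \<subseteq> {S. finite S} \<and> finite \<S>})"
    proof (rule bdd_aboveI2[where M = "exp C"])
      fix \<S> :: "'i set set" assume S: "\<S> \<in> {\<S>. \<S> \<subseteq> {S. finite S} \<and> finite \<S>}"
      then have fin: "finite (\<Union>\<S>)" by auto
      have "sum h \<S> \<le> sum h (Pow (\<Union>\<S>))"
        using fin hnn by (intro sum_mono2) auto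
      also have "\<dots> \<le> exp (\<Sum>p\<in>\<Union>\<S>. \<Sum>q\<in>\<Union>\<S>. Z p q)"
        unfolding h_def by (rule minor_perm_bound[OF fin nn])
      also have "\<dots> \<le> exp C" using Z fin by (simp add: l1_le_def)
      finally show "sum h \<S> \<le> exp C" .
    qed
  qed (rule hnn)
  have mb: "norm (minor (X F) S) \<le> h S" for F S
  proof -
    have "norm (minor (X F) S) \<le> (\<Sum>\<pi> | \<pi> permutes S. norm (of_int (sign \<pi>) * (\<Prod>p\<in>S. X F p (\<pi> p))))"
      unfolding minor_def by (rule norm_sum)
    also have "\<dots> \<le> h S"
      unfolding h_def using bound
      by (intro sum_mono) (auto simp: norm_mult sign_def prod_norm[symmetric] intro!: prod_mono)
    finally show ?thesis .
  qed
  have ml: "((\<lambda>F. minor (X F) S) \<longlongrightarrow> minor K S) (finite_subsets_at_top UNIV)" for S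
    unfolding minor_def by (intro tendsto_intros lim)
  have "((\<lambda>F. \<Sum>\<^sub>\<infinity>S\<in>{S. finite S}. if S \<subseteq> F then minor (X F) S else 0) \<longlongrightarrow> fdet K) (finite_subsets_at_top UNIV)"
    unfolding fdet_def
  proof (rule infsum_dominated_convergence[OF _ _ hsum])
    fix S :: "'i set" assume S: "S \<in> {S. finite S}"
    show "((\<lambda>F. if S \<subseteq> F then minor (X F) S else 0) \<longlongrightarrow> minor K S) (finite_subsets_at_top UNIV)"
    proof (rule Lim_transform_eventually[OF ml])
      show "\<forall>\<^sub>F F in finite_subsets_at_top UNIV. minor (X F) S = (if S \<subseteq> F then minor (X F) S else 0)"
        unfolding eventually_finite_subsets_at_top using S by (intro exI[of _ S]) auto
    qed
  qed (use mb hnn in auto)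
  moreover have "\<forall>\<^sub>F F in finite_subsets_at_top UNIV.
      (\<Sum>\<^sub>\<infinity>S\<in>{S. finite S}. if S \<subseteq> F then minor (X F) S else 0) =
      minor (\<lambda>p q. of_bool (p = q) + X F p q) F"
    unfolding eventually_finite_subsets_at_top
  proof (intro exI[of _ "{}"] conjI allI impI; simp)
    fix F :: "'i set" assume F: "finite F"
    have "(\<Sum>\<^sub>\<infinity>S\<in>{S. finite S}. if S \<subseteq> F then minor (X F) S else 0) = (\<Sum>\<^sub>\<infinity>S\<in>Pow F. minor (X F) S)"
      using F by (intro infsum_cong_neutral) (auto dest: finite_subset)
    also have "\<dots> = minor (\<lambda>p q. of_bool (p = q) + X F p q) F"
      using F by (simp add: sum_minors)
    finally show "(\<Sum>\<^sub>\<infinity>S\<in>{S. finite S}. if S \<subseteq> F then minor (X F) S else 0) =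
      minor (\<lambda>p q. of_bool (p = q) + X F p q) F" .
  qed
  ultimately show ?thesis by (rule Lim_transform_eventually)
qed

definition mmul :: "('i \<Rightarrow> 'j \<Rightarrow> complex) \<Rightarrow> ('j \<Rightarrow> 'k \<Rightarrow> complex) \<Rightarrow> 'i \<Rightarrow> 'k \<Rightarrow> complex" where
  "mmul M N p q = (\<Sum>\<^sub>\<infinity>r. M p r * N r q)"

text \<open>
  The majorant of \<open>mmul M N\<close> that also dominates all partial sums of its entries.
\<close>

definition amul :: "('i \<Rightarrow> 'j \<Rightarrow> complex) \<Rightarrow> ('j \<Rightarrow> 'k \<Rightarrow> complex) \<Rightarrow> 'i \<Rightarrow> 'k \<Rightarrow> real" where
  "amul M N p q = (\<Sum>\<^sub>\<infinity>r. norm (M p r) * norm (N r q))"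

lemma row_le_nonneg:
  assumes "row_le C M" shows "0 \<le> C"
  using assms[unfolded row_le_def, rule_format, of "{}"] by simp

lemma row_le_entry:
  assumes "row_le C M" shows "norm (M p q) \<le> C"
  using assms[unfolded row_le_def, rule_format, of "{q}" p] by simp

lemma row_le_summable:
  assumes "row_le C M"
  shows "(\<lambda>q. norm (M p q)) summable_on UNIV" "(\<Sum>\<^sub>\<infinity>q. norm (M p q)) \<le> C"
  using abs_summable_bounded[of UNIV "M p" C] assms by (auto simp: row_le_def)

lemma summable_row_times_bounded:
  assumes "row_le C M" and "\<And>r. norm (b r) \<le> (D::real)"
  shows "(\<lambda>r. norm (M p r) * norm (b r)) summable_on UNIV"
  by (rule summable_on_comparison_test[OF summable_on_cmult_left[OF row_le_summable(1)[OF assms(1), of p], of D]])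
     (use assms in \<open>auto intro: mult_left_mono\<close>)

lemma amul_summable:
  assumes "row_le C M" "row_le D N"
  shows "(\<lambda>r. norm (M p r) * norm (N r q)) summable_on UNIV"
  using summable_row_times_bounded[OF assms(1) row_le_entry[OF assms(2)]] .

lemma mmul_summable:
  assumes "row_le C M" "row_le D N"
  shows "(\<lambda>r. M p r * N r q) summable_on UNIV"
  by (rule abs_summable_summable) (simp add: norm_mult amul_summable[OF assms])

lemma norm_partial_mmul_le_amul:
  assumes "row_le C M" "row_le D N"
  shows "norm (\<Sum>r\<in>F. M p r * N r q) \<le> amul M N p q"
proof (cases "finite F")
  case True
  have "norm (\<Sum>r\<in>F. M p r * N r q) \<le> (\<Sum>r\<in>F. norm (M p r) * norm (N r q))"
    by (rule order_trans[OF norm_sum]) (simp add: norm_mult)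
  also have "\<dots> \<le> amul M N p q"
    unfolding amul_def using amul_summable[OF assms] True by (intro finite_sum_le_infsum) auto
  finally show ?thesis .
qed (auto simp: amul_def intro!: infsum_nonneg)

lemma mmul_limit:
  assumes "row_le C M" "row_le D N"
  shows "((\<lambda>F. \<Sum>r\<in>F. M p r * N r q) \<longlongrightarrow> mmul M N p q) (finite_subsets_at_top UNIV)"
  unfolding mmul_def using mmul_summable[OF assms] by (rule infsum_tendsto)

lemma norm_mmul_le_amul:
  assumes "row_le C M" "row_le D N"
  shows "norm (mmul M N p q) \<le> amul M N p q"
  using tendsto_upperbound[OF tendsto_norm[OF mmul_limit[OF assms]]] norm_partial_mmul_le_amul[OF assms]
  by (metis (no_types, lifting) always_eventually finite_subsets_at_top_neq_bot)

lemma sum_amul_le: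
  assumes M: "row_le C M" and N: "row_le D N" and F: "finite F"
  shows "(\<Sum>q\<in>F. amul M N p q) \<le> D * (\<Sum>\<^sub>\<infinity>r. norm (M p r))"
proof -
  have "(\<Sum>q\<in>F. amul M N p q) = (\<Sum>\<^sub>\<infinity>r. \<Sum>q\<in>F. norm (M p r) * norm (N r q))"
    unfolding amul_def by (rule summable_on_finite_sum(2)[OF F amul_summable[OF M N], symmetric])
  also have "\<dots> \<le> (\<Sum>\<^sub>\<infinity>r. norm (M p r) * D)"
  proof (rule infsum_mono)
    show "(\<lambda>r. \<Sum>q\<in>F. norm (M p r) * norm (N r q)) summable_on UNIV"
      by (rule summable_on_finite_sum(1)[OF F amul_summable[OF M N]])
    show "(\<lambda>r. norm (M p r) * D) summable_on UNIV"
      using row_le_summable(1)[OF M] by (rule summable_on_cmult_left)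
    show "(\<Sum>q\<in>F. norm (M p r) * norm (N r q)) \<le> norm (M p r) * D" for r
      using N F unfolding sum_distrib_left[symmetric] row_le_def by (intro mult_left_mono) auto
  qed
  also have "\<dots> = D * (\<Sum>\<^sub>\<infinity>r. norm (M p r))"
    by (subst infsum_cmult_left') (rule mult.commute)
  finally show ?thesis .
qed

lemma row_le_mmul:
  assumes M: "row_le C M" and N: "row_le D N"
  shows "row_le (D * C) (mmul M N)"
  unfolding row_le_def
proof (intro allI impI)
  fix p and F :: "'c set" assume F: "finite F"
  have "(\<Sum>q\<in>F. norm (mmul M N p q)) \<le> (\<Sum>q\<in>F. amul M N p q)"
    by (intro sum_mono norm_mmul_le_amul[OF assms])
  also have "\<dots> \<le> D * (\<Sum>\<^sub>\<infinity>r. norm (M p r))" by (rule sum_amul_le[OF M N F])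
  also have "\<dots> \<le> D * C" using row_le_nonneg[OF N] row_le_summable(2)[OF M] by (intro mult_left_mono)
  finally show "(\<Sum>q\<in>F. norm (mmul M N p q)) \<le> D * C" .
qed

definition mtransp :: "('i \<Rightarrow> 'j \<Rightarrow> 'a) \<Rightarrow> 'j \<Rightarrow> 'i \<Rightarrow> 'a" where
  "mtransp M p q = M q p"

lemma mtransp_mtransp [simp]: "mtransp (mtransp M) = M"
  by (simp add: mtransp_def fun_eq_iff)

lemma mtransp_mmul: "mtransp (mmul M N) = mmul (mtransp N) (mtransp M)"
  by (simp add: mtransp_def mmul_def fun_eq_iff mult.commute)

lemma mtransp_amul: "mtransp (amul M N) = amul (mtransp N) (mtransp M)"
  by (simp add: mtransp_def amul_def fun_eq_iff mult.commute)

text \<open>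
  The double sum is dominated by the product of the three bounds. The index types may differ, so a
  bounded sequence is covered as a matrix \<open>L\<close> with a single column.
\<close>

lemma mmul_assoc:
  assumes M: "row_le A M" and N: "row_le B N" and L: "row_le C L"
  shows "mmul (mmul M N) L = mmul M (mmul N L)"
proof (intro ext)
  fix p q
  let ?f = "\<lambda>(r, s). M p r * N r s * L s q"
  have sum: "?f summable_on UNIV \<times> UNIV"
  proof (rule abs_summable_bounded(2))
    fix F :: "('b \<times> 'c) set" assume F: "finite F"
    let ?G = "fst ` F" and ?H = "snd ` F"
    have "(\<Sum>x\<in>F. norm (?f x)) \<le> (\<Sum>x\<in>?G \<times> ?H. norm (?f x))"
      using F by (intro sum_mono2) (auto intro: rev_image_eqI)
    also have "\<dots> = (\<Sum>r\<in>?G. norm (M p r) * (\<Sum>s\<in>?H. norm (N r s) * norm (L s q)))"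
      by (simp add: sum.cartesian_product' norm_mult sum_distrib_left mult.assoc)
    also have "\<dots> \<le> (\<Sum>r\<in>?G. norm (M p r) * (\<Sum>s\<in>?H. norm (N r s) * C))"
      using row_le_entry[OF L] by (intro sum_mono mult_left_mono) auto
    also have "\<dots> \<le> (\<Sum>r\<in>?G. norm (M p r) * (B * C))"
      using N row_le_nonneg[OF L] F
      by (intro sum_mono mult_left_mono)
         (auto simp: sum_distrib_right[symmetric] row_le_def intro!: mult_right_mono)
    also have "\<dots> \<le> A * (B * C)"
      using M row_le_nonneg[OF L] row_le_nonneg[OF N] F unfolding sum_distrib_right[symmetric] row_le_def
      by (intro mult_right_mono) auto
    finally show "(\<Sum>x\<in>F. norm (?f x)) \<le> A * (B * C)" .
  qed
  have "mmul M (mmul N L) p q = (\<Sum>\<^sub>\<infinity>r. \<Sum>\<^sub>\<infinity>s. M p r * N r s * L s q)"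
    unfolding mmul_def by (simp add: infsum_cmult_right'[symmetric] mult.assoc)
  also have "\<dots> = (\<Sum>\<^sub>\<infinity>s. \<Sum>\<^sub>\<infinity>r. M p r * N r s * L s q)"
    using sum by (rule infsum_swap_banach)
  also have "\<dots> = mmul (mmul M N) L p q"
    unfolding mmul_def by (simp add: infsum_cmult_left'[symmetric])
  finally show "mmul (mmul M N) L p q = mmul M (mmul N L) p q" ..
qed

definition absm :: "('i \<Rightarrow> 'j \<Rightarrow> complex) \<Rightarrow> 'i \<Rightarrow> 'j \<Rightarrow> real" where
  "absm K p q = norm (K p q)"

lemma l1_le_mtransp:
  assumes "l1_le C Z" shows "l1_le C (mtransp Z)"
proof -
  have "(\<Sum>p\<in>F. \<Sum>q\<in>F. Z q p) = (\<Sum>p\<in>F. \<Sum>q\<in>F. Z p q)" for F by (rule sum.swap)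
  then show ?thesis using assms by (simp add: l1_le_def mtransp_def)
qed

lemma l1_le_absm_row_le:
  assumes "l1_le C (absm K)" shows "row_le C K"
  unfolding row_le_def
proof (intro allI impI)
  fix p and F :: "'a set" assume F: "finite F"
  have "(\<Sum>q\<in>F. norm (K p q)) \<le> (\<Sum>q\<in>insert p F. norm (K p q))"
    using F by (intro sum_mono2) auto
  also have "\<dots> \<le> (\<Sum>r\<in>insert p F. \<Sum>q\<in>insert p F. norm (K r q))"
    using F by (intro member_le_sum) (auto intro: sum_nonneg)
  also have "\<dots> \<le> C" using assms F by (simp add: l1_le_def absm_def del: sum.insert)
  finally show "(\<Sum>q\<in>F. norm (K p q)) \<le> C" .
qed

text \<open>
  Summing over the column index first costs the factor \<open>D\<close> and leaves the sum of all
  entries of \<open>K\<close>.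
\<close>

lemma l1_le_amul_right:
  assumes K: "l1_le C (absm K)" and M: "row_le D M"
  shows "l1_le (D * C) (amul K M)"
  unfolding l1_le_def
proof (intro conjI allI impI)
  show "0 \<le> amul K M p q" for p q unfolding amul_def by (intro infsum_nonneg) auto
  fix F :: "'a set" assume F: "finite F"
  note KR = l1_le_absm_row_le[OF K]
  have "(\<Sum>p\<in>F. \<Sum>q\<in>F. amul K M p q) \<le> (\<Sum>p\<in>F. D * (\<Sum>\<^sub>\<infinity>r. norm (K p r)))"
    by (intro sum_mono sum_amul_le[OF KR M F])
  also have "\<dots> = D * (\<Sum>\<^sub>\<infinity>r. \<Sum>p\<in>F. norm (K p r))"
    by (simp add: sum_distrib_left summable_on_finite_sum(2)[OF F row_le_summable(1)[OF KR]])
  also have "\<dots> \<le> D * C"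
  proof (intro mult_left_mono infsum_le_finite_sums)
    show "(\<lambda>r. \<Sum>p\<in>F. norm (K p r)) summable_on UNIV"
      by (rule summable_on_finite_sum(1)[OF F row_le_summable(1)[OF KR]])
    fix G :: "'a set" assume G: "finite G"
    have "(\<Sum>r\<in>G. \<Sum>p\<in>F. norm (K p r)) = (\<Sum>p\<in>F. \<Sum>r\<in>G. norm (K p r))" by (rule sum.swap)
    also have "\<dots> \<le> (\<Sum>p\<in>F. \<Sum>r\<in>F\<union>G. norm (K p r))"
      using F G by (intro sum_mono sum_mono2) auto
    also have "\<dots> \<le> (\<Sum>p\<in>F\<union>G. \<Sum>r\<in>F\<union>G. norm (K p r))"
      using F G by (intro sum_mono2) (auto intro: sum_nonneg)
    also have "\<dots> \<le> C" using K F G by (simp add: l1_le_def absm_def)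
    finally show "(\<Sum>r\<in>G. \<Sum>p\<in>F. norm (K p r)) \<le> C" .
  qed (rule row_le_nonneg[OF M])
  finally show "(\<Sum>p\<in>F. \<Sum>q\<in>F. amul K M p q) \<le> D * C" .
qed

lemma l1_le_amul_left:
  assumes K: "l1_le C (absm K)" and M: "row_le D (mtransp M)"
  shows "l1_le (D * C) (amul M K)"
proof -
  have "absm (mtransp K) = mtransp (absm K)" by (simp add: absm_def mtransp_def fun_eq_iff)
  then have "l1_le (D * C) (amul (mtransp K) (mtransp M))"
    using l1_le_amul_right[of C "mtransp K" D "mtransp M"] l1_le_mtransp[OF K] M by simp
  then show ?thesis using l1_le_mtransp by (metis mtransp_amul mtransp_mtransp)
qed

lemma l1_le_mono:
  assumes "l1_le C Z" "\<And>p q. 0 \<le> Y p q" "\<And>p q. Y p q \<le> Z p q" shows "l1_le C Y"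
  unfolding l1_le_def
proof (intro conjI allI impI assms(2))
  fix F :: "'a set" assume "finite F"
  then have "(\<Sum>p\<in>F. \<Sum>q\<in>F. Z p q) \<le> C" using assms(1) by (simp add: l1_le_def)
  moreover have "(\<Sum>p\<in>F. \<Sum>q\<in>F. Y p q) \<le> (\<Sum>p\<in>F. \<Sum>q\<in>F. Z p q)" by (intro sum_mono assms(3))
  ultimately show "(\<Sum>p\<in>F. \<Sum>q\<in>F. Y p q) \<le> C" by linarith
qed

lemma l1_le_add:
  assumes "l1_le C Z" "l1_le D Y" shows "l1_le (C + D) (\<lambda>p q. Z p q + Y p q)"
  using assms unfolding l1_le_def by (auto simp: sum.distrib intro: add_mono)

lemma minor_cong: "(\<And>p q. p \<in> F \<Longrightarrow> q \<in> F \<Longrightarrow> M p q = N p q) \<Longrightarrow> minor M F = minor N F"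
  unfolding minor_def by (intro sum.cong prod.cong refl arg_cong2[where f="(*)"]) (auto simp: permutes_in_image)

text \<open>
  The section of \<open>(1 + K) (1 + L)\<close> in which the inner sum runs over \<open>F\<close> only is a product of
  finite matrices.
\<close>

lemma fdet_mult:
  assumes K: "l1_le C (absm K)" and L: "l1_le D (absm L)"
  shows "fdet (\<lambda>p q. K p q + L p q + mmul K L p q) = fdet K * fdet L"
proof -
  note KR = l1_le_absm_row_le[OF K] and LR = l1_le_absm_row_le[OF L]
  let ?Z = "\<lambda>p q. absm K p q + absm L p q + amul K L p q"
  let ?X = "\<lambda>F p q. K p q + L p q + (\<Sum>r\<in>F. K p r * L r q)"
  have "l1_le (C + D + D * C) ?Z" by (intro l1_le_add K L l1_le_amul_right LR)
  then have "((\<lambda>F. minor (\<lambda>p q. of_bool (p = q) + ?X F p q) F) \<longlongrightarrow>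
      fdet (\<lambda>p q. K p q + L p q + mmul K L p q)) (finite_subsets_at_top UNIV)"
  proof (rule fdet_limit)
    show "norm (?X F p q) \<le> ?Z p q" for F p q
      unfolding absm_def
      by (intro order_trans[OF norm_triangle_ineq] add_mono norm_triangle_ineq norm_partial_mmul_le_amul[OF KR LR])
    show "((\<lambda>F. ?X F p q) \<longlongrightarrow> K p q + L p q + mmul K L p q) (finite_subsets_at_top UNIV)" for p q
      by (intro tendsto_intros mmul_limit[OF KR LR])
  qed
  moreover have "\<forall>\<^sub>F F in finite_subsets_at_top UNIV.
     minor (\<lambda>p q. of_bool (p = q) + ?X F p q) F =
     minor (\<lambda>p q. of_bool (p = q) + K p q) F * minor (\<lambda>p q. of_bool (p = q) + L p q) F"
    unfolding eventually_finite_subsets_at_top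
  proof (intro exI[of _ "{}"] conjI allI impI; simp)
    fix F :: "'a set" assume F: "finite F"
    show "minor (\<lambda>p q. of_bool (p = q) + ?X F p q) F =
     minor (\<lambda>p q. of_bool (p = q) + K p q) F * minor (\<lambda>p q. of_bool (p = q) + L p q) F"
      unfolding minor_mult[OF F, symmetric]
    proof (rule minor_cong)
      fix p q assume pq: "p \<in> F" "q \<in> F"
      have "(\<Sum>r\<in>F. (of_bool (p = r) + K p r) * (of_bool (r = q) + L r q)) =
         (\<Sum>r\<in>F. of_bool (p = r) * of_bool (r = q)) + (\<Sum>r\<in>F. of_bool (p = r) * L r q)
         + (\<Sum>r\<in>F. K p r * of_bool (r = q)) + (\<Sum>r\<in>F. K p r * L r q)"
        by (simp add: algebra_simps sum.distrib)
      moreover have "F \<inter> {r. p = r} = {p}" "F \<inter> {r. r = q} = {q}" using pq by auto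
      ultimately show "of_bool (p = q) + ?X F p q = (\<Sum>r\<in>F. (of_bool (p = r) + K p r) * (of_bool (r = q) + L r q))"
        using F pq by simp
    qed
  qed
  ultimately have 1: "((\<lambda>F. minor (\<lambda>p q. of_bool (p = q) + K p q) F * minor (\<lambda>p q. of_bool (p = q) + L p q) F) \<longlongrightarrow>
      fdet (\<lambda>p q. K p q + L p q + mmul K L p q)) (finite_subsets_at_top UNIV)"
    by (rule Lim_transform_eventually)
  have 2: "((\<lambda>F. minor (\<lambda>p q. of_bool (p = q) + K p q) F) \<longlongrightarrow> fdet K) (finite_subsets_at_top UNIV)"
    if "l1_le C (absm K)" for K :: "'a \<Rightarrow> 'a \<Rightarrow> complex" and C
    by (rule fdet_limit[OF that]) (auto simp: absm_def)
  show ?thesis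
    using tendsto_unique[OF _ 1 tendsto_mult[OF 2[OF K] 2[OF L]]] by simp
qed

text \<open>
  Only \<open>K\<close> is summable here, but \<open>M\<close> always occurs next to it, and the product with \<open>K\<close> is a summable
  majorant.
\<close>

lemma fdet_sylvester:
  assumes K: "l1_le C (absm K)" and M: "row_le D M" and M': "row_le D' (mtransp M)"
  shows "fdet (mmul K M) = fdet (mmul M K)"
proof -
  note KR = l1_le_absm_row_le[OF K]
  have 1: "((\<lambda>F. minor (\<lambda>p q. of_bool (p = q) + (\<Sum>r\<in>F. K p r * M r q)) F) \<longlongrightarrow> fdet (mmul K M)) (finite_subsets_at_top UNIV)"
    by (rule fdet_limit[OF l1_le_amul_right[OF K M]])
       (intro norm_partial_mmul_le_amul[OF KR M] mmul_limit[OF KR M])+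
  have 2: "((\<lambda>F. minor (\<lambda>p q. of_bool (p = q) + (\<Sum>r\<in>F. M p r * K r q)) F) \<longlongrightarrow> fdet (mmul M K)) (finite_subsets_at_top UNIV)"
    by (rule fdet_limit[OF l1_le_amul_left[OF K M']])
       (intro norm_partial_mmul_le_amul[OF M KR] mmul_limit[OF M KR])+
  have "\<forall>\<^sub>F F in finite_subsets_at_top UNIV.
     minor (\<lambda>p q. of_bool (p = q) + (\<Sum>r\<in>F. K p r * M r q)) F =
     minor (\<lambda>p q. of_bool (p = q) + (\<Sum>r\<in>F. M p r * K r q)) F"
    unfolding eventually_finite_subsets_at_top
    by (intro exI[of _ "{}"] conjI allI impI; simp add: minor_sylvester[of _ K M])
  from tendsto_unique[OF _ Lim_transform_eventually[OF 1 this] 2] show ?thesis by simp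
qed

section \<open>The ring of matrices with bounded row and column sums\<close>

definition schur :: "('i \<Rightarrow> 'i \<Rightarrow> complex) \<Rightarrow> bool" where
  "schur M \<longleftrightarrow> (\<exists>C. row_le C M) \<and> (\<exists>C. row_le C (mtransp M))"

lemma row_le_add:
  assumes "row_le C M" "row_le D N" shows "row_le (C + D) (\<lambda>p q. M p q + N p q)"
  unfolding row_le_def
proof (intro allI impI)
  fix p and F :: "'b set" assume F: "finite F"
  have "(\<Sum>q\<in>F. norm (M p q + N p q)) \<le> (\<Sum>q\<in>F. norm (M p q)) + (\<Sum>q\<in>F. norm (N p q))"
    unfolding sum.distrib[symmetric] by (intro sum_mono norm_triangle_ineq)
  also have "\<dots> \<le> C + D" using assms F by (intro add_mono) (auto simp: row_le_def)
  finally show "(\<Sum>q\<in>F. norm (M p q + N p q)) \<le> C + D" .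
qed

lemma row_le_uminus: "row_le C M \<Longrightarrow> row_le C (\<lambda>p q. - M p q)"
  by (simp add: row_le_def)

lemma row_le_diag:
  assumes "\<And>p. norm (d p) \<le> C" shows "row_le C (\<lambda>p q. of_bool (p = q) * d p)"
  unfolding row_le_def
proof (intro allI impI)
  fix p :: 'a and F :: "'a set" assume F: "finite F"
  have "0 \<le> C" using assms norm_ge_zero order_trans by blast
  have "(\<Sum>q\<in>F. norm (of_bool (p = q) * d p)) = (\<Sum>q\<in>F \<inter> {p}. norm (of_bool (p = q) * d p))"
    using F by (intro sum.mono_neutral_right) auto
  also have "\<dots> \<le> C" using assms[of p] \<open>0 \<le> C\<close> by (cases "p \<in> F") auto
  finally show "(\<Sum>q\<in>F. norm (of_bool (p = q) * d p)) \<le> C" .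
qed

lemma schur_add: "schur M \<Longrightarrow> schur N \<Longrightarrow> schur (\<lambda>p q. M p q + N p q)"
  unfolding schur_def mtransp_def using row_le_add by blast

lemma schur_uminus: "schur M \<Longrightarrow> schur (\<lambda>p q. - M p q)"
  unfolding schur_def mtransp_def using row_le_uminus by blast

lemma schur_diag:
  assumes "\<And>p. norm (d p) \<le> C" shows "schur (\<lambda>p q. of_bool (p = q) * d p)"
proof -
  have "mtransp (\<lambda>p q. of_bool (p = q) * d p) = (\<lambda>p q. of_bool (p = q) * d p)"
    by (auto simp: mtransp_def fun_eq_iff)
  then show ?thesis unfolding schur_def using row_le_diag[of d C] assms by auto
qed

lemma schur_mmul:
  assumes "schur M" "schur N" shows "schur (mmul M N)"
  using assms unfolding schur_def mtransp_mmul by (meson row_le_mmul)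

typedef 'i smat = "{M :: 'i \<Rightarrow> 'i \<Rightarrow> complex. schur M}"
  morphisms entry Smat
  using schur_diag[of "\<lambda>_. 0" 0] by auto

setup_lifting type_definition_smat

lemma schur_entry [simp]: "schur (entry M)"
  using entry by auto

lemma smat_eqI: "(\<And>p q. entry M p q = entry N p q) \<Longrightarrow> M = N"
  by (simp add: entry_inject[symmetric] fun_eq_iff)

text \<open>
  Unbounded \<open>d\<close> would leave the type; the value \<open>0\<close> there is a default.
\<close>

lift_definition diag :: "('i \<Rightarrow> complex) \<Rightarrow> 'i smat" is
  "\<lambda>d p q. if bounded (range d) then of_bool (p = q) * d p else 0"
proof -
  fix d :: "'i \<Rightarrow> complex"
  show "schur (\<lambda>p q. if bounded (range d) then of_bool (p = q) * d p else 0)"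
  proof (cases "bounded (range d)")
    case True
    then obtain C where "\<And>p. norm (d p) \<le> C" by (auto simp: bounded_iff)
    then have "schur (\<lambda>p q. of_bool (p = q) * d p)" by (rule schur_diag)
    then show ?thesis using True by simp
  next
    case False
    then show ?thesis using schur_diag[of "\<lambda>_. 0" 0] by simp
  qed
qed

text \<open>
  The bounds on row and column sums make products well defined and associative; with them,
  operator identities become identities in a noncommutative ring.
\<close>

instantiation smat :: (type) ring_1
begin

lift_definition zero_smat :: "'a smat" is "\<lambda>p q. 0"
  using schur_diag[of "\<lambda>_. 0" 0] by simp

lift_definition one_smat :: "'a smat" is "\<lambda>p q. of_bool (p = q)"
  using schur_diag[of "\<lambda>_. 1" 1] by simp

lift_definition plus_smat :: "'a smat \<Rightarrow> 'a smat \<Rightarrow> 'a smat" is "\<lambda>M N p q. M p q + N p q"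
  by (rule schur_add)

lift_definition uminus_smat :: "'a smat \<Rightarrow> 'a smat" is "\<lambda>M p q. - M p q"
  by (rule schur_uminus)

definition minus_smat :: "'a smat \<Rightarrow> 'a smat \<Rightarrow> 'a smat" where
  "minus_smat M N = M + - N"

lift_definition times_smat :: "'a smat \<Rightarrow> 'a smat \<Rightarrow> 'a smat" is mmul
  by (rule schur_mmul)

lemma entry_times: "entry (M * N) = mmul (entry M) (entry N)"
  by (rule times_smat.rep_eq)

lemma smat_summable: "(\<lambda>r. entry M p r * entry N r q) summable_on UNIV"
proof -
  obtain C D where "row_le C (entry M)" "row_le D (entry N)"
    using schur_entry[of M] schur_entry[of N] by (auto simp: schur_def)
  then show ?thesis by (rule mmul_summable)
qed

lemma mmul_delta_left: "mmul (\<lambda>p q. of_bool (p = q) * d p) M p q = d p * M p q"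
  unfolding mmul_def
  by (subst infsum_cong_neutral[where T="{p}" and g="\<lambda>r. d p * M p q"]) auto

lemma mmul_delta_right: "mmul M (\<lambda>p q. of_bool (p = q) * d p) p q = M p q * d q"
  unfolding mmul_def
  by (subst infsum_cong_neutral[where T="{q}" and g="\<lambda>r. M p q * d q"]) auto

instance
proof
  fix A B C :: "'a smat"
  show "A * B * C = A * (B * C)"
  proof -
    obtain a b c where "row_le a (entry A)" "row_le b (entry B)" "row_le c (entry C)"
      using schur_entry[unfolded schur_def] by metis
    then show ?thesis
      by (intro smat_eqI) (simp add: entry_times mmul_assoc)
  qed
  show "1 * A = A"
    using mmul_delta_left[of "\<lambda>_. 1"] by (intro smat_eqI) (simp add: entry_times one_smat.rep_eq)
  show "A * 1 = A"
    using mmul_delta_right[of _ "\<lambda>_. 1"] by (intro smat_eqI) (simp add: entry_times one_smat.rep_eq)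
  show "A + B + C = A + (B + C)" "A + B = B + A" "0 + A = A" "- A + A = 0" "A - B = A + - B"
    by (auto intro!: smat_eqI simp: plus_smat.rep_eq zero_smat.rep_eq uminus_smat.rep_eq minus_smat_def)
  show "(A + B) * C = A * C + B * C"
    by (intro smat_eqI)
       (simp add: entry_times plus_smat.rep_eq mmul_def distrib_right infsum_add smat_summable)
  show "A * (B + C) = A * B + A * C"
    by (intro smat_eqI)
       (simp add: entry_times plus_smat.rep_eq mmul_def distrib_left infsum_add smat_summable)
  show "(0::'a smat) \<noteq> 1"
    by (simp add: entry_inject[symmetric] zero_smat.rep_eq one_smat.rep_eq fun_eq_iff)
qed

end

lemma entry_diag: "bounded (range d) \<Longrightarrow> entry (diag d) = (\<lambda>p q. of_bool (p = q) * d p)"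
  by (simp add: diag.rep_eq)

lemma entry_diag_times: "bounded (range d) \<Longrightarrow> entry (diag d * M) p q = d p * entry M p q"
  using mmul_delta_left[of d "entry M"] by (simp add: entry_times entry_diag)

lemma entry_times_diag: "bounded (range d) \<Longrightarrow> entry (M * diag d) p q = entry M p q * d q"
  using mmul_delta_right[of "entry M" d] by (simp add: entry_times entry_diag)

lemma entry_minus: "entry (M - N) p q = entry M p q - entry N p q"
  unfolding minus_smat_def plus_smat.rep_eq uminus_smat.rep_eq by simp

lemmas entry_simps = plus_smat.rep_eq uminus_smat.rep_eq entry_minus zero_smat.rep_eq one_smat.rep_eq

text \<open>
  The two-sided ideal of matrices with absolutely summable entries, on which determinants are
  defined.
\<close>

definition l1mat :: "'i smat \<Rightarrow> bool" where
  "l1mat K \<longleftrightarrow> (\<exists>C. l1_le C (absm (entry K)))"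

definition op_det :: "'i smat \<Rightarrow> complex" where
  "op_det T = fdet (entry (T - 1))"

lemma l1mat_times_right: 
  assumes "l1mat K" shows "l1mat (K * M)"
proof -
  obtain C D where C: "l1_le C (absm (entry K))" and D: "row_le D (entry M)"
    using assms schur_entry[of M] by (auto simp: l1mat_def schur_def)
  have "l1_le (D * C) (absm (entry (K * M)))"
    by (rule l1_le_mono[OF l1_le_amul_right[OF C D]])
       (auto simp: absm_def entry_times intro: norm_mmul_le_amul[OF l1_le_absm_row_le[OF C] D])
  then show ?thesis by (auto simp: l1mat_def)
qed

lemma l1mat_times_left: 
  assumes "l1mat K" shows "l1mat (M * K)"
proof -
  obtain C D D' where C: "l1_le C (absm (entry K))" and D: "row_le D (entry M)" "row_le D' (mtransp (entry M))"
    using assms schur_entry[of M] by (auto simp: l1mat_def schur_def)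
  have "l1_le (D' * C) (absm (entry (M * K)))"
    by (rule l1_le_mono[OF l1_le_amul_left[OF C D(2)]])
       (auto simp: absm_def entry_times intro: norm_mmul_le_amul[OF D(1) l1_le_absm_row_le[OF C]])
  then show ?thesis by (auto simp: l1mat_def)
qed

lemma l1mat_uminus: "l1mat K \<Longrightarrow> l1mat (- K)"
  by (simp add: l1mat_def absm_def[abs_def] entry_simps)

lemma l1mat_add: 
  assumes "l1mat K" "l1mat L" shows "l1mat (K + L)"
proof -
  obtain C D where C: "l1_le C (absm (entry K))" "l1_le D (absm (entry L))"
    using assms by (auto simp: l1mat_def)
  have "l1_le (C + D) (absm (entry (K + L)))"
    by (rule l1_le_mono[OF l1_le_add[OF C]]) (auto simp: absm_def entry_simps norm_triangle_ineq)
  then show ?thesis by (auto simp: l1mat_def)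
qed

lemma l1mat_diff: "l1mat K \<Longrightarrow> l1mat L \<Longrightarrow> l1mat (K - L)"
  unfolding minus_smat_def by (intro l1mat_add l1mat_uminus)

lemmas l1mat_intros = l1mat_times_right l1mat_times_left l1mat_uminus l1mat_add l1mat_diff

lemma op_det_mult:
  assumes "l1mat (S - 1)" "l1mat (T - 1)"
  shows "op_det (S * T) = op_det S * op_det T" "l1mat (S * T - 1)"
proof -
  have eq: "S * T - 1 = (S - 1) + (T - 1) + (S - 1) * (T - 1)" by (simp add: algebra_simps)
  show "l1mat (S * T - 1)" unfolding eq by (intro l1mat_intros assms)
  obtain C D where C: "l1_le C (absm (entry (S - 1)))" "l1_le D (absm (entry (T - 1)))"
    using assms by (auto simp: l1mat_def)
  show "op_det (S * T) = op_det S * op_det T"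
    unfolding op_det_def eq fdet_mult[OF C, symmetric]
    by (simp add: plus_smat.rep_eq entry_times)
qed

lemma op_det_sylvester:
  assumes "l1mat K" shows "op_det (1 + K * M) = op_det (1 + M * K)"
proof -
  obtain C D D' where "l1_le C (absm (entry K))" "row_le D (entry M)" "row_le D' (mtransp (entry M))"
    using assms schur_entry[of M] by (auto simp: l1mat_def schur_def)
  from fdet_sylvester[OF this] show ?thesis by (simp add: op_det_def entry_times)
qed

text \<open>
  Cyclic invariance gives this for every invertible \<open>C\<close>, whereas multiplicativity would require
  \<open>C - 1\<close> to be in the ideal.
\<close>

lemma op_det_conj:
  assumes T: "l1mat (T - 1)" and C: "C' * C = 1" "C * C' = 1"
  shows "op_det (C * T * C') = op_det T" "l1mat (C * T * C' - 1)"
proof -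
  have eq: "C * T * C' = 1 + C * ((T - 1) * C')" using C by (simp add: algebra_simps)
  have "op_det (C * T * C') = op_det (1 + ((T - 1) * C') * C)"
    unfolding eq by (rule op_det_sylvester[symmetric]) (intro l1mat_intros T)
  also have "1 + ((T - 1) * C') * C = T" using C by (simp add: mult.assoc)
  finally show "op_det (C * T * C') = op_det T" .
  show "l1mat (C * T * C' - 1)" unfolding eq by (simp add: l1mat_intros T)
qed

text \<open>
  \<open>h\<close> assigns each index its block number. Taking \<open>-h\<close> instead gives upper triangular matrices.
\<close>

definition lower :: "('i \<Rightarrow> int) \<Rightarrow> 'i smat \<Rightarrow> bool" where
  "lower h M \<longleftrightarrow> (\<forall>p q. h p < h q \<longrightarrow> entry M p q = 0)"

definition strictly_lower :: "('i \<Rightarrow> int) \<Rightarrow> 'i smat \<Rightarrow> bool" where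
  "strictly_lower h M \<longleftrightarrow> (\<forall>p q. h p \<le> h q \<longrightarrow> entry M p q = 0)"

lemma strictly_lower_times_right:
  assumes M: "strictly_lower h M" and N: "lower h N" shows "strictly_lower h (M * N)"
  unfolding strictly_lower_def entry_times mmul_def
proof (intro allI impI infsum_0)
  fix p q r assume pq: "h p \<le> h q"
  show "entry M p r * entry N r q = 0"
  proof (cases "h p \<le> h r")
    case True then show ?thesis using M by (simp add: strictly_lower_def)
  next
    case False then show ?thesis using N pq by (simp add: lower_def)
  qed
qed

lemma strictly_lower_times_left:
  assumes M: "lower h M" and N: "strictly_lower h N" shows "strictly_lower h (M * N)"
  unfolding strictly_lower_def entry_times mmul_def
proof (intro allI impI infsum_0)
  fix p q r assume pq: "h p \<le> h q"
  show "entry M p r * entry N r q = 0"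
  proof (cases "h r \<le> h q")
    case True then show ?thesis using N by (simp add: strictly_lower_def)
  next
    case False then show ?thesis using M pq by (simp add: lower_def)
  qed
qed

lemma lower_diag: "lower h (diag d)"
  by (auto simp: lower_def diag.rep_eq)

text \<open>
  Each entry of \<open>M\<close> is multiplied by the difference of two diagonal entries, which vanishes inside
  the diagonal blocks.
\<close>

lemma strictly_lower_commutator:
  assumes "lower h M" "bounded (range d)" "\<And>p q. h p = h q \<Longrightarrow> d p = d q"
  shows "strictly_lower h (diag d * M - M * diag d)"
  unfolding strictly_lower_def
proof (intro allI impI)
  fix p q assume "h p \<le> h q"
  then show "entry (diag d * M - M * diag d) p q = 0"
    using assms(1) assms(3)[of p q]
    by (cases "h p = h q") (auto simp: entry_minus entry_diag_times entry_times_diag assms(2) lower_def)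
qed

text \<open>
  No permutation of a nonempty set strictly decreases the block number at an index where it is
  minimal, so only the empty minor survives.
\<close>

lemma fdet_strictly_triangular:
  fixes h :: "'i \<Rightarrow> int"
  assumes "\<And>p q. h p \<le> h q \<Longrightarrow> K p q = 0"
  shows "fdet K = 1"
proof -
  have "minor K S = 0" if S: "finite S" "S \<noteq> {}" for S
    unfolding minor_def
  proof (rule sum.neutral, rule ballI)
    fix \<pi> assume "\<pi> \<in> {\<pi>. \<pi> permutes S}"
    then have pi: "\<pi> permutes S" by simp
    define m where "m = Min (h ` S)"
    have "m \<in> h ` S" unfolding m_def using S by (intro Min_in) auto
    then obtain p where p: "p \<in> S" "h p = m" by auto
    have "\<pi> p \<in> S" using permutes_in_image[OF pi] p by auto
    then have "h p \<le> h (\<pi> p)" using S p by (simp add: m_def)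
    then have "K p (\<pi> p) = 0" by (rule assms)
    then have "(\<Prod>p\<in>S. K p (\<pi> p)) = 0" using S p by (intro prod_zero) auto
    then show "of_int (sign \<pi>) * (\<Prod>p\<in>S. K p (\<pi> p)) = 0" by simp
  qed
  then have "fdet K = (\<Sum>\<^sub>\<infinity>S\<in>{{}}. minor K S)"
    unfolding fdet_def by (intro infsum_cong_neutral) auto
  then show ?thesis by (simp add: minor_def)
qed

lemma op_det_unipotent:
  assumes "strictly_lower h (T - 1)" shows "op_det T = 1"
  unfolding op_det_def using assms by (intro fdet_strictly_triangular[of h]) (auto simp: strictly_lower_def)

lemma fdet_finite_diagonal:
  assumes F: "finite F" and d: "\<And>p. p \<notin> F \<Longrightarrow> d p = 1"
  shows "fdet (\<lambda>p q. of_bool (p = q) * (d p - 1)) = (\<Prod>p\<in>F. d p)"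
proof -
  let ?K = "\<lambda>p q. of_bool (p = q) * (d p - 1)"
  have minor_K: "minor ?K S = (\<Prod>p\<in>S. d p - 1)" if S: "finite S" for S
  proof -
    have "minor ?K S = (\<Sum>\<pi>\<in>{id}. of_int (sign \<pi>) * (\<Prod>p\<in>S. ?K p (\<pi> p)))"
      unfolding minor_def
    proof (rule sum.mono_neutral_right)
      show "finite {\<pi>. \<pi> permutes S}" using S by (rule finite_permutations)
      show "{id} \<subseteq> {\<pi>. \<pi> permutes S}" by (simp add: permutes_id)
      show "\<forall>\<pi>\<in>{\<pi>. \<pi> permutes S} - {id}. of_int (sign \<pi>) * (\<Prod>p\<in>S. ?K p (\<pi> p)) = 0"
      proof
        fix \<pi> assume pi: "\<pi> \<in> {\<pi>. \<pi> permutes S} - {id}"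
        then obtain p where "\<pi> p \<noteq> p" by (auto simp: fun_eq_iff)
        moreover from this pi have "p \<in> S" by (auto dest: permutes_not_in)
        ultimately have "(\<Prod>p\<in>S. ?K p (\<pi> p)) = 0" using S by (intro prod_zero) (auto intro!: bexI[of _ p])
        then show "of_int (sign \<pi>) * (\<Prod>p\<in>S. ?K p (\<pi> p)) = 0" by simp
      qed
    qed
    then show ?thesis by simp
  qed
  have "fdet ?K = (\<Sum>\<^sub>\<infinity>S\<in>Pow F. \<Prod>p\<in>S. d p - 1)"
    unfolding fdet_def
  proof (rule infsum_cong_neutral)
    fix S assume "S \<in> {S. finite S} - Pow F"
    then obtain p where p: "p \<in> S" "p \<notin> F" and S: "finite S" by auto
    have "(\<Prod>p\<in>S. d p - 1) = 0" using d[OF p(2)] by (intro prod_zero S bexI[OF _ p(1)]) simp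
    then show "minor ?K S = 0" using minor_K[OF S] by simp
  qed (use F in \<open>auto dest: finite_subset simp: minor_K\<close>)
  also have "\<dots> = (\<Sum>S\<in>Pow F. (\<Prod>p\<in>S. d p - 1) * (\<Prod>p\<in>F-S. 1))" using F by simp
  also have "\<dots> = (\<Prod>p\<in>F. d p)" using prod_add[OF F, of "\<lambda>p. d p - 1" "\<lambda>_. 1"] by simp
  finally show ?thesis .
qed

section \<open>The determinant formula for a pair of idempotents\<close>

lemma bounded_range_mult:
  fixes d e :: "'i \<Rightarrow> complex"
  assumes "bounded (range d)" "bounded (range e)"
  shows "bounded (range (\<lambda>i. d i * e i))"
proof -
  obtain C D where C: "\<And>i. norm (d i) \<le> C" and D: "\<And>i. norm (e i) \<le> D"
    using assms by (auto simp: bounded_iff)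
  have "norm (d i * e i) \<le> C * D" for i
    unfolding norm_mult by (intro mult_mono C D order_trans[OF norm_ge_zero C]) auto
  then show ?thesis by (intro boundedI[where B="C * D"]) auto
qed

lemma diag_times:
  assumes "bounded (range d)" "bounded (range e)"
  shows "diag d * diag e = diag (\<lambda>i. d i * e i)"
proof -
  have "bounded (range (\<lambda>i. d i * e i))"
    using bounded_range_mult[OF assms] .
  then show ?thesis
    using assms by (intro smat_eqI) (auto simp: entry_diag_times entry_diag)
qed

lemma diag_one: "diag (\<lambda>_. 1) = 1"
  by (intro smat_eqI) (simp add: entry_diag entry_simps)

text \<open>
  Scalars as central elements of the ring, which has no scalar multiplication of its own.
\<close>

definition scal :: "complex \<Rightarrow> 'i smat" where
  "scal s = diag (\<lambda>_. s)"

definition cut :: "'i set \<Rightarrow> 'i smat" where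
  "cut X = diag (\<lambda>i. of_bool (i \<in> X))"

lemma bounded_range_of_bool [simp]: "bounded (range (\<lambda>i. of_bool (i \<in> X) :: complex))"
  by (rule boundedI[where B=1]) auto

lemma entry_cut: "entry (cut X) p q = of_bool (p = q \<and> p \<in> X)"
  by (auto simp: cut_def entry_diag)

lemma entry_cut_times: "entry (cut X * M) p q = of_bool (p \<in> X) * entry M p q"
  by (simp add: cut_def entry_diag_times)

lemma entry_times_cut: "entry (M * cut X) p q = entry M p q * of_bool (q \<in> X)"
  by (simp add: cut_def entry_times_diag)

lemma entry_scal_times: "entry (scal s * M) p q = s * entry M p q"
  by (simp add: scal_def entry_diag_times)

lemma scal_central: "M * scal s = scal s * M"
  by (intro smat_eqI) (simp add: scal_def entry_times_diag entry_diag_times)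

lemma cut_idem: "cut X * cut X = cut X"
  by (intro smat_eqI) (simp add: entry_cut_times entry_cut)

lemma l1mat_finite_diag:
  assumes F: "finite F" and d: "\<And>i. i \<notin> F \<Longrightarrow> d i = 0" and b: "bounded (range d)"
  shows "l1mat (diag d)"
proof -
  have "l1_le (\<Sum>i\<in>F. norm (d i)) (absm (entry (diag d)))"
    unfolding l1_le_def
  proof (intro conjI allI impI)
    fix G :: "'a set" assume G: "finite G"
    have "(\<Sum>p\<in>G. \<Sum>q\<in>G. absm (entry (diag d)) p q) = (\<Sum>p\<in>G. norm (d p))"
    proof (rule sum.cong[OF refl])
      fix p assume p: "p \<in> G"
      have "(\<Sum>q\<in>G. absm (entry (diag d)) p q) = (\<Sum>q\<in>{p}. absm (entry (diag d)) p q)"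
        using G p by (intro sum.mono_neutral_right) (auto simp: absm_def entry_diag[OF b])
      then show "(\<Sum>q\<in>G. absm (entry (diag d)) p q) = norm (d p)"
        by (simp add: absm_def entry_diag[OF b])
    qed
    also have "\<dots> = (\<Sum>p\<in>G \<inter> F. norm (d p))"
      using G d by (intro sum.mono_neutral_right) auto
    also have "\<dots> \<le> (\<Sum>p\<in>F. norm (d p))" using F by (intro sum_mono2) auto
    finally show "(\<Sum>p\<in>G. \<Sum>q\<in>G. absm (entry (diag d)) p q) \<le> (\<Sum>i\<in>F. norm (d i))" .
  qed (simp add: absm_def)
  then show ?thesis by (auto simp: l1mat_def)
qed

lemma l1mat_cut_diff:
  assumes "finite {i. (i \<in> X) \<noteq> (i \<in> Y)}" shows "l1mat (cut X - cut Y)"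
proof -
  have b: "bounded (range (\<lambda>i. of_bool (i \<in> X) - of_bool (i \<in> Y) :: complex))"
    by (rule boundedI[where B=1]) auto
  have "cut X - cut Y = diag (\<lambda>i. of_bool (i \<in> X) - of_bool (i \<in> Y))"
    by (intro smat_eqI) (simp add: entry_minus entry_cut entry_diag[OF b])
  moreover have "l1mat \<dots>" by (rule l1mat_finite_diag[OF assms _ b]) auto
  ultimately show ?thesis by simp
qed

lemma op_det_finite_diag:
  assumes F: "finite F" and d: "\<And>i. i \<notin> F \<Longrightarrow> d i = 1" and b: "bounded (range d)"
  shows "op_det (diag d) = (\<Prod>i\<in>F. d i)" "l1mat (diag d - 1)"
proof -
  have b': "bounded (range (\<lambda>i. d i - 1))"
    using bounded_minus_comp[OF b, of "\<lambda>_. 1"] by (simp add: o_def)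
  have eq: "entry (diag d - 1) = (\<lambda>p q. of_bool (p = q) * (d p - 1))"
    by (auto simp: fun_eq_iff entry_simps entry_diag[OF b])
  show "op_det (diag d) = (\<Prod>i\<in>F. d i)"
    unfolding op_det_def eq by (rule fdet_finite_diagonal[OF F d])
  have "diag d - 1 = diag (\<lambda>i. d i - 1)"
    by (intro smat_eqI) (simp add: eq entry_diag[OF b'])
  then show "l1mat (diag d - 1)" using l1mat_finite_diag[OF F _ b'] d by simp
qed

text \<open>
  Both determinant formulas are instances of this. The two corner projections are \<open>cut X\<close> and \<open>cut Y\<close>, and
  \<open>A = V U\<close> is the triangular factorization; the commutator conditions say that \<open>cut X\<close> meets
  the factors only in Hankel blocks with summable entries.
\<close>

theorem det_idempotent_difference:
  fixes A B U U' V V' :: "'i smat" and h :: "'i \<Rightarrow> int" and s :: complex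
  assumes A: "A = V * U" and B: "B = U' * V'"
    and U: "U * U' = 1" "U' * U = 1" and V: "V * V' = 1" "V' * V = 1"
    and lower: "lower h U" "lower h U'" "lower (\<lambda>i. - h i) V" "lower (\<lambda>i. - h i) V'"
    and X: "\<And>i j. h i = h j \<Longrightarrow> i \<in> X \<longleftrightarrow> j \<in> X"
    and comm: "l1mat (cut X * U - U * cut X)" "l1mat (cut X * V - V * cut X)"
    and Y: "finite {i. (i \<in> X) \<noteq> (i \<in> Y)}"
    and s: "s \<noteq> -1"
  shows "op_det (1 + scal s * cut X - scal s * (A * cut Y * B)) =
    (\<Prod>i | (i \<in> X) \<noteq> (i \<in> Y). (1 + s * of_bool (i \<in> X)) / (1 + s * of_bool (i \<in> Y))) *
    op_det (1 - scal (s\<^sup>2) * (cut Y * B * (1 - cut X) * A * cut Y))"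
proof -
  define P R S where "P = cut X" and "R = cut Y" and "S = (scal s :: 'i smat)"
  define f where "f Z i = 1 + s * of_bool (i \<in> Z)" for Z and i :: 'i
  have f_nz: "f Z i \<noteq> 0" for Z i
    using s by (cases "i \<in> Z") (auto simp: f_def add_eq_0_iff)
  have bf: "bounded (range (f Z))" "bounded (range (\<lambda>i. inverse (f Z i)))" for Z
    by (rule boundedI[where B="1 + norm s"], auto simp: f_def intro: norm_triangle_mono)
       (rule boundedI[where B="max 1 (norm (inverse (1 + s)))"], auto simp: f_def)
  define p p' r r' where "p = diag (f X)" and "p' = diag (\<lambda>i. inverse (f X i))"
    and "r = diag (f Y)" and "r' = diag (\<lambda>i. inverse (f Y i))"
  have pp: "p * p' = 1" "p' * p = 1" and rr: "r * r' = 1" "r' * r = 1"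
    using f_nz by (simp_all add: p_def p'_def r_def r'_def diag_times bf diag_one)
  have f_eq: "diag (f Z) = 1 + S * cut Z" for Z
    by (intro smat_eqI) (auto simp: entry_diag[OF bf(1)] S_def entry_simps entry_scal_times entry_cut f_def)
  have p_eq: "p = 1 + S * P" and r_eq: "r = 1 + S * R"
    by (simp_all add: p_def r_def P_def R_def f_eq)
  have S_central: "M * S = S * M" "M * (S * N) = S * (M * N)" for M N
    by (simp_all add: S_def scal_central mult.assoc[symmetric])
  \<comment> \<open>Only the instances at matrices other than \<open>S\<close> itself terminate as rewrite rules.\<close>
  note S_comm = S_central[of P] S_central[of R] S_central[of A] S_central[of B]
  have AB: "A * B = 1" "B * A = 1"
    using U V by (simp_all add: A B mult.assoc) (simp_all add: mult.assoc[symmetric])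
  have P2: "P * P = P" "P * (P * Z) = P * Z" and R2: "R * R = R" "R * (R * Z) = R * Z" for Z
    by (simp_all add: P_def R_def cut_idem mult.assoc[symmetric])
  have AB2: "A * (B * Z) = Z" "B * (A * Z) = Z" for Z
    using AB by (simp_all add: mult.assoc[symmetric])
  define F where "F = A * R * B"
  have F2: "F * F = F" "F * (F * Z) = F * Z" for Z
    by (simp_all add: F_def mult.assoc AB2 R2)
  note S_comm = S_comm S_central[of F]
  define T where "T = 1 + S * P - S * F"
  \<comment> \<open>Written as \<open>1 + K M\<close> with \<open>K\<close> in the ideal, ready for cyclic invariance.\<close>
  define W where "W = 1 + (1 - P) * A * R * (- (S * S * (R * B)))"
  have W_eq: "W = 1 - S * (S * (F - P * F))"
    by (simp add: W_def F_def algebra_simps S_comm R2)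
  have ArB: "A * r * B = 1 + S * F"
    by (simp add: r_eq F_def algebra_simps S_comm AB AB2)
  have TW: "T * (A * r * B) = p * W"
    unfolding ArB T_def W_eq p_eq by (simp add: algebra_simps S_comm F2 P2)
  have inv: "(A * r * B) * (A * r' * B) = 1"
  proof -
    have "(A * r * B) * (A * r' * B) = A * ((r * r') * B)" by (simp add: mult.assoc AB2)
    then show ?thesis using rr AB by simp
  qed
  define G where "G = p * A * r' * B"
  have T_fact: "T = (p * W * p') * G"
  proof -
    have "T = T * ((A * r * B) * (A * r' * B))" by (simp add: inv)
    also have "\<dots> = p * W * (A * r' * B)" by (simp add: mult.assoc[symmetric] TW[symmetric])
    also have "\<dots> = (p * W * p') * (p * (A * r' * B))"
    proof -
      have "p' * (p * Z) = Z" for Z using pp by (simp add: mult.assoc[symmetric])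
      then show ?thesis by (simp add: mult.assoc)
    qed
    finally show ?thesis by (simp add: G_def mult.assoc)
  qed
  have commA: "l1mat (P * A - A * P)"
  proof -
    have "P * A - A * P = (P * V - V * P) * U + V * (P * U - U * P)"
      by (simp add: A algebra_simps)
    then show ?thesis using comm unfolding P_def by (simp add: l1mat_intros)
  qed
  have offdiag: "l1mat ((1 - P) * A * R)"
  proof -
    have "(1 - P) * A * R = (1 - P) * (- (P * A - A * P)) + (1 - P) * A * (- (P - R))"
      by (simp add: algebra_simps P2)
    then show ?thesis using commA l1mat_cut_diff[OF Y] unfolding P_def R_def
      by (simp only: l1mat_intros)
  qed
  have W_l1: "l1mat (W - 1)" unfolding W_def using offdiag by (simp add: l1mat_intros)
  have det_W: "op_det W = op_det (1 - scal (s\<^sup>2) * (cut Y * B * (1 - cut X) * A * cut Y))"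
  proof -
    have "op_det W = op_det (1 + (- (S * S * (R * B))) * ((1 - P) * A * R))"
      unfolding W_def by (rule op_det_sylvester[OF offdiag])
    also have "S * S = scal (s\<^sup>2)"
      by (simp add: S_def scal_def diag_times power2_eq_square)
    finally show ?thesis by (simp add: P_def R_def mult.assoc)
  qed
  have comm_p: "l1mat (p * M - M * p)" if "l1mat (P * M - M * P)" for M
  proof -
    have "p * M - M * p = S * (P * M - M * P)" by (simp add: p_eq algebra_simps S_central[of M])
    then show ?thesis using that by (simp add: l1mat_intros)
  qed
  have lower_p': "lower g p'" for g :: "'i \<Rightarrow> int" unfolding p'_def by (rule lower_diag)
  have strict: "strictly_lower g (p * M - M * p)"
    if "lower g M" "\<And>i j. g i = g j \<Longrightarrow> i \<in> X \<longleftrightarrow> j \<in> X" for g :: "'i \<Rightarrow> int" and M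
    unfolding p_def by (rule strictly_lower_commutator[OF that(1) bf(1)]) (drule that(2), simp add: f_def)
  define Y1 Y2 where "Y1 = V' * p * V * p'" and "Y2 = p * U * p' * U'"
  have Y1: "Y1 - 1 = V' * (p * V - V * p) * p'"
    using V pp by (simp add: Y1_def algebra_simps)
  have Y2: "Y2 - 1 = (p * U - U * p) * p' * U'"
  proof -
    have "U * p * p' * U' = U * ((p * p') * U')" by (simp only: mult.assoc)
    then have "U * p * p' * U' = 1" using pp U by simp
    then show ?thesis by (simp add: Y2_def algebra_simps)
  qed
  have Y1_l1: "l1mat (Y1 - 1)"
    unfolding Y1 by (intro l1mat_times_right l1mat_times_left comm_p) (use comm P_def in simp)
  have "strictly_lower (\<lambda>i. - h i) (Y1 - 1)"
    unfolding Y1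
    by (intro strictly_lower_times_right[OF strictly_lower_times_left[OF lower(4) strict[OF lower(3)]] lower_p'] X)
       simp
  then have det_Y1: "op_det Y1 = 1" by (rule op_det_unipotent)
  have Y2_l1: "l1mat (Y2 - 1)"
    unfolding Y2 by (intro l1mat_times_right comm_p) (use comm P_def in simp)
  have "strictly_lower h (Y2 - 1)"
    unfolding Y2
    by (intro strictly_lower_times_right[OF strictly_lower_times_right[OF strict[OF lower(1)] lower_p'] lower(2)] X)
  then have det_Y2: "op_det Y2 = 1" by (rule op_det_unipotent)
  define D where "D = diag (\<lambda>i. f X i * inverse (f Y i))"
  have D_eq: "D = p * r'" by (simp add: D_def p_def r'_def diag_times bf)
  have bD: "bounded (range (\<lambda>i. f X i * inverse (f Y i)))"
    by (rule bounded_range_mult[OF bf])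
  have D: "op_det D = (\<Prod>i | (i \<in> X) \<noteq> (i \<in> Y). f X i * inverse (f Y i))" "l1mat (D - 1)"
    unfolding D_def
    by (rule op_det_finite_diag[OF Y _ bD]; use f_nz in \<open>auto simp: f_def\<close>)+
  \<comment> \<open>The first factor is \<open>p A p\<^sup>-\<^sup>1 B\<close>, conjugated by \<open>V\<close> into unipotent form.\<close>
  have G_fact: "G = (V * (Y1 * Y2) * V') * (A * D * B)"
  proof -
    have c: "V * (V' * Z) = Z" "V' * (V * Z) = Z" "U' * (U * Z) = Z" "p' * (p * Z) = Z" for Z
      using V U pp by (simp_all add: mult.assoc[symmetric])
    show ?thesis
      by (simp add: G_def D_eq Y1_def Y2_def A B mult.assoc c)
  qed
  have Y12: "l1mat (Y1 * Y2 - 1)" "op_det (Y1 * Y2) = 1"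
    using op_det_mult[OF Y1_l1 Y2_l1] det_Y1 det_Y2 by simp_all
  have "op_det G = op_det D" and G_l1: "l1mat (G - 1)"
    unfolding G_fact
    using op_det_mult[OF op_det_conj(2)[OF Y12(1) V(2,1)] op_det_conj(2)[OF D(2) AB(2,1)]]
      op_det_conj(1)[OF Y12(1) V(2,1)] op_det_conj(1)[OF D(2) AB(2,1)] Y12(2) by simp_all
  moreover have "op_det T = op_det W * op_det G"
    unfolding T_fact
    using op_det_mult(1)[OF op_det_conj(2)[OF W_l1 pp(2,1)] G_l1] op_det_conj(1)[OF W_l1 pp(2,1)] by simp
  ultimately show ?thesis
    unfolding det_W D(1) T_def S_def P_def F_def R_def f_def by (simp add: divide_inverse mult.commute)
qed

section \<open>Uniqueness of Fourier coefficients\<close>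

no_notation vec_index (infixl "$" 100)

definition bdd_meas :: "(real \<Rightarrow> complex) \<Rightarrow> bool" where
  "bdd_meas f \<longleftrightarrow> f \<in> borel_measurable angle_measure \<and> (\<exists>C. AE t in angle_measure. norm (f t) \<le> C)"

text \<open>
  The Fourier coefficient without the factor \<open>1 / (2 pi)\<close>.
\<close>

definition fint :: "(real \<Rightarrow> complex) \<Rightarrow> int \<Rightarrow> complex" where
  "fint f k = (LINT t|angle_measure. f t * cis (- (of_int k * t)))"

lemma finite_angle_measure: "finite_measure angle_measure"
  by (intro finite_measure_lebesgue_on) simp

lemma bdd_meas_integrable: "bdd_meas f \<Longrightarrow> integrable angle_measure f"
  unfolding bdd_meas_def by (auto intro: finite_measure.integrable_const_bound[OF finite_angle_measure])

lemma bdd_meas_continuous: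
  assumes "continuous_on {0..2*pi} f" shows "bdd_meas f"
  unfolding bdd_meas_def
proof (intro conjI)
  show "f \<in> borel_measurable angle_measure"
    by (rule continuous_imp_measurable_on_sets_lebesgue[OF assms]) simp
  have "bounded (f ` {0..2*pi})"
    by (intro compact_imp_bounded compact_continuous_image assms) simp
  then obtain C where C: "\<forall>y \<in> f ` {0..2*pi}. norm y \<le> C"
    unfolding bounded_iff ..
  have "AE t in angle_measure. norm (f t) \<le> C" using C by (intro AE_I2) simp
  then show "\<exists>C. AE t in angle_measure. norm (f t) \<le> C" ..
qed

lemma bdd_meas_cis [simp]: "bdd_meas (\<lambda>t. cis (c * t))"
  by (intro bdd_meas_continuous continuous_intros)

lemma bdd_meas_cis_neg [simp]: "bdd_meas (\<lambda>t. cis (- (c * t)))"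
  by (intro bdd_meas_continuous continuous_intros)

lemma bdd_meas_const [simp]: "bdd_meas (\<lambda>t. c)"
  by (intro bdd_meas_continuous continuous_intros)

lemma bdd_meas_mult:
  assumes "bdd_meas f" "bdd_meas g" shows "bdd_meas (\<lambda>t. f t * g t)"
proof -
  obtain C D where C: "AE t in angle_measure. norm (f t) \<le> C" and D: "AE t in angle_measure. norm (g t) \<le> D"
    using assms by (auto simp: bdd_meas_def)
  have "AE t in angle_measure. norm (f t * g t) \<le> C * D"
    using C D
  proof eventually_elim
    case (elim t)
    then show ?case unfolding norm_mult
      by (intro mult_mono) (auto intro: order_trans[OF norm_ge_zero])
  qed
  then show ?thesis using assms by (auto simp: bdd_meas_def)
qed

lemma bdd_meas_add:
  assumes "bdd_meas f" "bdd_meas g" shows "bdd_meas (\<lambda>t. f t + g t)"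
proof -
  obtain C D where C: "AE t in angle_measure. norm (f t) \<le> C" and D: "AE t in angle_measure. norm (g t) \<le> D"
    using assms by (auto simp: bdd_meas_def)
  have "AE t in angle_measure. norm (f t + g t) \<le> C + D"
    using C D by eventually_elim (rule norm_triangle_mono)
  then show ?thesis using assms by (auto simp: bdd_meas_def)
qed

lemma bdd_meas_diff:
  assumes "bdd_meas f" "bdd_meas g" shows "bdd_meas (\<lambda>t. f t - g t)"
  using bdd_meas_add[OF assms(1) bdd_meas_mult[OF bdd_meas_const[of "-1"] assms(2)]] by simp

lemma bdd_meas_cmult: "bdd_meas f \<Longrightarrow> bdd_meas (\<lambda>t. c * f t)"
  by (intro bdd_meas_mult) auto

lemmas bdd_meas_intros = bdd_meas_mult bdd_meas_add bdd_meas_diff bdd_meas_const bdd_meas_cis bdd_meas_cis_neg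

definition null_spectrum :: "(real \<Rightarrow> complex) \<Rightarrow> bool" where
  "null_spectrum c \<longleftrightarrow> bdd_meas c \<and> (\<forall>k. fint c k = 0)"

lemma fint_add:
  assumes "bdd_meas f" "bdd_meas g"
  shows "fint (\<lambda>t. f t + g t) k = fint f k + fint g k"
  unfolding fint_def distrib_right
  by (intro Bochner_Integration.integral_add bdd_meas_integrable bdd_meas_intros assms)

lemma fint_cmult: "fint (\<lambda>t. c * f t) k = c * fint f k"
  unfolding fint_def by (simp add: mult.assoc)

lemma fint_times_cis: "fint (\<lambda>t. f t * cis (of_int m * t)) k = fint f (k - m)"
  unfolding fint_def by (simp add: mult.assoc cis_mult algebra_simps)

lemma null_spectrum_add:
  "null_spectrum c \<Longrightarrow> null_spectrum d \<Longrightarrow> null_spectrum (\<lambda>t. c t + d t)"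
  by (simp add: null_spectrum_def bdd_meas_add fint_add)

lemma null_spectrum_cmult:
  "null_spectrum c \<Longrightarrow> null_spectrum (\<lambda>t. z * c t)"
  by (simp add: null_spectrum_def bdd_meas_cmult fint_cmult)

lemma null_spectrum_cis:
  "null_spectrum c \<Longrightarrow> null_spectrum (\<lambda>t. c t * cis (of_int m * t))"
  by (simp add: null_spectrum_def bdd_meas_mult fint_times_cis)

text \<open>
  On the circle a real-linear function is a combination of \<open>cis t\<close> and \<open>cis (-t)\<close>, and multiplication
  by these shifts Fourier coefficients. The induction works because the class is preserved, not
  merely the vanishing of one integral.
\<close>

lemma null_spectrum_real_polynomial:
  assumes "real_polynomial_function p" "null_spectrum c"
  shows "null_spectrum (\<lambda>t. c t * of_real (p (cis t)))"
  using assms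
proof (induction arbitrary: c)
  case (linear f)
  have eq: "of_real (f (cis t)) =
      (f 1 - \<i> * f \<i>) / 2 * cis (of_int 1 * t) + (f 1 + \<i> * f \<i>) / 2 * cis (of_int (- 1) * t)" for t
  proof -
    have "f (cis t) = f (cos t *\<^sub>R 1 + sin t *\<^sub>R \<i>)"
      by (rule arg_cong[of _ _ f]) (simp add: complex_eq_iff)
    also have "\<dots> = cos t * f 1 + sin t * f \<i>"
      using linear(1) by (simp add: linear_add linear_scale bounded_linear.linear)
    finally show ?thesis by (simp add: complex_eq_iff field_simps)
  qed
  have "(\<lambda>t. c t * of_real (f (cis t))) =
     (\<lambda>t. (f 1 - \<i> * f \<i>) / 2 * (c t * cis (of_int 1 * t)) + (f 1 + \<i> * f \<i>) / 2 * (c t * cis (of_int (- 1) * t)))"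
    by (rule ext) (subst eq, simp only: algebra_simps)
  then show ?case
    by (simp only:) (intro null_spectrum_add null_spectrum_cmult null_spectrum_cis linear)
next
  case (const z)
  then show ?case using null_spectrum_cmult[of c "of_real z"] by (simp add: mult.commute)
next
  case (add f g)
  then show ?case by (simp add: distrib_left null_spectrum_add)
next
  case (mult f g)
  have "null_spectrum (\<lambda>t. (c t * of_real (f (cis t))) * of_real (g (cis t)))"
    by (intro mult)
  then show ?case by (simp add: mult.assoc)
qed

lemma null_spectrum_integral: "null_spectrum c \<Longrightarrow> (LINT t|angle_measure. c t) = 0"
  unfolding null_spectrum_def fint_def by (auto dest!: spec[of _ 0])

lemma norm_integral_le_sup:
  assumes "bdd_meas f" "AE t in angle_measure. norm (f t) \<le> C"
  shows "norm (LINT t|angle_measure. f t) \<le> 2 * pi * C"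
proof -
  have "norm (LINT t|angle_measure. f t) \<le> (LINT t|angle_measure. norm (f t))"
    by (rule integral_norm_bound)
  also have "\<dots> \<le> (LINT t|angle_measure. C)"
    using assms finite_angle_measure bdd_meas_integrable
    by (intro integral_mono_AE) (auto intro: integrable_norm finite_measure.integrable_const)
  also have "\<dots> = 2 * pi * C" by (simp add: measure_restrict_space)
  finally show ?thesis .
qed

text \<open>
  Stone-Weierstrass on the circle approximates \<open>f\<close> uniformly by real polynomials.
\<close>

lemma null_spectrum_continuous:
  fixes f :: "complex \<Rightarrow> real"
  assumes c: "null_spectrum c" and f: "continuous_on (sphere 0 1) f"
  shows "(LINT t|angle_measure. c t * of_real (f (cis t))) = 0"
proof -
  have bc: "bdd_meas c" using c by (simp add: null_spectrum_def)
  then obtain C where C: "AE t in angle_measure. norm (c t) \<le> C" by (auto simp: bdd_meas_def)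
  define D where "D = \<bar>C\<bar> + 1"
  have D: "AE t in angle_measure. norm (c t) \<le> D" using C by eventually_elim (simp add: D_def)
  have D0: "D > 0" by (simp add: D_def)
  have bf: "bdd_meas (\<lambda>t. of_real (f (cis t)))"
    by (intro bdd_meas_continuous continuous_intros continuous_on_compose2[OF f]) auto
  have "norm (LINT t|angle_measure. c t * of_real (f (cis t))) \<le> e" if e: "e > 0" for e
  proof -
    have e': "e / (2 * pi * D) > 0" using e D0 by simp
    obtain p where p: "real_polynomial_function p"
        and pf: "\<And>z. z \<in> sphere 0 1 \<Longrightarrow> \<bar>f z - p z\<bar> < e / (2 * pi * D)"
      by (rule Stone_Weierstrass_real_polynomial_function[OF compact_sphere f e']) blast
    note np = null_spectrum_real_polynomial[OF p c]
    then have bp: "bdd_meas (\<lambda>t. c t * of_real (p (cis t)))" by (simp add: null_spectrum_def)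
    have "(LINT t|angle_measure. c t * of_real (f (cis t))) =
        (LINT t|angle_measure. c t * of_real (f (cis t)) - c t * of_real (p (cis t)))"
      using null_spectrum_integral[OF np]
      by (subst Bochner_Integration.integral_diff)
         (simp_all add: bdd_meas_integrable bdd_meas_mult bc bf bp)
    moreover have "norm \<dots> \<le> 2 * pi * (D * (e / (2 * pi * D)))"
    proof (rule norm_integral_le_sup)
      show "bdd_meas (\<lambda>t. c t * of_real (f (cis t)) - c t * of_real (p (cis t)))"
        by (intro bdd_meas_intros bc bf bp)
      show "AE t in angle_measure. norm (c t * of_real (f (cis t)) - c t * of_real (p (cis t)))
         \<le> D * (e / (2 * pi * D))"
        using D
      proof eventually_elim
        case (elim t)
        have "norm (c t * of_real (f (cis t)) - c t * of_real (p (cis t))) = norm (c t) * \<bar>f (cis t) - p (cis t)\<bar>"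
          unfolding right_diff_distrib[symmetric] norm_mult of_real_diff[symmetric] norm_of_real ..
        also have "\<dots> \<le> D * (e / (2 * pi * D))"
          using elim pf[of "cis t"] D0 by (intro mult_mono) auto
        finally show ?case .
      qed
    qed
    ultimately show ?thesis using D0 by simp
  qed
  then have "norm (LINT t|angle_measure. c t * of_real (f (cis t))) \<le> 0"
    by (rule field_le_epsilon) simp
  then show ?thesis by simp
qed


lemma Arg2pi_cis: "0 \<le> t \<Longrightarrow> t < 2 * pi \<Longrightarrow> Arg2pi (cis t) = t"
  by (rule Arg2pi_unique[of 1]) (auto simp: cis_conv_exp)

lemma AE_angle_iff: "(AE t in angle_measure. P t) \<longleftrightarrow> (AE t in lebesgue. t \<in> {0..2*pi} \<longrightarrow> P t)"
  by (intro AE_restrict_space_iff) simp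

lemma AE_angle_negligible:
  assumes "negligible N" "\<And>t. 0 < t \<Longrightarrow> t < 2 * pi \<Longrightarrow> t \<notin> N \<Longrightarrow> P t"
  shows "AE t in angle_measure. P t"
proof -
  have "negligible (N \<union> {0, 2*pi})" using assms(1) by (intro negligible_Un) auto
  then have "N \<union> {0, 2*pi} \<in> null_sets lebesgue" by (simp only: negligible_iff_null_sets)
  then have "AE t in lebesgue. t \<notin> N \<union> {0, 2*pi}" by (rule AE_not_in)
  then have "AE t in lebesgue. t \<in> {0..2*pi} \<longrightarrow> P t"
  proof eventually_elim
    case (elim t)
    then show ?case using assms(2)[of t] by auto
  qed
  then show ?thesis by (simp only: AE_angle_iff)
qed

text \<open>
  A measurable function of the angle is a pointwise limit of continuous functions, but
  these need not agree at \<open>0\<close> and \<open>2 pi\<close>. The factor \<open>v n\<close>, which vanishes at \<open>1\<close> and tends to \<open>1\<close>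
  elsewhere, makes them continuous on the circle; clamping them to \<open>[-C, C]\<close> makes dominated
  convergence applicable.
\<close>

lemma bdd_meas_circle_approximation:
  fixes f :: "real \<Rightarrow> real"
  assumes f: "f \<in> borel_measurable angle_measure" and C: "AE t in angle_measure. \<bar>f t\<bar> \<le> C" "0 \<le> C"
  obtains g :: "nat \<Rightarrow> complex \<Rightarrow> real" where "\<And>n. continuous_on (sphere 0 1) (g n)"
    "\<And>n z. \<bar>g n z\<bar> \<le> C" "AE t in angle_measure. (\<lambda>n. g n (cis t)) \<longlonglongrightarrow> f t"
proof -
  let ?F = "\<lambda>t. if t \<in> {0..2*pi} then f t else 0"
  have "?F \<in> borel_measurable lebesgue"
    using f by (subst borel_measurable_if) auto
  then have "?F measurable_on UNIV"
    by (rule lebesgue_measurable_imp_measurable_on_real) simp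
  then obtain N k where N: "negligible N" and k: "\<And>n::nat. continuous_on UNIV (k n)"
    and lim: "\<And>x. x \<notin> N \<Longrightarrow> (\<lambda>n. k n x) \<longlonglongrightarrow> ?F x"
    unfolding measurable_on_def by auto
  define u where "u n x = max (- C) (min C (k n x))" for n x
  define v where "v n z = min 1 (real n * norm (z - 1))" for n and z :: complex
  define g where "g n z = v n z * u n (Arg2pi z)" for n z
  have u_bd: "\<bar>u n x\<bar> \<le> C" for n x using C(2) by (auto simp: u_def)
  have v_bd: "0 \<le> v n z" "v n z \<le> 1" for n z by (auto simp: v_def)
  have g_bd: "\<bar>g n z\<bar> \<le> C" for n z
    unfolding g_def abs_mult using mult_mono[of "\<bar>v n z\<bar>" 1 "\<bar>u n (Arg2pi z)\<bar>" C] u_bd[of n] v_bd[of n z] C(2) by simp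
  have u_cont: "continuous_on UNIV (u n)" for n
    unfolding u_def by (intro continuous_intros k)
  have v_cont: "continuous_on S (v n)" for n S
    unfolding v_def by (intro continuous_intros)
  have "continuous_on (sphere 0 1) (g n)" for n
    unfolding continuous_on_eq_continuous_within
  proof
    fix z :: complex assume z: "z \<in> sphere 0 1"
    show "continuous (at z within sphere 0 1) (g n)"
    proof (cases "z = 1")
      case True
      have "(v n \<longlongrightarrow> v n 1) (at 1 within sphere 0 1)"
        using v_cont[of UNIV n] by (auto simp: continuous_on_def intro: tendsto_within_subset)
      moreover have "v n 1 = 0" by (simp add: v_def)
      ultimately have lim0: "((\<lambda>z. C * v n z) \<longlongrightarrow> 0) (at 1 within sphere 0 1)"
        by (intro tendsto_mult_right_zero) simp
      have "(g n \<longlongrightarrow> 0) (at 1 within sphere 0 1)"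
      proof (rule Lim_null_comparison[OF always_eventually lim0], rule allI)
        fix z
        show "norm (g n z) \<le> C * v n z"
          using mult_right_mono[OF u_bd[of n "Arg2pi z"] v_bd(1)[of n z]] v_bd(1)[of n z]
          by (simp add: g_def abs_mult mult.commute)
      qed
      then show ?thesis using True by (simp add: continuous_within g_def v_def)
    next
      case False
      have "z \<notin> \<real>\<^sub>\<ge>\<^sub>0"
      proof
        assume "z \<in> \<real>\<^sub>\<ge>\<^sub>0"
        then obtain r where "z = of_real r" "r \<ge> 0" by (auto simp: nonneg_Reals_def)
        with z False show False by simp
      qed
      then have "continuous (at z) Arg2pi" by (rule continuous_at_Arg2pi)
      moreover have "continuous (at (Arg2pi z)) (u n)"
        using u_cont[of n] by (simp add: continuous_on_eq_continuous_at)
      ultimately have "continuous (at z) (\<lambda>z. u n (Arg2pi z))"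
        using continuous_at_compose[of z Arg2pi "u n"] by (simp add: o_def)
      moreover have "continuous (at z) (v n)"
        using v_cont[of UNIV n] by (simp add: continuous_on_eq_continuous_at)
      ultimately have "continuous (at z) (g n)"
        unfolding g_def by (intro continuous_mult)
      then show ?thesis by (rule continuous_at_imp_continuous_at_within)
    qed
  qed
  moreover have "AE t in angle_measure. (\<lambda>n. g n (cis t)) \<longlonglongrightarrow> f t"
  proof -
    have "AE t in angle_measure. \<bar>f t\<bar> \<le> C \<longrightarrow> (\<lambda>n. g n (cis t)) \<longlonglongrightarrow> f t"
    proof (rule AE_angle_negligible[OF N], intro impI)
      fix t assume t: "0 < t" "t < 2 * pi" "t \<notin> N" and fC: "\<bar>f t\<bar> \<le> C"
      have "(\<lambda>n. u n t) \<longlonglongrightarrow> max (- C) (min C (f t))"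
        unfolding u_def using lim[OF t(3)] t by (intro tendsto_intros) auto
      also have "max (- C) (min C (f t)) = f t" using fC by auto
      finally have ul: "(\<lambda>n. u n t) \<longlonglongrightarrow> f t" .
      have "cis t \<noteq> 1"
      proof
        assume "cis t = 1"
        then have "Arg2pi (cis t) = Arg2pi (cis 0)" by simp
        then show False using Arg2pi_cis[of t] Arg2pi_cis[of 0] t by simp
      qed
      then have pos: "norm (cis t - 1) > 0" by simp
      have vl: "(\<lambda>n. v n (cis t)) \<longlonglongrightarrow> 1"
      proof (rule tendsto_eventually)
        obtain m :: nat where m: "1 / norm (cis t - 1) \<le> real m" using real_arch_simple by blast
        show "\<forall>\<^sub>F n in sequentially. v n (cis t) = 1"
          using eventually_ge_at_top[of m]
        proof eventually_elim
          case (elim n)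
          then have "1 / norm (cis t - 1) \<le> real n" using m by simp
          then have "1 \<le> real n * norm (cis t - 1)" using pos by (simp add: divide_le_eq)
          then show ?case by (simp add: v_def)
        qed
      qed
      show "(\<lambda>n. g n (cis t)) \<longlonglongrightarrow> f t"
        using tendsto_mult[OF vl ul] t by (simp add: g_def Arg2pi_cis)
    qed
    then show ?thesis using C(1) by eventually_elim blast
  qed
  ultimately show thesis using that[of g] g_bd by blast
qed

lemma null_spectrum_real:
  fixes f :: "real \<Rightarrow> real"
  assumes c: "null_spectrum c" and f: "f \<in> borel_measurable angle_measure"
    and C: "AE t in angle_measure. \<bar>f t\<bar> \<le> C"
  shows "(LINT t|angle_measure. c t * of_real (f t)) = 0"
proof -
  have C': "AE t in angle_measure. \<bar>f t\<bar> \<le> \<bar>C\<bar>" using C by eventually_elim simp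
  obtain g where g: "\<And>n. continuous_on (sphere 0 1) (g n)" "\<And>n z. \<bar>g n z\<bar> \<le> \<bar>C\<bar>"
      "AE t in angle_measure. (\<lambda>n. g n (cis t)) \<longlonglongrightarrow> f t"
    using bdd_meas_circle_approximation[OF f C' abs_ge_zero] by blast
  have bc: "bdd_meas c" using c by (simp add: null_spectrum_def)
  obtain D where D: "AE t in angle_measure. norm (c t) \<le> D" using bc by (auto simp: bdd_meas_def)
  have bg: "bdd_meas (\<lambda>t. of_real (g n (cis t)))" for n
    by (intro bdd_meas_continuous continuous_intros continuous_on_compose2[OF g(1)]) auto
  have "(\<lambda>n. LINT t|angle_measure. c t * of_real (g n (cis t))) \<longlonglongrightarrow>
      (LINT t|angle_measure. c t * of_real (f t))"
  proof (rule integral_dominated_convergence[where w="\<lambda>_. D * \<bar>C\<bar>"])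
    show "(\<lambda>t. c t * of_real (f t)) \<in> borel_measurable angle_measure"
      using bc f by (auto simp: bdd_meas_def)
    show "(\<lambda>t. c t * of_real (g n (cis t))) \<in> borel_measurable angle_measure" for n
      using bdd_meas_mult[OF bc bg] by (simp add: bdd_meas_def)
    show "integrable angle_measure (\<lambda>_. D * \<bar>C\<bar>)"
      by (rule finite_measure.integrable_const[OF finite_angle_measure])
    show "AE t in angle_measure. (\<lambda>n. c t * of_real (g n (cis t))) \<longlonglongrightarrow> c t * of_real (f t)"
      using g(3) by eventually_elim (intro tendsto_intros)
    show "AE t in angle_measure. norm (c t * of_real (g n (cis t))) \<le> D * \<bar>C\<bar>" for n
      using D
    proof eventually_elim
      case (elim t)
      then show ?case unfolding norm_mult norm_of_real
        by (intro mult_mono g(2)) (auto intro: order_trans[OF norm_ge_zero])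
    qed
  qed
  then show ?thesis
    using null_spectrum_continuous[OF c g(1)] by (simp add: LIMSEQ_const_iff)
qed

text \<open>
  The uniqueness theorem for Fourier coefficients, in the form in which it applies to the
  coefficients of a product.
\<close>

lemma null_spectrum_orthogonal:
  assumes c: "null_spectrum c" and f: "bdd_meas f"
  shows "(LINT t|angle_measure. c t * f t) = 0"
proof -
  obtain C where C: "AE t in angle_measure. norm (f t) \<le> C" using f by (auto simp: bdd_meas_def)
  have m: "f \<in> borel_measurable angle_measure" using f by (simp add: bdd_meas_def)
  have bc: "bdd_meas c" using c by (simp add: null_spectrum_def)
  have re: "AE t in angle_measure. \<bar>Re (f t)\<bar> \<le> C" and im: "AE t in angle_measure. \<bar>Im (f t)\<bar> \<le> C"
    using C by (eventually_elim, meson abs_Re_le_cmod abs_Im_le_cmod order_trans)+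
  have mr: "(\<lambda>t. Re (f t)) \<in> borel_measurable angle_measure" "(\<lambda>t. Im (f t)) \<in> borel_measurable angle_measure"
    using m by measurable
  have b: "bdd_meas (\<lambda>t. of_real (Re (f t)))" "bdd_meas (\<lambda>t. of_real (Im (f t)))"
    unfolding bdd_meas_def using mr re im by (auto simp: norm_of_real)
  have "(LINT t|angle_measure. c t * f t) =
      (LINT t|angle_measure. c t * of_real (Re (f t)) + \<i> * (c t * of_real (Im (f t))))"
    by (rule Bochner_Integration.integral_cong[OF refl]) (simp add: complex_eq_iff algebra_simps)
  also have "\<dots> = (LINT t|angle_measure. c t * of_real (Re (f t))) + \<i> * (LINT t|angle_measure. c t * of_real (Im (f t)))"
    by (subst Bochner_Integration.integral_add)
       (auto intro!: bdd_meas_integrable bdd_meas_mult bc b)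
  also have "\<dots> = 0"
    using null_spectrum_real[OF c mr(1) re] null_spectrum_real[OF c mr(2) im] by simp
  finally show ?thesis .
qed

section \<open>Fourier coefficients of products\<close>

lemma fint_diff:
  assumes "bdd_meas f" "bdd_meas g"
  shows "fint (\<lambda>t. f t - g t) k = fint f k - fint g k"
  unfolding fint_def left_diff_distrib
  by (intro Bochner_Integration.integral_diff bdd_meas_integrable bdd_meas_intros assms)

lemma fint_cis: "fint (\<lambda>t. cis (of_int m * t)) k = of_bool (k = m) * (2 * pi)"
proof -
  define l where "l = m - k"
  have "fint (\<lambda>t. cis (of_int m * t)) k = (LINT t|angle_measure. cis (of_int l * t))"
    unfolding fint_def by (simp add: cis_mult l_def algebra_simps)
  also have "\<dots> = of_bool (l = 0) * (2 * pi)"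
  proof (cases "l = 0")
    case True then show ?thesis by (simp add: measure_restrict_space scaleR_conv_of_real)
  next
    case False
    let ?F = "\<lambda>t. cis (of_int l * t) / (\<i> * of_int l)"
    have "((\<lambda>t. cis (of_int l * t)) has_integral (?F (2 * pi) - ?F 0)) {0..2*pi}"
    proof (rule fundamental_theorem_of_calculus)
      fix x :: real assume "x \<in> {0..2*pi}"
      show "(?F has_vector_derivative cis (of_int l * x)) (at x within {0..2*pi})"
        unfolding cis_conv_exp using False
        by (auto intro!: derivative_eq_intros has_vector_derivative_real_field simp: field_simps)
    qed simp
    moreover have "cis (of_int l * (2 * pi)) = 1"
      using cis_multiple_2pi[of "of_int l"] by (simp add: mult_ac)
    ultimately have "integral {0..2*pi} (\<lambda>t. cis (of_int l * t)) = 0"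
      by (simp add: integral_unique)
    then show ?thesis
      using False by (subst lebesgue_integral_eq_integral) (auto intro: bdd_meas_integrable)
  qed
  finally show ?thesis by (auto simp: l_def)
qed

lemma integral_trig_series:
  assumes w: "(\<lambda>k. norm (w k)) summable_on UNIV" and f: "bdd_meas f"
  defines "G \<equiv> \<lambda>t. \<Sum>\<^sub>\<infinity>k::int. w k * cis (of_int k * t)"
  shows "bdd_meas G"
    and "((\<lambda>k. w k * (LINT t|angle_measure. f t * cis (of_int k * t))) has_sum
          (LINT t|angle_measure. f t * G t)) UNIV"
proof -
  let ?p = "\<lambda>K t. \<Sum>k\<in>K. w k * cis (of_int k * t)"
  have unif: "uniform_limit UNIV ?p G (finite_subsets_at_top UNIV)"
    unfolding G_def by (rule Weierstrass_m_test_general[OF _ w]) (simp add: norm_mult)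
  have "continuous_on UNIV G"
    by (rule uniform_limit_theorem[OF _ unif]) (auto intro!: always_eventually continuous_intros)
  then show G: "bdd_meas G" by (intro bdd_meas_continuous) (auto intro: continuous_on_subset)
  obtain C where C: "AE t in angle_measure. norm (f t) \<le> C" using f by (auto simp: bdd_meas_def)
  have bp: "bdd_meas (?p K)" for K
    by (intro bdd_meas_continuous continuous_intros)
  have part: "(LINT t|angle_measure. f t * ?p K t) =
      (\<Sum>k\<in>K. w k * (LINT t|angle_measure. f t * cis (of_int k * t)))" if "finite K" for K
  proof -
    have "(LINT t|angle_measure. f t * ?p K t) =
       (LINT t|angle_measure. (\<Sum>k\<in>K. w k * (f t * cis (of_int k * t))))"
      by (simp add: sum_distrib_left mult_ac)
    also have "\<dots> = (\<Sum>k\<in>K. (LINT t|angle_measure. w k * (f t * cis (of_int k * t))))"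
      by (rule Bochner_Integration.integral_sum) (intro bdd_meas_integrable bdd_meas_intros f)
    finally show ?thesis by simp
  qed
  have "((\<lambda>K. LINT t|angle_measure. f t * ?p K t) \<longlongrightarrow> (LINT t|angle_measure. f t * G t))
      (finite_subsets_at_top UNIV)"
  proof (rule tendstoI)
    fix e :: real assume e: "e > 0"
    define D where "D = 2 * pi * (\<bar>C\<bar> + 1)"
    have D: "D > 0" unfolding D_def by (intro mult_pos_pos) auto
    define d where "d = e / (D * 2)"
    have d: "d > 0" using e D by (simp add: d_def)
    have "\<forall>\<^sub>F K in finite_subsets_at_top UNIV. \<forall>t\<in>UNIV. dist (?p K t) (G t) < d"
      using unif d by (rule uniform_limitD)
    then show "\<forall>\<^sub>F K in finite_subsets_at_top UNIV.
        dist (LINT t|angle_measure. f t * ?p K t) (LINT t|angle_measure. f t * G t) < e"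
    proof eventually_elim
      case (elim K)
      have "(LINT t|angle_measure. f t * ?p K t) - (LINT t|angle_measure. f t * G t) =
          (LINT t|angle_measure. f t * ?p K t - f t * G t)"
        by (rule Bochner_Integration.integral_diff[symmetric])
           (intro bdd_meas_integrable bdd_meas_mult f bp G)+
      also have "norm \<dots> \<le> 2 * pi * ((\<bar>C\<bar> + 1) * d)"
      proof (rule norm_integral_le_sup)
        show "bdd_meas (\<lambda>t. f t * ?p K t - f t * G t)"
          by (intro bdd_meas_diff bdd_meas_mult f bp G)
        show "AE t in angle_measure. norm (f t * ?p K t - f t * G t) \<le> (\<bar>C\<bar> + 1) * d"
          using C
        proof eventually_elim
          case (elim t)
          have "norm (f t * ?p K t - f t * G t) = norm (f t) * dist (?p K t) (G t)"
            unfolding dist_norm right_diff_distrib[symmetric] norm_mult ..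
          also have "\<dots> \<le> (\<bar>C\<bar> + 1) * d"
            using elim \<open>\<forall>t\<in>UNIV. dist (?p K t) (G t) < d\<close> by (intro mult_mono) (auto intro: less_imp_le)
          finally show ?case .
        qed
      qed
      also have "\<dots> = D * d" by (simp only: D_def mult.assoc)
      also have "\<dots> = e / 2" using D by (simp add: d_def)
      also have "\<dots> < e" using e by simp
      finally show ?case by (simp add: dist_norm)
    qed
  qed
  moreover have "\<forall>\<^sub>F K in finite_subsets_at_top UNIV. (LINT t|angle_measure. f t * ?p K t) =
      (\<Sum>k\<in>K. w k * (LINT t|angle_measure. f t * cis (of_int k * t)))"
    using eventually_finite_subsets_at_top_weakI part by (auto intro!: eventually_finite_subsets_at_top_weakI)
  ultimately show "((\<lambda>k. w k * (LINT t|angle_measure. f t * cis (of_int k * t))) has_sum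
          (LINT t|angle_measure. f t * G t)) UNIV"
    unfolding has_sum_def by (rule Lim_transform_eventually)
qed

text \<open>
  The absolutely convergent Fourier series \<open>G\<close> of \<open>g\<close> has the same coefficients as \<open>2 pi g\<close>. By uniqueness
  it may replace \<open>2 pi g\<close> under the integral, and then integration is termwise.
\<close>

lemma fint_product:
  assumes f: "bdd_meas f" and g: "bdd_meas g" and w: "(\<lambda>k. norm (fint g k)) summable_on UNIV"
  shows "((\<lambda>k. fint f (n - k) * fint g k) has_sum (2 * pi * fint (\<lambda>t. f t * g t) n)) UNIV"
proof -
  define G where "G t = (\<Sum>\<^sub>\<infinity>k::int. fint g k * cis (of_int k * t))" for t
  have bG: "bdd_meas G" using integral_trig_series(1)[OF w f] unfolding G_def .
  have series: "((\<lambda>k. fint g k * fint h (m - k)) has_sum fint (\<lambda>t. h t * G t) m) UNIV"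
    if h: "bdd_meas h" for h m
  proof -
    have "bdd_meas (\<lambda>t. h t * cis (- (of_int m * t)))" by (intro bdd_meas_intros h)
    from integral_trig_series(2)[OF w this]
    have "((\<lambda>k. fint g k * (LINT t|angle_measure. h t * cis (- (of_int m * t)) * cis (of_int k * t))) has_sum
      (LINT t|angle_measure. h t * cis (- (of_int m * t)) * G t)) UNIV"
      unfolding G_def .
    moreover have "(LINT t|angle_measure. h t * cis (- (of_int m * t)) * cis (of_int k * t)) = fint h (m - k)" for k
      unfolding fint_def
      by (rule Bochner_Integration.integral_cong[OF refl]) (simp add: mult.assoc cis_mult algebra_simps)
    moreover have "(LINT t|angle_measure. h t * cis (- (of_int m * t)) * G t) = fint (\<lambda>t. h t * G t) m"
      unfolding fint_def by (rule Bochner_Integration.integral_cong[OF refl]) (simp add: mult_ac)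
    ultimately show ?thesis by simp
  qed
  have "fint G m = 2 * pi * fint g m" for m
  proof -
    have "((\<lambda>k. fint g k * fint (\<lambda>_. 1) (m - k)) has_sum fint G m) UNIV"
      using series[of "\<lambda>_. 1" m] by simp
    moreover have "fint (\<lambda>_. 1) (m - k) = of_bool (k = m) * (2 * pi)" for k
      using fint_cis[of 0 "m - k"] by auto
    ultimately have "((\<lambda>k. fint g k * (of_bool (k = m) * (2 * pi))) has_sum fint G m) UNIV" by simp
    moreover have "((\<lambda>k. fint g k * (of_bool (k = m) * (2 * pi))) has_sum (fint g m * (2 * pi))) UNIV"
      by (rule has_sum_finite_neutralI[of "{m}"]) auto
    ultimately have "fint G m = fint g m * (2 * pi)" by (rule has_sum_unique)
    then show ?thesis by simp
  qed
  then have "null_spectrum (\<lambda>t. 2 * pi * g t - G t)"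
    unfolding null_spectrum_def
    by (simp add: fint_diff fint_cmult bdd_meas_diff bdd_meas_cmult g bG)
  then have "(LINT t|angle_measure. (2 * pi * g t - G t) * (f t * cis (- (of_int n * t)))) = 0"
    by (rule null_spectrum_orthogonal) (intro bdd_meas_intros f)
  also have "(LINT t|angle_measure. (2 * pi * g t - G t) * (f t * cis (- (of_int n * t)))) =
      fint (\<lambda>t. 2 * pi * (f t * g t) - f t * G t) n"
    unfolding fint_def by (rule Bochner_Integration.integral_cong[OF refl]) (simp add: algebra_simps)
  also have "\<dots> = 2 * pi * fint (\<lambda>t. f t * g t) n - fint (\<lambda>t. f t * G t) n"
    by (simp add: fint_diff fint_cmult bdd_meas_cmult bdd_meas_mult f g bG)
  finally have "2 * pi * fint (\<lambda>t. f t * g t) n = fint (\<lambda>t. f t * G t) n" by simp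
  then show ?thesis using series[OF f, of n] by (simp add: mult.commute)
qed

section \<open>Coefficient sequences of matrix functions\<close>

lemma bdd_meas_cong_AE:
  assumes f: "bdd_meas f" and eq: "AE t in angle_measure. f t = g t"
  shows "bdd_meas g" "fint f = fint g"
proof -
  have "(\<lambda>t. if t \<in> {0..2*pi} then f t else 0) \<in> borel_measurable lebesgue"
    using f by (subst borel_measurable_if) (auto simp: bdd_meas_def)
  moreover have "AE t in lebesgue. (if t \<in> {0..2*pi} then f t else 0) = (if t \<in> {0..2*pi} then g t else 0)"
    using eq unfolding AE_angle_iff by eventually_elim auto
  ultimately have "(\<lambda>t. if t \<in> {0..2*pi} then g t else 0) \<in> borel_measurable lebesgue"
    by (rule borel_measurable_AE)
  then have g: "g \<in> borel_measurable angle_measure"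
    by (subst (asm) borel_measurable_if) auto
  obtain C where C: "AE t in angle_measure. norm (f t) \<le> C" using f by (auto simp: bdd_meas_def)
  have "AE t in angle_measure. norm (g t) \<le> C"
    using C eq by eventually_elim simp
  with g show bg: "bdd_meas g" by (auto simp: bdd_meas_def)
  show "fint f = fint g"
  proof
    fix k
    show "fint f k = fint g k"
      unfolding fint_def
    proof (rule integral_cong_AE)
      show "AE t in angle_measure. f t * cis (- (of_int k * t)) = g t * cis (- (of_int k * t))"
        using eq by eventually_elim simp
    qed (use bdd_meas_mult[OF f bdd_meas_cis_neg] bdd_meas_mult[OF bg bdd_meas_cis_neg] in \<open>simp_all add: bdd_meas_def\<close>)
  qed
qed

text \<open>
  Fourier coefficients are taken entrywise, and entrywise bounds are immediate for products.
\<close>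

definition bdd_entries :: "(complex \<Rightarrow> complex^'n^'n) \<Rightarrow> bool" where
  "bdd_entries a \<longleftrightarrow> (\<forall>i j. bdd_meas (\<lambda>t. a (cis t) $ i $ j))"

lemma norm_matrix_entry_le: "norm (A $ i $ j) \<le> norm A"
  for A :: "complex^'n^'m"
  by (rule order_trans[OF Finite_Cartesian_Product.norm_nth_le Finite_Cartesian_Product.norm_nth_le])

lemma L_inf_bdd_entries:
  assumes "a \<in> L_inf" shows "bdd_entries a"
  unfolding bdd_entries_def bdd_meas_def
proof (intro allI conjI)
  fix i j
  have m: "(\<lambda>t. a (cis t)) \<in> borel_measurable angle_measure" using assms by (simp add: L_inf_def)
  have "(\<lambda>A::complex^'a^'a. A $ i $ j) \<in> borel_measurable borel"
    by (intro borel_measurable_continuous_onI continuous_intros)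
  from measurable_compose[OF m this]
  show "(\<lambda>t. a (cis t) $ i $ j) \<in> borel_measurable angle_measure" .
  obtain C where C: "AE t in angle_measure. norm (a (cis t)) \<le> C" using assms by (auto simp: L_inf_def)
  have "AE t in angle_measure. norm (a (cis t) $ i $ j) \<le> C"
    using C by eventually_elim (rule order_trans[OF norm_matrix_entry_le])
  then show "\<exists>C. AE t in angle_measure. norm (a (cis t) $ i $ j) \<le> C" ..
qed

lemma fourier_coeff_entry:
  "fourier_coeff a k $ i $ j = fint (\<lambda>t. a (cis t) $ i $ j) k / (2 * pi)"
  by (simp add: fourier_coeff_def fint_def)

lemma fourier_coeff_cong_AE:
  assumes a: "bdd_entries a" and eq: "AE t in angle_measure. a (cis t) = b (cis t)"
  shows "bdd_entries b" "fourier_coeff b = fourier_coeff a"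
proof -
  have e: "AE t in angle_measure. a (cis t) $ i $ j = b (cis t) $ i $ j" for i j
    using eq by eventually_elim simp
  note c = bdd_meas_cong_AE[OF a[unfolded bdd_entries_def, rule_format] e]
  show "bdd_entries b" unfolding bdd_entries_def using c(1) by blast
  show "fourier_coeff b = fourier_coeff a"
    by (rule ext) (simp add: Finite_Cartesian_Product.vec_eq_iff fourier_coeff_entry c(2))
qed

definition wiener :: "(int \<Rightarrow> complex^'n^'m) \<Rightarrow> bool" where
  "wiener c \<longleftrightarrow> (\<lambda>k. norm (c k)) summable_on UNIV"

definition weighted_wiener :: "(int \<Rightarrow> complex^'n^'m) \<Rightarrow> bool" where
  "weighted_wiener c \<longleftrightarrow> (\<lambda>k. (of_int \<bar>k\<bar> + 1) * norm (c k)) summable_on UNIV"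

lemma weighted_wiener_imp_wiener: "weighted_wiener c \<Longrightarrow> wiener c"
  unfolding weighted_wiener_def wiener_def
  by (erule summable_on_comparison_test) (auto simp: mult_le_cancel_right1)

lemma wiener_entry:
  assumes "wiener c" shows "(\<lambda>k. norm (c k $ i $ j)) summable_on UNIV"
  using assms unfolding wiener_def
  by (rule summable_on_comparison_test) (auto simp: norm_matrix_entry_le)

lemma norm_matrix_le_sum: "norm A \<le> (\<Sum>i\<in>UNIV. \<Sum>j\<in>UNIV. norm (A $ i $ j))"
  for A :: "complex^'n^'m"
proof -
  have "norm x \<le> (\<Sum>i\<in>UNIV. norm (x $ i))" for x :: "'b::real_normed_vector^'k"
    unfolding norm_vec_def by (rule L2_set_le_sum) simp
  from order_trans[OF this sum_mono[OF this]] show ?thesis .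
qed

lemma fourier_coeff_product:
  assumes a: "bdd_entries a" and b: "bdd_entries b" and w: "wiener (fourier_coeff b)"
    and eq: "AE t in angle_measure. c (cis t) = a (cis t) ** b (cis t)"
  shows "bdd_entries c"
    and "((\<lambda>k. \<Sum>r\<in>UNIV. fourier_coeff a (n - k) $ i $ r * fourier_coeff b k $ r $ j) has_sum
      fourier_coeff c n $ i $ j) UNIV"
proof -
  define p where "p z = a z ** b z" for z
  let ?A = "\<lambda>i r t. a (cis t) $ i $ r" and ?B = "\<lambda>r j t. b (cis t) $ r $ j"
  have bA: "bdd_meas (?A i r)" and bB: "bdd_meas (?B i r)" for i r
    using a b by (simp_all add: bdd_entries_def)
  have p_entry: "p (cis t) $ i $ j = (\<Sum>r\<in>UNIV. ?A i r t * ?B r j t)" for t i j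
    by (simp add: p_def matrix_matrix_mult_def)
  have sums: "bdd_meas (\<lambda>t. \<Sum>r\<in>R. ?A i r t * ?B r j t) \<and>
      fint (\<lambda>t. \<Sum>r\<in>R. ?A i r t * ?B r j t) n = (\<Sum>r\<in>R. fint (\<lambda>t. ?A i r t * ?B r j t) n)"
    if "finite R" for i j n R
    using that
  proof induction
    case empty then show ?case by (simp add: fint_def)
  next
    case (insert r R)
    then show ?case by (simp add: bdd_meas_add bdd_meas_mult bA bB fint_add)
  qed
  have bp: "bdd_entries p" using sums by (simp add: bdd_entries_def p_entry)
  have eq': "AE t in angle_measure. p (cis t) = c (cis t)" using eq by eventually_elim (simp add: p_def)
  note pc = fourier_coeff_cong_AE[OF bp eq']
  show "bdd_entries c" by (rule pc(1))
  have "((\<lambda>k. fourier_coeff a (n - k) $ i $ r * fourier_coeff b k $ r $ j) has_sum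
      fint (\<lambda>t. ?A i r t * ?B r j t) n / (2 * pi)) UNIV" for r
  proof -
    have eqB: "fint (?B r j) k = 2 * pi * fourier_coeff b k $ r $ j" for k
      by (simp add: fourier_coeff_entry)
    have "(\<lambda>k. norm (fint (?B r j) k)) summable_on UNIV"
      unfolding eqB norm_mult by (intro summable_on_cmult_right wiener_entry w)
    from fint_product[OF bA bB this]
    have "((\<lambda>k. inverse ((2 * pi) * (2 * pi)) * (fint (?A i r) (n - k) * fint (?B r j) k)) has_sum
       inverse ((2 * pi) * (2 * pi)) * (2 * pi * fint (\<lambda>t. ?A i r t * ?B r j t) n)) UNIV"
      by (intro has_sum_cmult_right)
    then show ?thesis by (simp add: fourier_coeff_entry field_simps)
  qed
  from has_sum_finite_sum[OF finite this]
  show "((\<lambda>k. \<Sum>r\<in>UNIV. fourier_coeff a (n - k) $ i $ r * fourier_coeff b k $ r $ j) has_sum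
      fourier_coeff c n $ i $ j) UNIV"
    using sums[OF finite, where i=i and j=j and n=n] by (simp add: pc(2) fourier_coeff_entry p_entry sum_divide_distrib)
qed

text \<open>
  The weight is submultiplicative:
  \<open>\<bar>n\<bar> + 1 \<le> (\<bar>n - k\<bar> + 1) (\<bar>k\<bar> + 1)\<close>.
\<close>

lemma weighted_convolution_summable:
  fixes \<alpha> \<beta> :: "int \<Rightarrow> real"
  assumes nn: "\<And>k. 0 \<le> \<alpha> k" "\<And>k. 0 \<le> \<beta> k"
    and A: "(\<lambda>k. (of_int \<bar>k\<bar> + 1) * \<alpha> k) summable_on UNIV" and B: "(\<lambda>k. (of_int \<bar>k\<bar> + 1) * \<beta> k) summable_on UNIV"
  shows "(\<lambda>k. \<alpha> (n - k) * \<beta> k) summable_on UNIV"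
    and "(\<lambda>n. (of_int \<bar>n\<bar> + 1) * (\<Sum>\<^sub>\<infinity>k. \<alpha> (n - k) * \<beta> k)) summable_on UNIV"
proof -
  define a b where "a k = (of_int \<bar>k\<bar> + 1) * \<alpha> k" and "b k = (of_int \<bar>k\<bar> + 1) * \<beta> k" for k
  have nn': "0 \<le> a k" "0 \<le> b k" for k using nn by (simp_all add: a_def b_def)
  have sa: "a summable_on UNIV" and sb: "b summable_on UNIV" using A B by (simp_all add: a_def[abs_def] b_def[abs_def])
  have "(\<lambda>(m, k). a m * b k) summable_on UNIV \<times> UNIV"
  proof (rule summable_on_SigmaI[where g="\<lambda>m. a m * infsum b UNIV"])
    show "((\<lambda>k. case (m, k) of (m, k) \<Rightarrow> a m * b k) has_sum a m * infsum b UNIV) UNIV" for m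
      using has_sum_cmult_right[OF has_sum_infsum[OF sb], of "a m"] by simp
    show "(\<lambda>m. a m * infsum b UNIV) summable_on UNIV" by (rule summable_on_cmult_left[OF sa])
  qed (use nn' in auto)
  also have "?this \<longleftrightarrow> (\<lambda>(n, k). a (n - k) * b k) summable_on UNIV \<times> UNIV"
    by (rule summable_on_reindex_bij_witness[of _ "\<lambda>(n, k). (n - k, k)" "\<lambda>(m, k). (m + k, k)"]) auto
  finally have prod: "(\<lambda>(n, k). a (n - k) * b k) summable_on UNIV \<times> UNIV" .
  have sab: "(\<lambda>k. a (n - k) * b k) summable_on UNIV" for n
    using summable_on_SigmaD1[OF prod, of n] by simp
  have w: "(of_int \<bar>n\<bar> + 1) * (\<alpha> (n - k) * \<beta> k) \<le> a (n - k) * b k" for n k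
  proof -
    have "of_int \<bar>n\<bar> + 1 \<le> (of_int \<bar>n - k\<bar> + 1) * (of_int \<bar>k\<bar> + 1 :: real)"
    proof -
      have "\<bar>n\<bar> + 1 \<le> (\<bar>n - k\<bar> + \<bar>k\<bar>) + 1 + \<bar>n - k\<bar> * \<bar>k\<bar>"
        using abs_triangle_ineq[of "n - k" k] mult_nonneg_nonneg[OF abs_ge_zero abs_ge_zero, of "n - k" k]
        by linarith
      also have "\<dots> = (\<bar>n - k\<bar> + 1) * (\<bar>k\<bar> + 1)" by (simp add: algebra_simps)
      finally have "real_of_int (\<bar>n\<bar> + 1) \<le> real_of_int ((\<bar>n - k\<bar> + 1) * (\<bar>k\<bar> + 1))"
        by (simp only: of_int_le_iff)
      then show ?thesis by simp
    qed
    from mult_right_mono[OF this, of "\<alpha> (n - k) * \<beta> k"] nn show ?thesis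
      by (simp add: a_def b_def mult_ac)
  qed
  have le: "\<alpha> (n - k) * \<beta> k \<le> a (n - k) * b k" for n k
  proof -
    have "\<alpha> (n - k) * \<beta> k \<le> (of_int \<bar>n\<bar> + 1) * (\<alpha> (n - k) * \<beta> k)"
      using mult_right_mono[of 1 "of_int \<bar>n\<bar> + 1" "\<alpha> (n - k) * \<beta> k"] mult_nonneg_nonneg[OF nn(1)[of "n - k"] nn(2)[of k]]
      by simp
    with w[of n k] show ?thesis by linarith
  qed
  show s: "(\<lambda>k. \<alpha> (n - k) * \<beta> k) summable_on UNIV" for n
    by (rule summable_on_comparison_test[OF sab[of n]]) (auto intro: le mult_nonneg_nonneg nn)
  have "(\<lambda>n. \<Sum>\<^sub>\<infinity>k. a (n - k) * b k) summable_on UNIV"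
    using summable_on_Sigma_banach[OF prod] by simp
  then show "(\<lambda>n. (of_int \<bar>n\<bar> + 1) * (\<Sum>\<^sub>\<infinity>k. \<alpha> (n - k) * \<beta> k)) summable_on UNIV"
  proof (rule summable_on_comparison_test)
    fix n :: int
    show "0 \<le> (of_int \<bar>n\<bar> + 1) * (\<Sum>\<^sub>\<infinity>k. \<alpha> (n - k) * \<beta> k)"
      by (intro mult_nonneg_nonneg infsum_nonneg nn) auto
    have "(of_int \<bar>n\<bar> + 1) * (\<Sum>\<^sub>\<infinity>k. \<alpha> (n - k) * \<beta> k) = (\<Sum>\<^sub>\<infinity>k. (of_int \<bar>n\<bar> + 1) * (\<alpha> (n - k) * \<beta> k))"
      by (rule infsum_cmult_right'[symmetric])
    also have "\<dots> \<le> (\<Sum>\<^sub>\<infinity>k. a (n - k) * b k)"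
      by (intro infsum_mono summable_on_cmult_right s sab w)
    finally show "(of_int \<bar>n\<bar> + 1) * (\<Sum>\<^sub>\<infinity>k. \<alpha> (n - k) * \<beta> k) \<le> (\<Sum>\<^sub>\<infinity>k. a (n - k) * b k)" .
  qed
qed

lemma weighted_wiener_product:
  assumes a: "bdd_entries a" "weighted_wiener (fourier_coeff a)"
    and b: "bdd_entries b" "weighted_wiener (fourier_coeff b)"
    and eq: "AE t in angle_measure. c (cis t) = a (cis t) ** b (cis t)"
  shows "weighted_wiener (fourier_coeff (c :: complex \<Rightarrow> complex^'n^'n))"
proof -
  let ?\<alpha> = "\<lambda>k. norm (fourier_coeff a k)" and ?\<beta> = "\<lambda>k. norm (fourier_coeff b k)"
  let ?conv = "\<lambda>n. \<Sum>\<^sub>\<infinity>k. ?\<alpha> (n - k) * ?\<beta> k"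
  let ?N = "real CARD('n)"
  note conv = weighted_convolution_summable[of ?\<alpha> ?\<beta>, OF norm_ge_zero norm_ge_zero
      a(2)[unfolded weighted_wiener_def] b(2)[unfolded weighted_wiener_def]]
  have "norm (fourier_coeff c n) \<le> ?N^3 * ?conv n" for n
  proof -
    have ent: "norm (fourier_coeff c n $ i $ j) \<le> ?N * ?conv n" for i j
    proof (rule norm_infsum_le)
      show "((\<lambda>k. \<Sum>r\<in>UNIV. fourier_coeff a (n - k) $ i $ r * fourier_coeff b k $ r $ j) has_sum
        fourier_coeff c n $ i $ j) UNIV"
        by (rule fourier_coeff_product(2)[OF a(1) b(1) weighted_wiener_imp_wiener[OF b(2)] eq])
      show "((\<lambda>k. ?N * (?\<alpha> (n - k) * ?\<beta> k)) has_sum ?N * ?conv n) UNIV"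
        by (intro has_sum_cmult_right has_sum_infsum conv(1))
      fix k
      have "norm (\<Sum>r\<in>UNIV. fourier_coeff a (n - k) $ i $ r * fourier_coeff b k $ r $ j) \<le>
          (\<Sum>r\<in>(UNIV::'n set). ?\<alpha> (n - k) * ?\<beta> k)"
        by (rule order_trans[OF norm_sum], rule sum_mono, simp only: norm_mult, rule mult_mono)
           (simp_all add: norm_matrix_entry_le)
      then show "norm (\<Sum>r\<in>UNIV. fourier_coeff a (n - k) $ i $ r * fourier_coeff b k $ r $ j) \<le>
          ?N * (?\<alpha> (n - k) * ?\<beta> k)" by simp
    qed
    have "norm (fourier_coeff c n) \<le> (\<Sum>i\<in>(UNIV::'n set). \<Sum>j\<in>(UNIV::'n set). ?N * ?conv n)"
      by (rule order_trans[OF norm_matrix_le_sum]) (intro sum_mono ent)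
    then show ?thesis by (simp add: power3_eq_cube mult_ac)
  qed
  then show ?thesis
    unfolding weighted_wiener_def
    by (intro summable_on_comparison_test[OF summable_on_cmult_right[OF conv(2), of "?N^3"]])
       (auto simp: mult.left_commute intro!: mult_left_mono)
qed

section \<open>Laurent matrices\<close>

hide_const (open) Matrix.mat
hide_fact (open) Matrix.mat_def Matrix.vec_eq_iff

text \<open>
  Taking \<open>f j k = j - k\<close> bounds the rows and \<open>f j k = k - j\<close> the columns of a Laurent matrix.
\<close>

lemma row_le_laurent:
  fixes c :: "int \<Rightarrow> complex^'n^'n"
  assumes bound: "\<And>p q. norm (M p q) \<le> norm (c (f (fst p) (fst q)))"
    and inj: "\<And>j. inj (f j)" and c: "wiener c"
  shows "row_le (real CARD('n) * (\<Sum>\<^sub>\<infinity>k. norm (c k))) (M :: int \<times> 'n \<Rightarrow> int \<times> 'n \<Rightarrow> complex)"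
  unfolding row_le_def
proof (intro allI impI)
  fix p and F :: "(int \<times> 'n) set" assume F: "finite F"
  have "(\<Sum>q\<in>F. norm (M p q)) \<le> (\<Sum>q\<in>F. norm (c (f (fst p) (fst q))))"
    by (intro sum_mono bound)
  also have "\<dots> \<le> (\<Sum>q\<in>fst ` F \<times> (UNIV::'n set). norm (c (f (fst p) (fst q))))"
    using F by (intro sum_mono2) (auto intro: rev_image_eqI)
  also have "\<dots> = real CARD('n) * (\<Sum>k\<in>fst ` F. norm (c (f (fst p) k)))"
    by (simp add: sum.cartesian_product' sum_distrib_left)
  also have "(\<Sum>k\<in>fst ` F. norm (c (f (fst p) k))) = (\<Sum>m\<in>f (fst p) ` fst ` F. norm (c m))"
    by (subst sum.reindex) (auto intro: inj_on_subset[OF inj])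
  also have "\<dots> \<le> (\<Sum>\<^sub>\<infinity>k. norm (c k))"
    using F c unfolding wiener_def by (intro finite_sum_le_infsum) auto
  finally show "(\<Sum>q\<in>F. norm (M p q)) \<le> real CARD('n) * (\<Sum>\<^sub>\<infinity>k. norm (c k))"
    by (simp add: mult_left_mono)
qed

text \<open>
  The block Laurent matrix, with block row and block column as first components of the
  indices. The value \<open>0\<close> at sequences that are not summable is a default.
\<close>

lift_definition lmat :: "(int \<Rightarrow> complex^'n^'n) \<Rightarrow> (int \<times> 'n) smat" is
  "\<lambda>c p q. if wiener c then c (fst p - fst q) $ snd p $ snd q else 0"
proof -
  fix c :: "int \<Rightarrow> complex^'n^'n"
  show "schur (\<lambda>p q. if wiener c then c (fst p - fst q) $ snd p $ snd q else 0)"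
  proof (cases "wiener c")
    case True
    have "row_le (real CARD('n) * (\<Sum>\<^sub>\<infinity>k. norm (c k))) (\<lambda>p q. c (fst p - fst q) $ snd p $ snd q)"
      by (rule row_le_laurent[where f="\<lambda>j k. j - k", OF _ _ True]) (auto simp: norm_matrix_entry_le inj_def)
    moreover have "row_le (real CARD('n) * (\<Sum>\<^sub>\<infinity>k. norm (c k))) (mtransp (\<lambda>p q. c (fst p - fst q) $ snd p $ snd q))"
      by (rule row_le_laurent[where f="\<lambda>j k. k - j", OF _ _ True]) (auto simp: norm_matrix_entry_le inj_def mtransp_def)
    ultimately show ?thesis using True by (auto simp: schur_def)
  next
    case False
    then show ?thesis using schur_diag[of "\<lambda>_. 0" 0] by simp
  qed
qed

lemma entry_lmat: "wiener c \<Longrightarrow> entry (lmat c) p q = c (fst p - fst q) $ snd p $ snd q"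
  by (simp add: lmat.rep_eq)

lemma lmat_product:
  assumes a: "bdd_entries a" "wiener (fourier_coeff a)" and b: "bdd_entries b" "wiener (fourier_coeff b)"
    and c: "wiener (fourier_coeff c)"
    and eq: "AE t in angle_measure. c (cis t) = a (cis t) ** b (cis t)"
  shows "lmat (fourier_coeff a) * lmat (fourier_coeff b) = lmat (fourier_coeff (c :: complex \<Rightarrow> complex^'n^'n))"
proof (rule smat_eqI)
  fix p q :: "int \<times> 'n"
  obtain j i where p: "p = (j, i)" by (cases p)
  obtain l m where q: "q = (l, m)" by (cases q)
  let ?t = "\<lambda>k r. fourier_coeff a (j - k) $ i $ r * fourier_coeff b (k - l) $ r $ m"
  have s: "(\<lambda>x. ?t (fst x) (snd x)) summable_on UNIV"
    using smat_summable[of "lmat (fourier_coeff a)" p "lmat (fourier_coeff b)" q]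
    by (simp add: entry_lmat a b p q)
  have "entry (lmat (fourier_coeff a) * lmat (fourier_coeff b)) p q = (\<Sum>\<^sub>\<infinity>x. ?t (fst x) (snd x))"
    by (simp add: entry_times mmul_def entry_lmat a b p q)
  also have "\<dots> = (\<Sum>\<^sub>\<infinity>k. \<Sum>\<^sub>\<infinity>r. ?t k r)"
    using infsum_Sigma_banach[of "\<lambda>x. ?t (fst x) (snd x)" UNIV "\<lambda>_. UNIV"] s by simp
  also have "\<dots> = (\<Sum>\<^sub>\<infinity>k. \<Sum>r\<in>UNIV. ?t k r)" by simp
  also have "\<dots> = (\<Sum>\<^sub>\<infinity>k. \<Sum>r\<in>UNIV. fourier_coeff a (j - l - k) $ i $ r * fourier_coeff b k $ r $ m)"
    by (rule infsum_reindex_bij_witness[of _ "\<lambda>k. k + l" "\<lambda>k. k - l"]) (auto simp: algebra_simps)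
  also have "\<dots> = fourier_coeff c (j - l) $ i $ m"
    by (rule infsumI[OF fourier_coeff_product(2)[OF a(1) b eq]])
  finally show "entry (lmat (fourier_coeff a) * lmat (fourier_coeff b)) p q = entry (lmat (fourier_coeff c)) p q"
    by (simp add: entry_lmat c p q)
qed

lemma fourier_coeff_identity:
  assumes "AE t in angle_measure. c (cis t) = mat 1"
  shows "wiener (fourier_coeff c)" "lmat (fourier_coeff c) = 1"
proof -
  have b: "bdd_entries (\<lambda>_. mat 1)" by (simp add: bdd_entries_def)
  have "AE t in angle_measure. (\<lambda>_. mat 1) (cis t) = c (cis t)"
    using assms by eventually_elim simp
  then have "fourier_coeff c = fourier_coeff (\<lambda>_. mat 1)" by (rule fourier_coeff_cong_AE[OF b])
  moreover have "fourier_coeff (\<lambda>_. mat 1) k = (if k = 0 then mat 1 else (0 :: complex^'a^'a))" for k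
  proof -
    have "fint (\<lambda>_. z) k = z * (of_bool (k = 0) * (2 * pi))" for z
      using fint_cis[of 0 k] fint_cmult[of z "\<lambda>_. 1" k] by simp
    then show ?thesis
      by (simp add: vec_eq_iff fourier_coeff_entry mat_def)
  qed
  ultimately have eq: "fourier_coeff c = (\<lambda>k. if k = 0 then mat 1 else 0)" by (simp add: fun_eq_iff)
  have "(\<lambda>k. norm (fourier_coeff c k)) summable_on {0}" by simp
  then show w: "wiener (fourier_coeff c)"
    unfolding wiener_def by (rule summable_on_cong_neutral[THEN iffD1, rotated -1]) (auto simp: eq)
  show "lmat (fourier_coeff c) = 1"
    by (intro smat_eqI, simp only: entry_lmat[OF w] one_smat.rep_eq) (auto simp: eq mat_def prod_eq_iff)
qed

text \<open>
  In the region \<open>\<bar>j\<bar> \<le> \<bar>j - k\<bar>\<close> the diagonal \<open>j - k = m\<close> has at most \<open>2 \<bar>m\<bar> + 1\<close> blocks, and the weight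
  pays for them.
\<close>

lemma l1mat_hankel:
  fixes K :: "(int \<times> 'n::finite) smat" and c :: "int \<Rightarrow> complex^'n^'n"
  assumes c: "weighted_wiener c"
    and bound: "\<And>p q. norm (entry K p q) \<le> of_bool (\<bar>fst p\<bar> \<le> \<bar>fst p - fst q\<bar>) * norm (c (fst p - fst q))"
  shows "l1mat K"
proof -
  let ?S = "\<Sum>\<^sub>\<infinity>k. (of_int \<bar>k\<bar> + 1) * norm (c k)" and ?N = "real CARD('n)"
  let ?h = "\<lambda>j k. of_bool (\<bar>j\<bar> \<le> \<bar>j - k\<bar>) * norm (c (j - k))"
  have "l1_le (?N * (?N * (2 * ?S))) (absm (entry K))"
    unfolding l1_le_def
  proof (intro conjI allI impI)
    fix F :: "(int \<times> 'n) set" assume F: "finite F"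
    define J where "J = fst ` F"
    have J: "finite J" using F by (simp add: J_def)
    have sub: "F \<subseteq> J \<times> UNIV" by (auto simp: J_def intro: rev_image_eqI)
    have "(\<Sum>p\<in>F. \<Sum>q\<in>F. absm (entry K) p q) \<le> (\<Sum>p\<in>F. \<Sum>q\<in>F. ?h (fst p) (fst q))"
      unfolding absm_def by (intro sum_mono bound)
    also have "\<dots> \<le> (\<Sum>p\<in>F. \<Sum>q\<in>J \<times> (UNIV::'n set). ?h (fst p) (fst q))"
      using J sub by (intro sum_mono sum_mono2) auto
    also have "\<dots> \<le> (\<Sum>p\<in>J \<times> (UNIV::'n set). \<Sum>q\<in>J \<times> (UNIV::'n set). ?h (fst p) (fst q))"
      using J sub by (intro sum_mono2) (auto intro: sum_nonneg)
    also have "\<dots> = ?N * (?N * (\<Sum>j\<in>J. \<Sum>k\<in>J. ?h j k))"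
      by (simp add: sum.cartesian_product' sum_distrib_left)
    also have "(\<Sum>j\<in>J. \<Sum>k\<in>J. ?h j k) \<le> 2 * ?S"
    proof -
      define M where "M = (\<lambda>(j, k). j - k) ` (J \<times> J)"
      have M: "finite M" using J by (simp add: M_def)
      have "(\<Sum>j\<in>J. \<Sum>k\<in>J. ?h j k) = (\<Sum>j\<in>J. \<Sum>m\<in>(\<lambda>k. j - k) ` J. of_bool (\<bar>j\<bar> \<le> \<bar>m\<bar>) * norm (c m))"
        by (rule sum.cong[OF refl], subst sum.reindex) (auto intro: inj_onI)
      also have "\<dots> \<le> (\<Sum>j\<in>J. \<Sum>m\<in>M. of_bool (\<bar>j\<bar> \<le> \<bar>m\<bar>) * norm (c m))"
        using M by (intro sum_mono sum_mono2) (auto simp: M_def)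
      also have "\<dots> = (\<Sum>m\<in>M. \<Sum>j\<in>J. of_bool (\<bar>j\<bar> \<le> \<bar>m\<bar>) * norm (c m))" by (rule sum.swap)
      also have "\<dots> \<le> (\<Sum>m\<in>M. 2 * ((of_int \<bar>m\<bar> + 1) * norm (c m)))"
      proof (rule sum_mono)
        fix m
        have "(\<Sum>j\<in>J. of_bool (\<bar>j\<bar> \<le> \<bar>m\<bar>) * norm (c m)) = (\<Sum>j\<in>J \<inter> {j. \<bar>j\<bar> \<le> \<bar>m\<bar>}. norm (c m))"
          using J by (intro sum.mono_neutral_cong_right) auto
        also have "\<dots> = real (card (J \<inter> {j. \<bar>j\<bar> \<le> \<bar>m\<bar>})) * norm (c m)" by simp
        also have "\<dots> \<le> 2 * (of_int \<bar>m\<bar> + 1) * norm (c m)"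
        proof (rule mult_right_mono)
          have "card (J \<inter> {j. \<bar>j\<bar> \<le> \<bar>m\<bar>}) \<le> card {-\<bar>m\<bar>..\<bar>m\<bar>}"
            by (intro card_mono) auto
          also have "\<dots> = nat (2 * \<bar>m\<bar> + 1)" by simp
          finally have "real (card (J \<inter> {j. \<bar>j\<bar> \<le> \<bar>m\<bar>})) \<le> real (nat (2 * \<bar>m\<bar> + 1))" by simp
          also have "\<dots> = 2 * of_int \<bar>m\<bar> + 1" by (simp add: of_nat_nat)
          finally show "real (card (J \<inter> {j. \<bar>j\<bar> \<le> \<bar>m\<bar>})) \<le> 2 * (of_int \<bar>m\<bar> + 1)" by simp
        qed simp
        finally show "(\<Sum>j\<in>J. of_bool (\<bar>j\<bar> \<le> \<bar>m\<bar>) * norm (c m)) \<le> 2 * ((of_int \<bar>m\<bar> + 1) * norm (c m))"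
          by (simp only: mult.assoc)
      qed
      also have "\<dots> = 2 * (\<Sum>m\<in>M. (of_int \<bar>m\<bar> + 1) * norm (c m))" by (simp only: sum_distrib_left)
      also have "\<dots> \<le> 2 * ?S"
        using M c unfolding weighted_wiener_def
        by (intro mult_left_mono finite_sum_le_infsum) auto
      finally show ?thesis .
    qed
    finally show "(\<Sum>p\<in>F. \<Sum>q\<in>F. absm (entry K) p q) \<le> ?N * (?N * (2 * ?S))"
      by (simp add: mult_left_mono)
  qed (simp add: absm_def)
  then show ?thesis by (auto simp: l1mat_def)
qed

text \<open>
  The commutator lives where exactly one of the two block indices is negative, and there
  \<open>\<bar>j\<bar> \<le> \<bar>j - k\<bar>\<close>.
\<close>

lemma l1mat_commutator:
  fixes c :: "int \<Rightarrow> complex^'n^'n" and X :: "(int \<times> 'n) set"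
  assumes c: "weighted_wiener c" and X: "X = {p. 0 \<le> fst p} \<or> X = {p. fst p < 0}"
  shows "l1mat (cut X * lmat c - lmat c * cut X)"
proof (rule l1mat_hankel[OF c])
  fix p q :: "int \<times> 'n"
  have "entry (cut X * lmat c - lmat c * cut X) p q =
     (of_bool (p \<in> X) - of_bool (q \<in> X)) * (c (fst p - fst q) $ snd p $ snd q)"
    by (simp add: entry_minus entry_cut_times entry_times_cut entry_lmat weighted_wiener_imp_wiener[OF c] algebra_simps)
  then show "norm (entry (cut X * lmat c - lmat c * cut X) p q) \<le>
      of_bool (\<bar>fst p\<bar> \<le> \<bar>fst p - fst q\<bar>) * norm (c (fst p - fst q))"
    using X norm_matrix_entry_le[of "c (fst p - fst q)" "snd p" "snd q"]
    by (cases "p \<in> X"; cases "q \<in> X") (auto simp: norm_mult)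
qed

lemma lower_lmat:
  assumes "wiener c" "\<And>k. k < 0 \<Longrightarrow> c k = 0" shows "lower fst (lmat c)"
  using assms by (auto simp: lower_def entry_lmat)

lemma upper_lmat:
  assumes "wiener c" "\<And>k. k > 0 \<Longrightarrow> c k = 0" shows "lower (\<lambda>p. - fst p) (lmat c)"
  using assms by (auto simp: lower_def entry_lmat)

text \<open>
  A column of a matrix as a sequence of vectors. All operators in question map columns to columns,
  so their entries can be read off from matrix products.
\<close>

definition mcol :: "(int \<times> 'n::finite \<Rightarrow> 'k \<Rightarrow> complex) \<Rightarrow> 'k \<Rightarrow> 'n sequence" where
  "mcol M q = (\<lambda>k. \<chi> i. M (k, i) q)"

definition col :: "(int \<times> 'n::finite) smat \<Rightarrow> int \<times> 'n \<Rightarrow> 'n sequence" where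
  "col M q = mcol (entry M) q"

lemma unit_seq_col: "unit_seq q = col 1 q"
  by (rule ext) (auto simp: unit_seq_def col_def mcol_def one_smat.rep_eq vec_eq_iff axis_def prod_eq_iff)

lemma proj_Qn_col: "proj_Qn n (col M q) = col (cut {p. n \<le> fst p} * M) q"
  by (rule ext) (auto simp: proj_Qn_def col_def mcol_def entry_cut_times vec_eq_iff)

lemma cut_Compl: "cut (- X) = 1 - cut X"
  by (intro smat_eqI) (auto simp: entry_cut entry_simps)

lemma col_diff: "col M q - col N q = col (M - N) q"
  by (rule ext) (auto simp: col_def mcol_def entry_minus vec_eq_iff)

lemma scale_col: "seq_scale s (col M q) = col (scal s * M) q"
  by (rule ext) (auto simp: col_def mcol_def seq_scale_def entry_scal_times vec_eq_iff)

lemma laurent_mcol: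
  fixes M :: "int \<times> 'n::finite \<Rightarrow> 'k \<Rightarrow> complex"
  assumes w: "wiener (fourier_coeff a)" and M: "row_le C M"
  shows "laurent a (mcol M q) = mcol (mmul (entry (lmat (fourier_coeff a))) M) q"
proof (rule ext)
  fix j
  let ?c = "fourier_coeff a" and ?L = "lmat (fourier_coeff a)"
  obtain D where D: "row_le D (entry ?L)" using schur_entry[of ?L] by (auto simp: schur_def)
  have s: "(\<lambda>(k, r). entry ?L (j, i) (k, r) * M (k, r) q) summable_on UNIV \<times> UNIV" for i
    using mmul_summable[OF D M, of "(j, i)" q] by (simp add: case_prod_unfold)
  have ent: "(?c (j - k) *v mcol M q k) $ i = (\<Sum>\<^sub>\<infinity>r. entry ?L (j, i) (k, r) * M (k, r) q)" for i k
    by (simp add: matrix_vector_mult_def mcol_def entry_lmat[OF w])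
  have "((\<lambda>k. (?c (j - k) *v mcol M q k) $ i) has_sum mmul (entry ?L) M (j, i) q) UNIV" for i
  proof -
    have "(\<lambda>k. (?c (j - k) *v mcol M q k) $ i) summable_on UNIV"
      unfolding ent using summable_on_Sigma_banach[OF s[of i]] by simp
    moreover have "(\<Sum>\<^sub>\<infinity>k. (?c (j - k) *v mcol M q k) $ i) = mmul (entry ?L) M (j, i) q"
      unfolding ent mmul_def
      using infsum_Sigma'_banach[OF s[of i]] by (simp add: case_prod_unfold)
    ultimately show ?thesis by (simp add: has_sum_iff)
  qed
  then have "((\<lambda>k. ?c (j - k) *v mcol M q k) has_sum mcol (mmul (entry ?L) M) q j) UNIV"
    unfolding has_sum_def by (intro vec_tendstoI) (simp add: mcol_def)
  then show "laurent a (mcol M q) j = mcol (mmul (entry ?L) M) q j"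
    unfolding laurent_def by (rule infsumI)
qed

lemma laurent_col:
  assumes "wiener (fourier_coeff a)"
  shows "laurent a (col M q) = col (lmat (fourier_coeff a) * M) q"
proof -
  obtain C where "row_le C (entry M)" using schur_entry[of M] by (auto simp: schur_def)
  from laurent_mcol[OF assms this] show ?thesis by (simp add: col_def entry_times)
qed

text \<open>
  A bounded sequence is a matrix with one column, so this is associativity of
  matrix products.
\<close>

lemma laurent_inverse:
  assumes w: "wiener (fourier_coeff a)" "wiener (fourier_coeff b)"
    and inv: "lmat (fourier_coeff a) * lmat (fourier_coeff b) = 1"
    and x: "\<And>k. norm (x k) \<le> C"
  shows "laurent a (laurent b x) = x"
proof -
  let ?A = "entry (lmat (fourier_coeff a))" and ?B = "entry (lmat (fourier_coeff b))"
  define M :: "int \<times> 'a \<Rightarrow> unit \<Rightarrow> complex" where "M p u = x (fst p) $ snd p" for p u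
  have M: "row_le C M"
    unfolding row_le_def
  proof (intro allI impI)
    fix p and F :: "unit set"
    have "(\<Sum>q\<in>F. norm (M p q)) \<le> (\<Sum>q\<in>(UNIV::unit set). norm (M p q))" by (intro sum_mono2) auto
    also have "\<dots> = norm (x (fst p) $ snd p)" by (simp add: M_def UNIV_unit)
    also have "\<dots> \<le> C" by (rule order_trans[OF Finite_Cartesian_Product.norm_nth_le x])
    finally show "(\<Sum>q\<in>F. norm (M p q)) \<le> C" .
  qed
  obtain D E where D: "row_le D ?A" and E: "row_le E ?B"
    using schur_entry[of "lmat (fourier_coeff a)"] schur_entry[of "lmat (fourier_coeff b)"] by (auto simp: schur_def)
  have xM: "x = mcol M ()" by (simp add: mcol_def M_def fun_eq_iff vec_eq_iff)
  have "laurent a (laurent b x) = mcol (mmul ?A (mmul ?B M)) ()"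
    unfolding xM laurent_mcol[OF w(2) M] laurent_mcol[OF w(1) row_le_mmul[OF E M]] ..
  also have "mmul ?A (mmul ?B M) = mmul (mmul ?A ?B) M" by (rule mmul_assoc[OF D E M, symmetric])
  also have "mmul ?A ?B = (\<lambda>p q. of_bool (p = q) * 1)"
    unfolding entry_times[symmetric] inv by (simp add: one_smat.rep_eq)
  also have "mmul \<dots> M = M" by (intro ext) (simp only: mmul_delta_left mult_1)
  finally show ?thesis by (simp only: xM)
qed

lemma fredholm_det_eq_op_det:
  assumes "\<And>q. (T - id) (unit_seq q) = col (M - 1) q"
  shows "fredholm_det T = op_det M"
proof -
  have "op_entry (T - id) = entry (M - 1)"
    by (intro ext) (simp only: op_entry_def assms col_def mcol_def, simp)
  then show ?thesis
    by (simp add: fredholm_det_def op_det_def fdet_def principal_minor_def[abs_def] minor_def[abs_def])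
qed

section \<open>Bounded operators on the sequence space\<close>

text \<open>
  Estimates in \<open>l2\<close> reduce to finite sections, where the inequalities for \<open>L2_set\<close> apply.
\<close>

lemma l2_bound_iff:
  assumes "0 \<le> C"
  shows "x \<in> l2 \<and> l2_norm x \<le> C \<longleftrightarrow> (\<forall>F. finite F \<longrightarrow> L2_set (\<lambda>k. norm (x k)) F \<le> C)"
proof -
  have sq: "L2_set (\<lambda>k. norm (x k)) F \<le> C \<longleftrightarrow> (\<Sum>k\<in>F. (norm (x k))\<^sup>2) \<le> C\<^sup>2" for F
    unfolding L2_set_def using assms by (simp add: real_sqrt_le_iff real_le_lsqrt sqrt_le_D power_mono real_sqrt_le_iff[of _ "C\<^sup>2", symmetric] del: real_sqrt_le_iff)
  show ?thesis
  proof
    assume x: "x \<in> l2 \<and> l2_norm x \<le> C"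
    then have "(\<Sum>\<^sub>\<infinity>k. (norm (x k))\<^sup>2) \<le> C\<^sup>2"
      unfolding l2_norm_def using sqrt_le_D by blast
    moreover have "(\<Sum>k\<in>F. (norm (x k))\<^sup>2) \<le> (\<Sum>\<^sub>\<infinity>k. (norm (x k))\<^sup>2)" if "finite F" for F
      using x that unfolding l2_def by (intro finite_sum_le_infsum) auto
    ultimately show "\<forall>F. finite F \<longrightarrow> L2_set (\<lambda>k. norm (x k)) F \<le> C"
      unfolding sq by (meson order_trans)
  next
    assume b: "\<forall>F. finite F \<longrightarrow> L2_set (\<lambda>k. norm (x k)) F \<le> C"
    then have b': "(\<Sum>k\<in>F. norm ((norm (x k))\<^sup>2)) \<le> C\<^sup>2" if "finite F" for F
      using that unfolding sq by simp
    from abs_summable_bounded[of UNIV "\<lambda>k. (norm (x k))\<^sup>2" "C\<^sup>2"] b'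
    have "(\<lambda>k. (norm (x k))\<^sup>2) summable_on UNIV" "(\<Sum>\<^sub>\<infinity>k. (norm (x k))\<^sup>2) \<le> C\<^sup>2" by simp_all
    then show "x \<in> l2 \<and> l2_norm x \<le> C"
      using assms by (auto simp: l2_def l2_norm_def intro: real_le_lsqrt infsum_nonneg)
  qed
qed

lemma l2_norm_nonneg [simp]: "0 \<le> l2_norm x"
  unfolding l2_norm_def by (intro real_sqrt_ge_zero infsum_nonneg) simp

lemma L2_set_le_l2_norm:
  assumes "x \<in> l2" "finite F" shows "L2_set (\<lambda>k. norm (x k)) F \<le> l2_norm x"
  using l2_bound_iff[of "l2_norm x" x] assms by simp

lemma l2_boundI:
  assumes "\<And>F. finite F \<Longrightarrow> L2_set (\<lambda>k. norm (x k)) F \<le> C"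
  shows "x \<in> l2" "l2_norm x \<le> C"
proof -
  have "0 \<le> C" using assms[of "{}"] by simp
  from l2_bound_iff[OF this, of x] assms show "x \<in> l2" "l2_norm x \<le> C" by simp_all
qed

lemma l2_entry_le: "x \<in> l2 \<Longrightarrow> norm (x k) \<le> l2_norm x"
  using L2_set_le_l2_norm[of x "{k}"] by (simp add: L2_set_def)

lemma l2_add:
  assumes "x \<in> l2" "y \<in> l2"
  shows "x + y \<in> l2" "l2_norm (x + y) \<le> l2_norm x + l2_norm y"
proof -
  have *: "L2_set (\<lambda>k. norm ((x + y) k)) F \<le> l2_norm x + l2_norm y" if "finite F" for F
  proof -
    have "L2_set (\<lambda>k. norm ((x + y) k)) F \<le> L2_set (\<lambda>k. norm (x k) + norm (y k)) F"
      by (intro L2_set_mono) (auto simp: norm_triangle_ineq)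
    also have "\<dots> \<le> L2_set (\<lambda>k. norm (x k)) F + L2_set (\<lambda>k. norm (y k)) F" by (rule L2_set_triangle_ineq)
    also have "\<dots> \<le> l2_norm x + l2_norm y" by (intro add_mono L2_set_le_l2_norm assms that)
    finally show ?thesis .
  qed
  show "x + y \<in> l2" by (rule l2_boundI(1)[OF *])
  show "l2_norm (x + y) \<le> l2_norm x + l2_norm y" by (rule l2_boundI(2)[OF *])
qed

lemma norm_vector_scalar_mult: "norm (c *s v) = norm c * norm v" for v :: "complex^'n"
  by (simp add: norm_vec_def L2_set_right_distrib norm_mult)

lemma l2_scale:
  assumes "x \<in> l2" shows "seq_scale c x \<in> l2" "l2_norm (seq_scale c x) \<le> norm c * l2_norm x"
proof -
  have "L2_set (\<lambda>k. norm (seq_scale c x k)) F \<le> norm c * l2_norm x" if "finite F" for F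
  proof -
    have "L2_set (\<lambda>k. norm (seq_scale c x k)) F = norm c * L2_set (\<lambda>k. norm (x k)) F"
      by (simp add: seq_scale_def norm_vector_scalar_mult L2_set_right_distrib)
    also have "\<dots> \<le> norm c * l2_norm x" by (intro mult_left_mono L2_set_le_l2_norm assms that) simp
    finally show ?thesis .
  qed
  from l2_boundI[OF this] show "seq_scale c x \<in> l2" "l2_norm (seq_scale c x) \<le> norm c * l2_norm x" by simp_all
qed

definition restr :: "int set \<Rightarrow> 'n::finite operator" where
  "restr X x = (\<lambda>k. if k \<in> X then x k else 0)"

lemma l2_restr:
  assumes "x \<in> l2" shows "restr X x \<in> l2" "l2_norm (restr X x) \<le> l2_norm x"
proof -
  have "L2_set (\<lambda>k. norm (restr X x k)) F \<le> l2_norm x" if "finite F" for F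
    by (rule order_trans[OF L2_set_mono L2_set_le_l2_norm[OF assms that]]) (auto simp: restr_def)
  from l2_boundI[OF this] show "restr X x \<in> l2" "l2_norm (restr X x) \<le> l2_norm x" by simp_all
qed

lemma norm_matrix_vector_mult: "norm (A *v v) \<le> norm A * norm v" for A :: "complex^'n^'m"
proof -
  have "norm ((A *v v) $ i) \<le> norm (A $ i) * norm v" for i
  proof -
    have "norm ((A *v v) $ i) \<le> (\<Sum>j\<in>UNIV. \<bar>norm (A $ i $ j)\<bar> * \<bar>norm (v $ j)\<bar>)"
      unfolding matrix_vector_mult_def by (simp add: norm_mult[symmetric]) (rule norm_sum)
    also have "\<dots> \<le> norm (A $ i) * norm v"
      unfolding norm_vec_def[of v] norm_vec_def[of "A $ i"] by (rule L2_set_mult_ineq)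
    finally show ?thesis .
  qed
  then have "norm (A *v v) \<le> L2_set (\<lambda>i. norm (A $ i) * norm v) UNIV"
    unfolding norm_vec_def[of "A *v v"] by (intro L2_set_mono) auto
  also have "\<dots> = norm A * norm v"
    unfolding norm_vec_def[of A] by (simp add: L2_set_left_distrib)
  finally show ?thesis .
qed

definition conv :: "(int \<Rightarrow> complex^'n^'n) \<Rightarrow> 'n::finite operator" where
  "conv c x = (\<lambda>j. \<Sum>\<^sub>\<infinity>k. c (j - k) *v x k)"

lemma laurent_eq_conv: "laurent a = conv (fourier_coeff a)"
  by (rule ext) (simp add: laurent_def conv_def)

lemma conv_has_sum:
  assumes c: "wiener c" and x: "x \<in> l2"
  shows "((\<lambda>k. c (j - k) *v x k) has_sum conv c x j) UNIV"
    and "((\<lambda>m. c m *v x (j - m)) has_sum conv c x j) UNIV"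
proof -
  have "(\<lambda>m. norm (c m *v x (j - m))) summable_on UNIV"
    by (rule summable_on_comparison_test[OF summable_on_cmult_left[OF c[unfolded wiener_def], of "l2_norm x"]])
       (auto intro!: order_trans[OF norm_matrix_vector_mult] mult_left_mono l2_entry_le x)
  then have s: "((\<lambda>m. c m *v x (j - m)) has_sum (\<Sum>\<^sub>\<infinity>m. c m *v x (j - m))) UNIV"
    by (rule has_sum_infsum[OF abs_summable_summable])
  have reindex: "((\<lambda>k. c (j - k) *v x k) has_sum S) UNIV \<longleftrightarrow> ((\<lambda>m. c m *v x (j - m)) has_sum S) UNIV" for S
    by (rule has_sum_reindex_bij_witness[of _ "\<lambda>k. j - k" "\<lambda>k. j - k"]) auto
  from s show k: "((\<lambda>k. c (j - k) *v x k) has_sum conv c x j) UNIV"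
    unfolding reindex[symmetric] conv_def by (auto simp: has_sum_iff)
  then show "((\<lambda>m. c m *v x (j - m)) has_sum conv c x j) UNIV"
    by (simp only: reindex)
qed

lemma L2_set_sum_le:
  "finite G \<Longrightarrow> L2_set (\<lambda>j. \<Sum>m\<in>G. f m j) F \<le> (\<Sum>m\<in>G. L2_set (f m) F)"
proof (induction G rule: finite_induct)
  case empty then show ?case by (simp add: L2_set_def)
next
  case (insert m G)
  then show ?case by (auto intro: order_trans[OF L2_set_triangle_ineq])
qed

text \<open>
  Minkowski's inequality, applied to the sum of the shifts of \<open>x\<close> with coefficients \<open>c m\<close>.
\<close>

lemma l2_conv:
  assumes c: "wiener c" and x: "x \<in> l2"
  shows "conv c x \<in> l2" "l2_norm (conv c x) \<le> (\<Sum>\<^sub>\<infinity>k. norm (c k)) * l2_norm x"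
proof -
  let ?S = "\<Sum>\<^sub>\<infinity>k. norm (c k)"
  have "L2_set (\<lambda>j. norm (conv c x j)) F \<le> ?S * l2_norm x" if F: "finite F" for F
  proof -
    have part: "L2_set (\<lambda>j. norm (\<Sum>m\<in>G. c m *v x (j - m))) F \<le> ?S * l2_norm x" if G: "finite G" for G
    proof -
      have "L2_set (\<lambda>j. norm (\<Sum>m\<in>G. c m *v x (j - m))) F \<le> L2_set (\<lambda>j. \<Sum>m\<in>G. norm (c m) * norm (x (j - m))) F"
        by (intro L2_set_mono order_trans[OF norm_sum] sum_mono norm_matrix_vector_mult) auto
      also have "\<dots> \<le> (\<Sum>m\<in>G. L2_set (\<lambda>j. norm (c m) * norm (x (j - m))) F)"
        by (rule L2_set_sum_le[OF G])
      also have "\<dots> \<le> (\<Sum>m\<in>G. norm (c m) * l2_norm x)"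
      proof (rule sum_mono)
        fix m
        have "L2_set (\<lambda>j. norm (x (j - m))) F = L2_set (\<lambda>k. norm (x k)) ((\<lambda>j. j - m) ` F)"
          unfolding L2_set_def by (subst sum.reindex) (auto intro: inj_onI)
        also have "\<dots> \<le> l2_norm x" using F by (intro L2_set_le_l2_norm x) auto
        finally show "L2_set (\<lambda>j. norm (c m) * norm (x (j - m))) F \<le> norm (c m) * l2_norm x"
          by (simp add: L2_set_right_distrib[symmetric] mult_left_mono)
      qed
      also have "\<dots> = (\<Sum>m\<in>G. norm (c m)) * l2_norm x" by (simp add: sum_distrib_right)
      also have "\<dots> \<le> ?S * l2_norm x"
        using c G unfolding wiener_def by (intro mult_right_mono finite_sum_le_infsum) auto
      finally show ?thesis .
    qed
    have "((\<lambda>G. L2_set (\<lambda>j. norm (\<Sum>m\<in>G. c m *v x (j - m))) F) \<longlongrightarrow> L2_set (\<lambda>j. norm (conv c x j)) F)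
        (finite_subsets_at_top UNIV)"
      using conv_has_sum(2)[OF c x] unfolding L2_set_def has_sum_def by (intro tendsto_intros)
    then show ?thesis
      by (rule tendsto_upperbound) (auto intro!: eventually_finite_subsets_at_top_weakI part)
  qed
  from l2_boundI[OF this] show "conv c x \<in> l2" "l2_norm (conv c x) \<le> ?S * l2_norm x" by simp_all
qed

lemma bounded_opI:
  assumes "\<And>x. x \<in> l2 \<Longrightarrow> A x \<in> l2" "\<And>x. x \<in> l2 \<Longrightarrow> l2_norm (A x) \<le> K * l2_norm x"
    "\<And>x y. x \<in> l2 \<Longrightarrow> y \<in> l2 \<Longrightarrow> A (x + y) = A x + A y"
    "\<And>z x. x \<in> l2 \<Longrightarrow> A (seq_scale z x) = seq_scale z (A x)"
  shows "bounded_op A"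
  unfolding bounded_op_def using assms by blast

lemma bounded_op_cong:
  assumes A: "bounded_op A" and eq: "\<And>x. x \<in> l2 \<Longrightarrow> B x = A x" shows "bounded_op B"
proof -
  obtain K where K: "\<And>x. x \<in> l2 \<Longrightarrow> l2_norm (A x) \<le> K * l2_norm x" using A unfolding bounded_op_def by blast
  show ?thesis
    using A K by (intro bounded_opI[where K=K]) (simp_all add: eq l2_add l2_scale bounded_op_def)
qed

lemma bounded_op_bound:
  assumes "bounded_op A" obtains K where "0 \<le> K" "\<And>x. x \<in> l2 \<Longrightarrow> l2_norm (A x) \<le> K * l2_norm x"
proof -
  obtain K where K: "\<And>x. x \<in> l2 \<Longrightarrow> l2_norm (A x) \<le> K * l2_norm x" using assms unfolding bounded_op_def by blast
  show thesis
  proof (rule that[of "\<bar>K\<bar>"])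
    fix x :: "'a sequence" assume "x \<in> l2"
    from K[OF this] show "l2_norm (A x) \<le> \<bar>K\<bar> * l2_norm x"
      by (rule order_trans) (intro mult_right_mono, auto)
  qed simp
qed

lemma bounded_op_comp:
  assumes A: "bounded_op A" and B: "bounded_op B" shows "bounded_op (A \<circ> B)"
proof -
  obtain K where K: "0 \<le> K" "\<And>x. x \<in> l2 \<Longrightarrow> l2_norm (A x) \<le> K * l2_norm x" using bounded_op_bound[OF A] by blast
  obtain L where L: "0 \<le> L" "\<And>x. x \<in> l2 \<Longrightarrow> l2_norm (B x) \<le> L * l2_norm x" using bounded_op_bound[OF B] by blast
  have B2: "\<And>x. x \<in> l2 \<Longrightarrow> B x \<in> l2" using B by (simp add: bounded_op_def)
  show ?thesis
  proof (rule bounded_opI[where K="K * L"])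
    fix x :: "'a sequence" assume x: "x \<in> l2"
    have "l2_norm (A (B x)) \<le> K * (L * l2_norm x)"
      using K(2)[OF B2[OF x]] mult_left_mono[OF L(2)[OF x] K(1)] by linarith
    then show "l2_norm ((A \<circ> B) x) \<le> K * L * l2_norm x" by (simp add: mult.assoc)
  qed (use A B in \<open>simp_all add: bounded_op_def\<close>)
qed

lemma seq_scale_add: "seq_scale z (x + y) = seq_scale z x + seq_scale z y"
  by (simp add: seq_scale_def fun_eq_iff vector_add_ldistrib)

lemma seq_scale_scale: "seq_scale z (seq_scale w x) = seq_scale (z * w) x"
  by (simp add: seq_scale_def fun_eq_iff vector_smult_assoc)

lemma bounded_op_add:
  assumes A: "bounded_op A" and B: "bounded_op B" shows "bounded_op (A + B)"
proof -
  obtain K where K: "0 \<le> K" "\<And>x. x \<in> l2 \<Longrightarrow> l2_norm (A x) \<le> K * l2_norm x" using bounded_op_bound[OF A] by blast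
  obtain L where L: "0 \<le> L" "\<And>x. x \<in> l2 \<Longrightarrow> l2_norm (B x) \<le> L * l2_norm x" using bounded_op_bound[OF B] by blast
  have m: "\<And>x. x \<in> l2 \<Longrightarrow> A x \<in> l2" "\<And>x. x \<in> l2 \<Longrightarrow> B x \<in> l2" using A B by (simp_all add: bounded_op_def)
  show ?thesis
  proof (rule bounded_opI[where K="K + L"])
    fix x :: "'a sequence" assume x: "x \<in> l2"
    show "l2_norm ((A + B) x) \<le> (K + L) * l2_norm x"
      using l2_add(2)[OF m(1)[OF x] m(2)[OF x]] K(2)[OF x] L(2)[OF x] by (simp add: distrib_right)
  qed (use A B in \<open>simp_all add: bounded_op_def l2_add seq_scale_add algebra_simps\<close>)
qed

lemma bounded_op_scale:
  assumes A: "bounded_op A" shows "bounded_op (z *\<^sub>o A)"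
proof -
  obtain K where K: "0 \<le> K" "\<And>x. x \<in> l2 \<Longrightarrow> l2_norm (A x) \<le> K * l2_norm x" using bounded_op_bound[OF A] by blast
  have m: "\<And>x. x \<in> l2 \<Longrightarrow> A x \<in> l2" using A by (simp add: bounded_op_def)
  show ?thesis
  proof (rule bounded_opI[where K="norm z * K"])
    fix x :: "'a sequence" assume x: "x \<in> l2"
    show "l2_norm ((z *\<^sub>o A) x) \<le> norm z * K * l2_norm x"
      unfolding op_scale_def
      using order_trans[OF l2_scale(2)[OF m[OF x], of z] mult_left_mono[OF K(2)[OF x]]] by (simp add: mult.assoc)
  qed (use A in \<open>simp_all add: bounded_op_def l2_scale op_scale_def seq_scale_add seq_scale_scale mult.commute\<close>)
qed

lemma op_diff_eq: "A - B = A + (- 1) *\<^sub>o B"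
  by (simp add: fun_eq_iff op_scale_def seq_scale_def vector_smult_lneg)

lemma bounded_op_diff: "bounded_op A \<Longrightarrow> bounded_op B \<Longrightarrow> bounded_op (A - B)"
  unfolding op_diff_eq by (intro bounded_op_add bounded_op_scale)

lemma bounded_op_restr: "bounded_op (restr X)"
  by (rule bounded_opI[where K=1]) (auto simp: l2_restr, auto simp: restr_def seq_scale_def fun_eq_iff)

lemma bounded_linear_vector_scalar_mult: "bounded_linear (\<lambda>v::complex^'n. z *s v)"
  by (rule bounded_linear_intro[where K="norm z"])
     (auto simp: vector_add_ldistrib norm_vector_scalar_mult mult.commute vec_eq_iff)

lemma bounded_op_conv:
  assumes c: "wiener c" shows "bounded_op (conv c)"
proof (rule bounded_opI[where K="\<Sum>\<^sub>\<infinity>k. norm (c k)"])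
  fix x y :: "'a sequence" and z assume x: "x \<in> l2" and y: "y \<in> l2"
  show "conv c x \<in> l2" "l2_norm (conv c x) \<le> (\<Sum>\<^sub>\<infinity>k. norm (c k)) * l2_norm x"
    using l2_conv[OF c x] .
  show "conv c (x + y) = conv c x + conv c y"
  proof
    fix j
    have "((\<lambda>k. c (j - k) *v (x + y) k) has_sum (conv c x j + conv c y j)) UNIV"
      using has_sum_add[OF conv_has_sum(1)[OF c x] conv_has_sum(1)[OF c y]]
      by (simp add: matrix_vector_right_distrib)
    then show "conv c (x + y) j = (conv c x + conv c y) j"
      using has_sum_unique[OF conv_has_sum(1)[OF c l2_add(1)[OF x y]]] by simp
  qed
  show "conv c (seq_scale z x) = seq_scale z (conv c x)"
  proof
    fix j
    have "((\<lambda>k. c (j - k) *v seq_scale z x k) has_sum (z *s conv c x j)) UNIV"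
      using has_sum_bounded_linear[OF bounded_linear_vector_scalar_mult conv_has_sum(1)[OF c x], of z]
      by (simp add: seq_scale_def vector_scalar_commute)
    then show "conv c (seq_scale z x) j = seq_scale z (conv c x) j"
      using has_sum_unique[OF conv_has_sum(1)[OF c l2_scale(1)[OF x]]] by (simp add: seq_scale_def)
  qed
qed

section \<open>Operators with summable approximation numbers\<close>

lemma l2_zero [simp]: "(\<lambda>_. 0) \<in> l2" "l2_norm (\<lambda>_. 0) = 0"
  by (simp_all add: l2_def l2_norm_def)

lemma bounded_op_zero: "bounded_op A \<Longrightarrow> A (\<lambda>_. 0) = (\<lambda>_. 0)"
proof -
  assume A: "bounded_op A"
  have "A (seq_scale 0 (\<lambda>_. 0)) = seq_scale 0 (A (\<lambda>_. 0))" using A by (simp add: bounded_op_def)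
  then show ?thesis by (simp add: seq_scale_def)
qed

lemma op_norm_bounds:
  assumes A: "bounded_op A" shows "0 \<le> op_norm A"
    and "(\<And>x. x \<in> l2 \<Longrightarrow> l2_norm (A x) \<le> C * l2_norm x) \<Longrightarrow> 0 \<le> C \<Longrightarrow> op_norm A \<le> C"
proof -
  obtain K where K: "0 \<le> K" "\<And>x. x \<in> l2 \<Longrightarrow> l2_norm (A x) \<le> K * l2_norm x" using bounded_op_bound[OF A] by blast
  let ?S = "{l2_norm (A x) | x. x \<in> l2 \<and> l2_norm x \<le> 1}"
  have ub: "y \<le> D" if "\<And>x. x \<in> l2 \<Longrightarrow> l2_norm (A x) \<le> D * l2_norm x" "0 \<le> D" and y: "y \<in> ?S" for y D
  proof -
    obtain x where x: "x \<in> l2" "l2_norm x \<le> 1" "y = l2_norm (A x)" using y by blast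
    show ?thesis using that(1)[OF x(1)] mult_left_mono[OF x(2) that(2)] x(3) by simp
  qed
  have mem: "l2_norm (A (\<lambda>_. 0)) \<in> ?S" by (rule CollectI, intro exI[of _ "\<lambda>_. 0"]) simp
  have "bdd_above ?S" by (rule bdd_aboveI[of _ K]) (rule ub[OF K(2) K(1)])
  from cSup_upper[OF mem this] show "0 \<le> op_norm A"
    unfolding op_norm_def by (rule order_trans[OF l2_norm_nonneg])
  assume "\<And>x. x \<in> l2 \<Longrightarrow> l2_norm (A x) \<le> C * l2_norm x" "0 \<le> C"
  then show "op_norm A \<le> C"
    unfolding op_norm_def using mem ub by (intro cSup_least) blast+
qed

lemma rank_le_mono: "rank_le k F \<Longrightarrow> k \<le> m \<Longrightarrow> rank_le m F"
  unfolding rank_le_def using le_trans by blast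

lemma bounded_op_null: "bounded_op (\<lambda>_ _. 0)"
  by (rule bounded_opI[where K=0]) (auto simp: fun_eq_iff seq_scale_def)

lemma rank_le_null: "rank_le k (\<lambda>_ _. 0)"
  unfolding rank_le_def by (intro exI[of _ "{}"]) (auto simp: fun_eq_iff)

lemma sing_val_properties:
  assumes A: "bounded_op A"
  shows "0 \<le> sing_val A k" "k \<le> m \<Longrightarrow> sing_val A m \<le> sing_val A k"
    and "bounded_op F \<Longrightarrow> rank_le k F \<Longrightarrow> (\<And>x. x \<in> l2 \<Longrightarrow> l2_norm (A x - F x) \<le> C * l2_norm x) \<Longrightarrow> 0 \<le> C
      \<Longrightarrow> sing_val A k \<le> C"
proof -
  let ?S = "\<lambda>k. {op_norm (A - F) | F. bounded_op F \<and> rank_le k F}"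
  have nn: "0 \<le> y" if "y \<in> ?S k" for y k
    using that op_norm_bounds(1)[OF bounded_op_diff[OF A]] by blast
  have ne: "?S k \<noteq> {}" for k using bounded_op_null rank_le_null by blast
  have bdd: "bdd_below (?S k)" for k using nn by (rule bdd_belowI)
  show "0 \<le> sing_val A k" unfolding sing_val_def using ne nn by (rule cInf_greatest)
  show "sing_val A m \<le> sing_val A k" if "k \<le> m"
    unfolding sing_val_def using ne[of k] bdd[of m] rank_le_mono[OF _ that] by (intro cInf_superset_mono) blast+
  assume F: "bounded_op F" "rank_le k F" and C: "\<And>x. x \<in> l2 \<Longrightarrow> l2_norm (A x - F x) \<le> C * l2_norm x" "0 \<le> C"
  have "op_norm (A - F) \<le> C"
    using C by (intro op_norm_bounds(2) bounded_op_diff A F) simp_all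
  moreover have "sing_val A k \<le> op_norm (A - F)"
    unfolding sing_val_def using F by (intro cInf_lower[OF _ bdd]) blast
  ultimately show "sing_val A k \<le> C" by simp
qed

definition approx_within :: "nat \<Rightarrow> real \<Rightarrow> 'n::finite operator \<Rightarrow> bool" where
  "approx_within k e A \<longleftrightarrow> (\<exists>F. bounded_op F \<and> rank_le k F \<and> (\<forall>x\<in>l2. l2_norm (A x - F x) \<le> e * l2_norm x))"

text \<open>
  Approximation by operators of rank \<open>c (M + 1)\<close> with summable errors. Unlike summability of the
  approximation numbers, this property is visibly closed under sums and under multiplication by bounded
  operators.
\<close>

definition fast_approx :: "'n::finite operator \<Rightarrow> bool" where
  "fast_approx A \<longleftrightarrow> bounded_op A \<and>
     (\<exists>c g. summable g \<and> (\<forall>M. 0 \<le> g M) \<and> (\<forall>M. approx_within (c * (M + 1)) (g M) A))"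

lemma fast_approxE:
  assumes "fast_approx A"
  obtains c g where "bounded_op A" "summable g" "\<And>M. 0 \<le> g M" "\<And>M. approx_within (c * (M + 1)) (g M) A"
  using assms unfolding fast_approx_def by blast

text \<open>
  Approximation numbers decrease, so the \<open>d\<close> of them in each block are at most the first one,
  which \<open>g\<close> dominates.
\<close>

lemma fast_approx_trace_class:
  assumes "fast_approx A" shows "trace_class A"
proof -
  obtain c g where A: "bounded_op A" and g: "summable g" "\<And>M. 0 \<le> g M"
    and F: "\<And>M. approx_within (c * (M + 1)) (g M) A"
    by (rule fast_approxE[OF assms]) (rule that)
  let ?s = "sing_val A"
  note sv = sing_val_properties[OF A]
  \<comment> \<open>The blocks of length \<open>d\<close> must not be empty, even if \<open>c = 0\<close>.\<close>
  define d where "d = c + 1"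
  have le: "?s (d * (M + 1)) \<le> g M" for M
  proof -
    obtain F where "bounded_op F" "rank_le (c * (M + 1)) F" "\<And>x. x \<in> l2 \<Longrightarrow> l2_norm (A x - F x) \<le> g M * l2_norm x"
      using F[of M] unfolding approx_within_def by blast
    then have "?s (c * (M + 1)) \<le> g M" using g(2) by (intro sv(3)[where F=F])
    moreover have "?s (d * (M + 1)) \<le> ?s (c * (M + 1))" by (rule sv(2)) (simp add: d_def)
    ultimately show ?thesis by simp
  qed
  have bound: "(\<Sum>k<n. ?s k) \<le> d * (?s 0 + suminf g)" for n
  proof -
    have "(\<Sum>k<n. ?s k) \<le> (\<Sum>k<Suc n * d. ?s k)"
      using sv(1) by (intro sum_mono2) (auto simp: d_def)
    also have "\<dots> = (\<Sum>m<Suc n. \<Sum>k=m*d..<m*d+d. ?s k)" by (rule sum.nat_group[symmetric])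
    also have "\<dots> \<le> (\<Sum>m<Suc n. \<Sum>k=m*d..<m*d+d. ?s (d * m))"
      by (intro sum_mono sv(2)) (simp add: mult.commute)
    also have "\<dots> = d * (\<Sum>m<Suc n. ?s (d * m))" by (simp add: sum_distrib_left distrib_left)
    also have "(\<Sum>m<Suc n. ?s (d * m)) = ?s 0 + (\<Sum>m<n. ?s (d * (m + 1)))"
      by (subst sum.lessThan_Suc_shift) simp
    also have "(\<Sum>m<n. ?s (d * (m + 1))) \<le> (\<Sum>m<n. g m)" by (intro sum_mono le)
    also have "\<dots> \<le> suminf g" using g by (intro sum_le_suminf) auto
    finally show ?thesis by (simp add: mult_left_mono)
  qed
  have "summable ?s" by (rule summableI_nonneg_bounded[OF sv(1) bound])
  with A show ?thesis by (simp add: trace_class_def)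
qed

text \<open>
  The vectors \<open>v i\<close> may coincide for different \<open>i\<close>, as happens for images of a spanning set; their
  coefficients are then added.
\<close>

lemma rank_le_family:
  fixes v :: "'b \<Rightarrow> 'n::finite sequence"
  assumes I: "finite I" "card I \<le> k" and v: "\<And>i. i \<in> I \<Longrightarrow> v i \<in> l2"
    and F: "\<And>x. x \<in> l2 \<Longrightarrow> F x = (\<Sum>i\<in>I. seq_scale (c x i) (v i))"
  shows "rank_le k F"
  unfolding rank_le_def
proof (intro exI[of _ "v ` I"] conjI ballI)
  show "card (v ` I) \<le> k" using card_image_le[OF I(1), of v] I(2) by simp
  fix x :: "'n sequence" assume x: "x \<in> l2"
  have sc: "(\<Sum>i\<in>J. seq_scale (c x i) b) = seq_scale (\<Sum>i\<in>J. c x i) b" if "finite J" for J b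
    using that by induction (auto simp: seq_scale_def fun_eq_iff vector_sadd_rdistrib)
  have "F x = (\<Sum>b\<in>v ` I. \<Sum>i | i \<in> I \<and> v i = b. seq_scale (c x i) (v i))"
    unfolding F[OF x] by (rule sum.image_gen[OF I(1)])
  also have "\<dots> = (\<Sum>b\<in>v ` I. \<Sum>i | i \<in> I \<and> v i = b. seq_scale (c x i) b)"
    by (intro sum.cong refl) auto
  also have "\<dots> = (\<Sum>b\<in>v ` I. seq_scale (\<Sum>i | i \<in> I \<and> v i = b. c x i) b)"
    using I(1) by (intro sum.cong refl sc) simp
  finally show "\<exists>c. F x = (\<Sum>b\<in>v ` I. seq_scale (c b) b)"
    by (intro exI[of _ "\<lambda>b. \<Sum>i | i \<in> I \<and> v i = b. c x i"])
qed (use I v in auto)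

lemma rank_leE:
  assumes "rank_le k F"
  obtains B c where "finite B" "B \<subseteq> l2" "card B \<le> k" "\<And>x. x \<in> l2 \<Longrightarrow> F x = (\<Sum>b\<in>B. seq_scale (c x b) b)"
proof -
  obtain B where B: "B \<subseteq> l2" "finite B" "card B \<le> k" and ex: "\<forall>x\<in>l2. \<exists>c. F x = (\<Sum>b\<in>B. seq_scale (c b) b)"
    using assms unfolding rank_le_def by blast
  from bchoice[OF ex] obtain c where "\<forall>x\<in>l2. F x = (\<Sum>b\<in>B. seq_scale (c x b) b)" by blast
  then show thesis using that[of B c] B by blast
qed

lemma rank_le_comp_right:
  assumes F: "rank_le k F" and A: "\<And>x. x \<in> l2 \<Longrightarrow> A x \<in> l2" shows "rank_le k (F \<circ> A)"
proof -
  obtain B c where B: "finite B" "B \<subseteq> l2" "card B \<le> k" and eq: "\<And>x. x \<in> l2 \<Longrightarrow> F x = (\<Sum>b\<in>B. seq_scale (c x b) b)"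
    using rank_leE[OF F] by blast
  show ?thesis
    by (rule rank_le_family[OF B(1,3), of "\<lambda>b. b" _ "\<lambda>x. c (A x)"]) (use B(2) eq A in auto)
qed

lemma bounded_op_sum:
  assumes A: "bounded_op A" and I: "finite I" and v: "\<And>i. i \<in> I \<Longrightarrow> v i \<in> l2"
  shows "A (\<Sum>i\<in>I. seq_scale (c i) (v i)) = (\<Sum>i\<in>I. seq_scale (c i) (A (v i)))
    \<and> (\<Sum>i\<in>I. seq_scale (c i) (v i)) \<in> l2"
  using I v
proof (induction I rule: finite_induct)
  case empty
  then show ?case using bounded_op_zero[OF A] by (simp add: zero_fun_def)
next
  case (insert i I)
  let ?S = "\<Sum>j\<in>I. seq_scale (c j) (v j)" and ?T = "\<Sum>j\<in>I. seq_scale (c j) (A (v j))"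
  have IH: "A ?S = ?T" "?S \<in> l2" using insert by auto
  have vi: "v i \<in> l2" "seq_scale (c i) (v i) \<in> l2" using insert.prems l2_scale by auto
  have "A (seq_scale (c i) (v i) + ?S) = A (seq_scale (c i) (v i)) + A ?S"
    using A vi IH(2) unfolding bounded_op_def by blast
  also have "A (seq_scale (c i) (v i)) = seq_scale (c i) (A (v i))"
    using A vi unfolding bounded_op_def by blast
  finally show ?case
    unfolding sum.insert[OF insert.hyps] IH(1) using l2_add(1)[OF vi(2) IH(2)] by blast
qed

lemma rank_le_comp_left:
  assumes A: "bounded_op A" and F: "rank_le k F" shows "rank_le k (A \<circ> F)"
proof -
  obtain B c where B: "finite B" "B \<subseteq> l2" "card B \<le> k" and eq: "\<And>x. x \<in> l2 \<Longrightarrow> F x = (\<Sum>b\<in>B. seq_scale (c x b) b)"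
    using rank_leE[OF F] by blast
  show ?thesis
  proof (rule rank_le_family[OF B(1,3), of A])
    show "A b \<in> l2" if "b \<in> B" for b using that B A by (auto simp: bounded_op_def)
    show "(A \<circ> F) x = (\<Sum>b\<in>B. seq_scale (c x b) (A b))" if "x \<in> l2" for x
      using bounded_op_sum[OF A B(1), of "\<lambda>b. b" "c x"] B(2) eq[OF that] by auto
  qed
qed

lemma rank_le_add:
  assumes F: "rank_le k F" and G: "rank_le m G" shows "rank_le (k + m) (F + G)"
proof -
  obtain B c where B: "finite B" "B \<subseteq> l2" "card B \<le> k" and Fx: "\<And>x. x \<in> l2 \<Longrightarrow> F x = (\<Sum>b\<in>B. seq_scale (c x b) b)"
    using rank_leE[OF F] by blast
  obtain D e where D: "finite D" "D \<subseteq> l2" "card D \<le> m" and Gx: "\<And>x. x \<in> l2 \<Longrightarrow> G x = (\<Sum>b\<in>D. seq_scale (e x b) b)"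
    using rank_leE[OF G] by blast
  show ?thesis
  proof (rule rank_le_family[of "B <+> D" _ "case_sum id id" _ "\<lambda>x. case_sum (c x) (e x)"])
    show "(F + G) x = (\<Sum>i\<in>B <+> D. seq_scale (case_sum (c x) (e x) i) (case_sum id id i))" if "x \<in> l2" for x
      using B(1) D(1) by (simp add: sum.Plus Fx Gx that)
  qed (use B D in \<open>auto simp: card_Plus\<close>)
qed

lemma approx_within_comp_left:
  assumes A: "approx_within k e A" "bounded_op A" and B: "bounded_op B"
    and K: "0 \<le> K" "\<And>x. x \<in> l2 \<Longrightarrow> l2_norm (B x) \<le> K * l2_norm x"
  shows "approx_within k (K * e) (B \<circ> A)"
proof -
  obtain F where F: "bounded_op F" "rank_le k F" "\<And>x. x \<in> l2 \<Longrightarrow> l2_norm (A x - F x) \<le> e * l2_norm x"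
    using A(1) unfolding approx_within_def by blast
  have "l2_norm ((B \<circ> A) x - (B \<circ> F) x) \<le> (K * e) * l2_norm x" if x: "x \<in> l2" for x
  proof -
    have d: "(A - F) x \<in> l2" using bounded_op_diff[OF A(2) F(1)] x by (simp add: bounded_op_def)
    moreover have "F x \<in> l2" using F(1) x by (simp add: bounded_op_def)
    ultimately have "B ((A - F) x + F x) = B ((A - F) x) + B (F x)"
      using B unfolding bounded_op_def by blast
    moreover have "(A - F) x + F x = A x" by simp
    ultimately have "(B \<circ> A) x - (B \<circ> F) x = B ((A - F) x)" by simp
    then have "l2_norm ((B \<circ> A) x - (B \<circ> F) x) \<le> K * l2_norm ((A - F) x)" using K(2)[OF d] by simp
    also have "\<dots> \<le> K * (e * l2_norm x)" using F(3)[OF x] K(1) by (intro mult_left_mono) simp_all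
    finally show ?thesis by (simp add: mult.assoc)
  qed
  then show ?thesis
    unfolding approx_within_def using bounded_op_comp[OF B F(1)] rank_le_comp_left[OF B F(2)] by blast
qed

lemma approx_within_comp_right:
  assumes A: "approx_within k e A" and B: "bounded_op B" and e: "0 \<le> e"
    and K: "\<And>x. x \<in> l2 \<Longrightarrow> l2_norm (B x) \<le> K * l2_norm x"
  shows "approx_within k (e * K) (A \<circ> B)"
proof -
  obtain F where F: "bounded_op F" "rank_le k F" "\<And>x. x \<in> l2 \<Longrightarrow> l2_norm (A x - F x) \<le> e * l2_norm x"
    using A unfolding approx_within_def by blast
  have B2: "x \<in> l2 \<Longrightarrow> B x \<in> l2" for x using B by (simp add: bounded_op_def)
  have "l2_norm ((A \<circ> B) x - (F \<circ> B) x) \<le> (e * K) * l2_norm x" if x: "x \<in> l2" for x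
    using order_trans[OF F(3)[OF B2[OF x]] mult_left_mono[OF K[OF x] e]] by (simp add: mult.assoc)
  moreover have "rank_le k (F \<circ> B)" by (rule rank_le_comp_right[OF F(2) B2])
  ultimately show ?thesis unfolding approx_within_def using bounded_op_comp[OF F(1) B] by blast
qed

lemma approx_within_add:
  assumes A: "approx_within k e A" "bounded_op A" and B: "approx_within m f B" "bounded_op B"
  shows "approx_within (k + m) (e + f) (A + B)"
proof -
  obtain F where F: "bounded_op F" "rank_le k F" "\<And>x. x \<in> l2 \<Longrightarrow> l2_norm (A x - F x) \<le> e * l2_norm x"
    using A(1) unfolding approx_within_def by blast
  obtain G where G: "bounded_op G" "rank_le m G" "\<And>x. x \<in> l2 \<Longrightarrow> l2_norm (B x - G x) \<le> f * l2_norm x"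
    using B(1) unfolding approx_within_def by blast
  have "l2_norm ((A + B) x - (F + G) x) \<le> (e + f) * l2_norm x" if x: "x \<in> l2" for x
  proof -
    have m: "(A - F) x \<in> l2" "(B - G) x \<in> l2"
      using bounded_op_diff[OF A(2) F(1)] bounded_op_diff[OF B(2) G(1)] x by (simp_all add: bounded_op_def)
    have "(A + B) x - (F + G) x = (A - F) x + (B - G) x" by (simp add: algebra_simps)
    then have "l2_norm ((A + B) x - (F + G) x) \<le> l2_norm ((A - F) x) + l2_norm ((B - G) x)"
      using l2_add(2)[OF m] by (simp only:)
    also have "\<dots> \<le> (e + f) * l2_norm x" using F(3)[OF x] G(3)[OF x] by (simp add: distrib_right)
    finally show ?thesis .
  qed
  then show ?thesis
    unfolding approx_within_def using bounded_op_add[OF F(1) G(1)] rank_le_add[OF F(2) G(2)] by blast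
qed

lemma fast_approx_comp_left:
  assumes A: "fast_approx A" and B: "bounded_op B" shows "fast_approx (B \<circ> A)"
proof -
  obtain c g where bA: "bounded_op A" and g: "summable g" "\<And>M. 0 \<le> g M"
    and F: "\<And>M. approx_within (c * (M + 1)) (g M) A"
    by (rule fast_approxE[OF A]) (rule that)
  obtain K where K: "0 \<le> K" "\<And>x. x \<in> l2 \<Longrightarrow> l2_norm (B x) \<le> K * l2_norm x" using bounded_op_bound[OF B] by blast
  show ?thesis
    unfolding fast_approx_def
    using approx_within_comp_left[OF F bA B K] bounded_op_comp[OF B bA] summable_mult[OF g(1), of K] g(2) K(1)
    by (intro conjI exI[of _ c] exI[of _ "\<lambda>M. K * g M"]) auto
qed

lemma fast_approx_comp_right:
  assumes A: "fast_approx A" and B: "bounded_op B" shows "fast_approx (A \<circ> B)"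
proof -
  obtain c g where bA: "bounded_op A" and g: "summable g" "\<And>M. 0 \<le> g M"
    and F: "\<And>M. approx_within (c * (M + 1)) (g M) A"
    by (rule fast_approxE[OF A]) (rule that)
  obtain K where K: "0 \<le> K" "\<And>x. x \<in> l2 \<Longrightarrow> l2_norm (B x) \<le> K * l2_norm x" using bounded_op_bound[OF B] by blast
  show ?thesis
    unfolding fast_approx_def
    using approx_within_comp_right[OF F B g(2) K(2)] bounded_op_comp[OF bA B] summable_mult2[OF g(1), of K] g(2) K(1)
    by (intro conjI exI[of _ c] exI[of _ "\<lambda>M. g M * K"]) auto
qed

lemma fast_approx_add:
  assumes A: "fast_approx A" and B: "fast_approx B" shows "fast_approx (A + B)"
proof -
  obtain c g where bA: "bounded_op A" and g: "summable g" "\<And>M. 0 \<le> g M"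
    and F: "\<And>M. approx_within (c * (M + 1)) (g M) A"
    by (rule fast_approxE[OF A]) (rule that)
  obtain d h where bB: "bounded_op B" and h: "summable h" "\<And>M. 0 \<le> h M"
    and G: "\<And>M. approx_within (d * (M + 1)) (h M) B"
    by (rule fast_approxE[OF B]) (rule that)
  have "approx_within ((c + d) * (M + 1)) (g M + h M) (A + B)" for M
    using approx_within_add[OF F bA G bB] by (simp only: distrib_right)
  then show ?thesis
    unfolding fast_approx_def
    using bounded_op_add[OF bA bB] summable_add[OF g(1) h(1)] g(2) h(2)
    by (intro conjI exI[of _ "c + d"] exI[of _ "\<lambda>M. g M + h M"]) auto
qed

lemma bounded_op_id: "bounded_op id"
  by (rule bounded_opI[where K=1]) auto

lemma fast_approx_scale: "fast_approx A \<Longrightarrow> fast_approx (z *\<^sub>o A)"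
  using fast_approx_comp_left[OF _ bounded_op_scale[OF bounded_op_id, of z]]
  by (simp add: op_scale_def o_def)

lemma fast_approx_diff: "fast_approx A \<Longrightarrow> fast_approx B \<Longrightarrow> fast_approx (A - B)"
  unfolding op_diff_eq by (intro fast_approx_add fast_approx_scale)

lemma fast_approx_cong:
  assumes A: "fast_approx A" and eq: "\<And>x. x \<in> l2 \<Longrightarrow> B x = A x" shows "fast_approx B"
  using A bounded_op_cong[OF _ eq] eq unfolding fast_approx_def approx_within_def by simp

section \<open>Hankel blocks are trace class\<close>

text \<open>
  The block rows with \<open>\<bar>j\<bar> \<le> M\<close> form an operator of rank at most \<open>(2 M + 1) N\<close>. The remaining rows meet
  \<open>c m\<close> only for \<open>\<bar>m\<bar> + d > M\<close>, and each \<open>norm (c m)\<close> is counted for at most \<open>\<bar>m\<bar> + d\<close> values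
  of \<open>M\<close>, which the weight pays for.
\<close>

lemma fast_approx_hankel:
  fixes c :: "int \<Rightarrow> complex^'n::finite^'n"
  assumes c: "weighted_wiener c" and XY: "\<And>j k. j \<in> X \<Longrightarrow> k \<in> Y \<Longrightarrow> \<bar>j\<bar> \<le> \<bar>j - k\<bar> + d" and d: "0 \<le> d"
  shows "fast_approx (restr X \<circ> conv c \<circ> restr Y)"
proof -
  note w = weighted_wiener_imp_wiener[OF c]
  let ?A = "restr X \<circ> conv c \<circ> restr Y"
  \<comment> \<open>The coefficients that the rows with \<open>\<bar>j\<bar> > M\<close> can meet.\<close>
  define t where "t M m = (if int M < \<bar>m\<bar> + d then c m else 0)" for M m
  define g where "g M = (\<Sum>\<^sub>\<infinity>m. norm (t M m))" for M
  have t_le: "norm (t M m) \<le> norm (c m)" for M m by (simp add: t_def)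
  have wt: "wiener (t M)" for M
    unfolding wiener_def by (rule summable_on_comparison_test[OF w[unfolded wiener_def]]) (auto simp: t_le)
  have g0: "0 \<le> g M" for M unfolding g_def by (rule infsum_nonneg) simp
  let ?S = "\<Sum>\<^sub>\<infinity>m. (of_int \<bar>m\<bar> + 1) * norm (c m)"
  have "summable g"
  proof (rule summableI_nonneg_bounded[OF g0])
    fix n
    have "(\<Sum>M<n. g M) = (\<Sum>\<^sub>\<infinity>m. \<Sum>M<n. norm (t M m))"
      unfolding g_def by (rule summable_on_finite_sum(2)[symmetric]) (use wt in \<open>auto simp: wiener_def\<close>)
    also have "\<dots> \<le> (\<Sum>\<^sub>\<infinity>m. (of_int d + 1) * ((of_int \<bar>m\<bar> + 1) * norm (c m)))"
    proof (rule infsum_mono)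
      show "(\<lambda>m. \<Sum>M<n. norm (t M m)) summable_on UNIV"
        by (rule summable_on_finite_sum(1)) (use wt in \<open>auto simp: wiener_def\<close>)
      show "(\<lambda>m. (of_int d + 1) * ((of_int \<bar>m\<bar> + 1) * norm (c m))) summable_on UNIV"
        using c unfolding weighted_wiener_def by (rule summable_on_cmult_right)
      fix m
      have "(\<Sum>M<n. norm (t M m)) = (\<Sum>M\<in>{..<n} \<inter> {M. int M < \<bar>m\<bar> + d}. norm (c m))"
        by (rule sum.mono_neutral_cong_right) (auto simp: t_def)
      also have "\<dots> = real (card ({..<n} \<inter> {M. int M < \<bar>m\<bar> + d})) * norm (c m)" by simp
      also have "\<dots> \<le> ((of_int d + 1) * (of_int \<bar>m\<bar> + 1)) * norm (c m)"
      proof (rule mult_right_mono)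
        have "card ({..<n} \<inter> {M. int M < \<bar>m\<bar> + d}) \<le> card {..<nat (\<bar>m\<bar> + d)}"
          by (intro card_mono) auto
        then have "int (card ({..<n} \<inter> {M. int M < \<bar>m\<bar> + d})) \<le> \<bar>m\<bar> + d" using d by simp
        also have "\<dots> \<le> (d + 1) * (\<bar>m\<bar> + 1)" using d by (simp add: algebra_simps)
        finally have "real_of_int (int (card ({..<n} \<inter> {M. int M < \<bar>m\<bar> + d}))) \<le> real_of_int ((d + 1) * (\<bar>m\<bar> + 1))"
          by (simp only: of_int_le_iff)
        then show "real (card ({..<n} \<inter> {M. int M < \<bar>m\<bar> + d})) \<le> (of_int d + 1) * (of_int \<bar>m\<bar> + 1)" by simp
      qed simp
      finally show "(\<Sum>M<n. norm (t M m)) \<le> (of_int d + 1) * ((of_int \<bar>m\<bar> + 1) * norm (c m))"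
        by (simp only: mult.assoc)
    qed
    also have "\<dots> = (of_int d + 1) * ?S" by (rule infsum_cmult_right')
    finally show "(\<Sum>M<n. g M) \<le> (of_int d + 1) * ?S" .
  qed
  moreover have bA: "bounded_op ?A"
    by (intro bounded_op_comp bounded_op_restr bounded_op_conv w)
  moreover have "approx_within (2 * CARD('n) * (M + 1)) (g M) ?A" for M
    unfolding approx_within_def
  proof (intro exI conjI ballI)
    define J where "J = {- int M..int M}"
    let ?F = "restr J \<circ> ?A"
    show bF: "bounded_op ?F" by (intro bounded_op_comp bounded_op_restr bA)
    have "card (J \<times> (UNIV :: 'n set)) = nat (2 * int M + 1) * CARD('n)"
      by (simp add: J_def card_cartesian_product)
    also have "\<dots> \<le> (2 * (M + 1)) * CARD('n)" by (intro mult_right_mono) auto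
    finally have card: "card (J \<times> (UNIV :: 'n set)) \<le> 2 * CARD('n) * (M + 1)" by (simp add: mult_ac)
    show "rank_le (2 * CARD('n) * (M + 1)) ?F"
    proof (rule rank_le_family[OF _ card, of unit_seq _ "\<lambda>x p. ?A x (fst p) $ snd p"])
      show "finite (J \<times> (UNIV :: 'n set))" by (simp add: J_def)
      show "unit_seq p \<in> l2" for p :: "int \<times> 'n"
      proof -
        have "(\<lambda>k. (norm (unit_seq p k))\<^sup>2) summable_on {fst p}" by simp
        then show ?thesis
          unfolding l2_def mem_Collect_eq
          by (rule summable_on_cong_neutral[THEN iffD1, rotated -1]) (auto simp: unit_seq_def)
      qed
      fix x :: "'n sequence"
      show "?F x = (\<Sum>p\<in>J \<times> UNIV. seq_scale (?A x (fst p) $ snd p) (unit_seq p))"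
      proof (rule ext)
        fix k
        define y where "y = ?A x"
        have app: "(\<Sum>p\<in>P. f p) k = (\<Sum>p\<in>P. f p k)" for P and f :: "int \<times> 'n \<Rightarrow> 'n sequence"
          by (induction P rule: infinite_finite_induct) auto
        have "(\<Sum>p\<in>J \<times> UNIV. seq_scale (y (fst p) $ snd p) (unit_seq p) k) = 
              (\<Sum>j\<in>J. \<Sum>i\<in>UNIV. (y j $ i) *s (if k = j then axis i 1 else 0))"
          by (simp add: sum.cartesian_product' seq_scale_def unit_seq_def cong: if_cong)
        also have "\<dots> = (\<Sum>j\<in>J. if k = j then \<Sum>i\<in>UNIV. (y j $ i) *s axis i 1 else 0)"
          by (intro sum.cong refl) simp
        also have "\<dots> = (\<Sum>j\<in>J. if k = j then y j else 0)"
          by (simp add: basis_expansion cong: if_cong)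
        also have "\<dots> = restr J y k" by (simp add: restr_def J_def)
        finally show "?F x k = (\<Sum>p\<in>J \<times> UNIV. seq_scale (?A x (fst p) $ snd p) (unit_seq p)) k"
          unfolding app y_def by simp
      qed
    qed
    fix x :: "'n sequence" assume x: "x \<in> l2"
    have "?A x - ?F x = restr (X - J) (conv (t M) (restr Y x))"
    proof (rule ext)
      fix j
      show "(?A x - ?F x) j = restr (X - J) (conv (t M) (restr Y x)) j"
      proof (cases "j \<in> X - J")
        case True
        then have j: "j \<in> X" "int M < \<bar>j\<bar>" by (auto simp: J_def)
        have "c (j - k) *v restr Y x k = t M (j - k) *v restr Y x k" for k
          using XY[OF j(1), of k] j(2) by (auto simp: restr_def t_def)
        then show ?thesis using True by (simp add: restr_def[of X] restr_def[of J] restr_def[of "X - J"] conv_def)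
      qed (auto simp: restr_def)
    qed
    then have "l2_norm (?A x - ?F x) \<le> l2_norm (conv (t M) (restr Y x))"
      by (simp only: l2_restr(2)[OF l2_conv(1)[OF wt l2_restr(1)[OF x]]])
    also have "\<dots> \<le> g M * l2_norm (restr Y x)" unfolding g_def by (rule l2_conv(2)[OF wt l2_restr(1)[OF x]])
    also have "\<dots> \<le> g M * l2_norm x" by (intro mult_left_mono l2_restr(2) x g0)
    finally show "l2_norm (?A x - ?F x) \<le> g M * l2_norm x" .
  qed
  ultimately show ?thesis unfolding fast_approx_def using g0 by blast
qed

lemma proj_Qn_eq_restr: "proj_Qn n = restr {n..}"
  by (simp add: proj_Qn_def restr_def fun_eq_iff)

lemma proj_P_eq_restr: "proj_P = restr {0..}"
  by (simp add: proj_P_def restr_def fun_eq_iff)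

lemma id_minus_restr: "id - restr X = restr (- X)"
  by (auto simp: restr_def fun_eq_iff)

lemma restr_add_Compl: "restr X x + restr (- X) x = x"
  by (auto simp: restr_def fun_eq_iff)

text \<open>
  The choice \<open>d = \<bar>n\<bar>\<close> fits both Hankel blocks: their corner is at distance \<open>\<bar>n\<bar>\<close> from the diagonal.
\<close>

lemma trace_class_operators:
  fixes a b :: "complex \<Rightarrow> complex^'n::finite^'n"
  assumes a: "weighted_wiener (fourier_coeff a)" and b: "weighted_wiener (fourier_coeff b)"
    and inv: "\<And>x. x \<in> l2 \<Longrightarrow> laurent a (laurent b x) = x"
  shows "id_plus_trace_class (id + s *\<^sub>o proj_P - s *\<^sub>o (laurent a \<circ> proj_Qn n \<circ> laurent b))"
    and "id_plus_trace_class (id - z *\<^sub>o (proj_Qn n \<circ> laurent b \<circ> proj_Q \<circ> laurent a \<circ> proj_Qn n))"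
    and "id_plus_trace_class (id - z *\<^sub>o ((id - proj_Qn n) \<circ> laurent b \<circ> proj_P \<circ> laurent a \<circ> (id - proj_Qn n)))"
proof -
  let ?A = "laurent a" and ?B = "laurent b"
  let ?H1 = "restr {0..} \<circ> ?A \<circ> restr (- {n..})" and ?H2 = "restr (- {0..}) \<circ> ?A \<circ> restr {n..}"
  have bA: "bounded_op ?A" and bB: "bounded_op ?B"
    unfolding laurent_eq_conv by (intro bounded_op_conv weighted_wiener_imp_wiener a b)+
  have H1: "fast_approx ?H1" and H2: "fast_approx ?H2"
    unfolding laurent_eq_conv by (rule fast_approx_hankel[OF a, of _ _ "\<bar>n\<bar>"]; auto)+
  have "fast_approx (s *\<^sub>o ((?H1 - ?H2) \<circ> ?B))"
    by (intro fast_approx_scale fast_approx_comp_right[OF _ bB] fast_approx_diff H1 H2)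
  then have "fast_approx (id + s *\<^sub>o proj_P - s *\<^sub>o (?A \<circ> proj_Qn n \<circ> ?B) - id)"
  proof (rule fast_approx_cong)
    fix x :: "'n sequence" assume x: "x \<in> l2"
    define y where "y = ?B x"
    have y: "y \<in> l2" using bB x by (simp add: y_def bounded_op_def)
    have "?A (restr {n..} y + restr (- {n..}) y) = ?A (restr {n..} y) + ?A (restr (- {n..}) y)"
      using bA l2_restr(1)[OF y] unfolding bounded_op_def by blast
    then have split: "x = ?A (restr {n..} y) + ?A (restr (- {n..}) y)"
      using inv[OF x] by (simp only: restr_add_Compl y_def)
    have diff: "restr {0..} x - ?A (restr {n..} y) = ?H1 y - ?H2 y"
      by (subst split) (auto simp: restr_def fun_eq_iff)
    have "(id + s *\<^sub>o proj_P - s *\<^sub>o (?A \<circ> proj_Qn n \<circ> ?B) - id) x =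
       seq_scale s (restr {0..} x - ?A (restr {n..} y))"
      by (simp add: fun_eq_iff op_scale_def seq_scale_def proj_P_eq_restr proj_Qn_eq_restr y_def
           vector_ssub_ldistrib)
    also have "\<dots> = (s *\<^sub>o ((?H1 - ?H2) \<circ> ?B)) x"
      unfolding diff by (simp add: op_scale_def y_def)
    finally show "(id + s *\<^sub>o proj_P - s *\<^sub>o (?A \<circ> proj_Qn n \<circ> ?B) - id) x = (s *\<^sub>o ((?H1 - ?H2) \<circ> ?B)) x" .
  qed
  then show "id_plus_trace_class (id + s *\<^sub>o proj_P - s *\<^sub>o (?A \<circ> proj_Qn n \<circ> ?B))"
    unfolding id_plus_trace_class_def by (rule fast_approx_trace_class)
  have neg: "id - z *\<^sub>o Z - id = (- z) *\<^sub>o Z" for Z :: "'n operator"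
    by (simp add: fun_eq_iff op_scale_def seq_scale_def vector_smult_lneg)
  show "id_plus_trace_class (id - z *\<^sub>o (proj_Qn n \<circ> ?B \<circ> proj_Q \<circ> ?A \<circ> proj_Qn n))"
    unfolding id_plus_trace_class_def neg proj_Q_def proj_P_eq_restr proj_Qn_eq_restr id_minus_restr
    using fast_approx_scale[OF fast_approx_comp_left[OF H2 bounded_op_comp[OF bounded_op_restr[of "{n..}"] bB]], of "- z"]
    by (intro fast_approx_trace_class) (simp only: comp_assoc)
  show "id_plus_trace_class (id - z *\<^sub>o ((id - proj_Qn n) \<circ> ?B \<circ> proj_P \<circ> ?A \<circ> (id - proj_Qn n)))"
    unfolding id_plus_trace_class_def neg proj_P_eq_restr proj_Qn_eq_restr id_minus_restr
    using fast_approx_scale[OF fast_approx_comp_left[OF H1 bounded_op_comp[OF bounded_op_restr[of "- {n..}"] bB]], of "- z"]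
    by (intro fast_approx_trace_class) (simp only: comp_assoc)
qed

section \<open>The two determinant formulas\<close>

lemma K11_iff: "a \<in> K11 \<longleftrightarrow> a \<in> L_inf \<and> weighted_wiener (fourier_coeff a)"
  by (simp add: K11_def weighted_wiener_def)

lemma matrix_inv_properties:
  fixes A :: "complex^'n^'n"
  assumes "invertible A" shows "A ** matrix_inv A = mat 1" "matrix_inv A ** A = mat 1"
  using assms unfolding invertible_def matrix_inv_def by (metis (mono_tags, lifting) someI_ex)+

lemma matrix_inv_product:
  fixes A B :: "complex^'n^'n"
  assumes A: "invertible A" and B: "invertible B"
  shows "matrix_inv (A ** B) = matrix_inv B ** matrix_inv A"
proof -
  let ?C = "matrix_inv B ** matrix_inv A"
  have "A ** B ** ?C = A ** (B ** matrix_inv B) ** matrix_inv A" by (simp only: matrix_mul_assoc)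
  then have 1: "A ** B ** ?C = mat 1" using A B by (simp add: matrix_inv_properties)
  have "?C ** (A ** B) = matrix_inv B ** (matrix_inv A ** A) ** B" by (simp only: matrix_mul_assoc)
  then have 2: "?C ** (A ** B) = mat 1" using A B by (simp add: matrix_inv_properties)
  have "invertible (A ** B)" using 1 2 unfolding invertible_def by blast
  then have "matrix_inv (A ** B) ** (A ** B) ** ?C = ?C" by (simp add: matrix_inv_properties)
  then have "matrix_inv (A ** B) ** (A ** B ** ?C) = ?C" by (simp only: matrix_mul_assoc)
  then show ?thesis by (simp add: 1)
qed

text \<open>
  Multiplicativity of the Laurent matrix turns pointwise inverses into inverse matrices.
\<close>

lemma units_in_lmat:
  assumes "u \<in> units_in (K11 \<inter> H)"
  shows "u \<in> H" "ptw_inv u \<in> H"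
    and "bdd_entries u" "bdd_entries (ptw_inv u)"
    and "weighted_wiener (fourier_coeff u)" "weighted_wiener (fourier_coeff (ptw_inv u))"
    and "AE t in angle_measure. invertible (u (cis t))"
    and "lmat (fourier_coeff u) * lmat (fourier_coeff (ptw_inv u)) = 1"
    and "lmat (fourier_coeff (ptw_inv u)) * lmat (fourier_coeff u) = 1"
proof -
  show H: "u \<in> H" "ptw_inv u \<in> H" and inv: "AE t in angle_measure. invertible (u (cis t))"
    using assms by (auto simp: units_in_def)
  show bdd: "bdd_entries u" "bdd_entries (ptw_inv u)"
    and ww: "weighted_wiener (fourier_coeff u)" "weighted_wiener (fourier_coeff (ptw_inv u))"
    using assms by (auto simp: units_in_def K11_iff L_inf_bdd_entries)
  note w = ww[THEN weighted_wiener_imp_wiener]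
  have "AE t in angle_measure. u (cis t) ** ptw_inv u (cis t) = mat 1"
    using inv by eventually_elim (simp add: ptw_inv_def matrix_inv_properties)
  from fourier_coeff_identity[of "\<lambda>z. u z ** ptw_inv u z", OF this]
  show "lmat (fourier_coeff u) * lmat (fourier_coeff (ptw_inv u)) = 1"
    using lmat_product[OF bdd(1) w(1) bdd(2) w(2), of "\<lambda>z. u z ** ptw_inv u z"] by simp
  have "AE t in angle_measure. ptw_inv u (cis t) ** u (cis t) = mat 1"
    using inv by eventually_elim (simp add: ptw_inv_def matrix_inv_properties)
  from fourier_coeff_identity[of "\<lambda>z. ptw_inv u z ** u z", OF this]
  show "lmat (fourier_coeff (ptw_inv u)) * lmat (fourier_coeff u) = 1"
    using lmat_product[OF bdd(2) w(2) bdd(1) w(1), of "\<lambda>z. ptw_inv u z ** u z"] by simp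
qed

text \<open>
  The two half-lines differ in \<open>\<bar>n\<bar>\<close> blocks of size \<open>N\<close>; the sign of \<open>n\<close> decides
  whether a factor \<open>1 + s\<close> stands in the numerator or in the denominator.
\<close>

lemma half_line_factor:
  fixes s :: complex
  shows "finite {p :: int \<times> 'n::finite. (0 \<le> fst p) \<noteq> (n \<le> fst p)}"
    and "(\<Prod>p :: int \<times> 'n | (0 \<le> fst p) \<noteq> (n \<le> fst p).
       (1 + s * of_bool (0 \<le> fst p)) / (1 + s * of_bool (n \<le> fst p))) = (1 + s) powi (n * int CARD('n))"
    and "(\<Prod>p :: int \<times> 'n | (fst p < 0) \<noteq> (fst p < n).
       (1 + s * of_bool (fst p < 0)) / (1 + s * of_bool (fst p < n))) = (1 + s) powi (- (n * int CARD('n)))"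
proof -
  let ?D = "{p :: int \<times> 'n. (0 \<le> fst p) \<noteq> (n \<le> fst p)}" and ?z = "1 + s"
  show "finite ?D"
    by (rule finite_subset[of _ "{min 0 n..<max 0 n} \<times> UNIV"]) auto
  have "?D = {min 0 n..<max 0 n} \<times> UNIV" by auto
  then have card: "card ?D = nat \<bar>n\<bar> * CARD('n)" by (simp add: card_cartesian_product)
  have power: "(\<Prod>p\<in>?D. if 0 \<le> n then w else inverse w) = w powi (n * int CARD('n))" for w :: complex
  proof (cases "0 \<le> n")
    case True
    then have n: "n * int CARD('n) = int (card ?D)" unfolding card by simp
    show ?thesis unfolding n using True by (simp only: prod_constant power_int_of_nat if_True)
  next
    case False
    then have n: "n * int CARD('n) = - int (card ?D)" unfolding card by simp
    show ?thesis unfolding n using False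
      by (simp only: prod_constant power_int_of_nat power_int_minus power_inverse if_False)
  qed
  show "(\<Prod>p\<in>?D. (1 + s * of_bool (0 \<le> fst p)) / (1 + s * of_bool (n \<le> fst p))) = ?z powi (n * int CARD('n))"
    unfolding power[symmetric] by (rule prod.cong) (auto simp: divide_inverse)
  have D': "{p :: int \<times> 'n. (fst p < 0) \<noteq> (fst p < n)} = ?D" by auto
  show "(\<Prod>p :: int \<times> 'n | (fst p < 0) \<noteq> (fst p < n).
       (1 + s * of_bool (fst p < 0)) / (1 + s * of_bool (fst p < n))) = ?z powi (- (n * int CARD('n)))"
    unfolding D' power_int_minus unfolding power_int_inverse[symmetric] unfolding power[symmetric]
    by (rule prod.cong) (auto simp: divide_inverse)
qed

theorem theorem1p3:
  fixes a :: "complex \<Rightarrow> complex^'n^'n" and n :: int and s :: complex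
  assumes "a \<in> Phi_r K11 \<inter> Phi_l K11"
  defines "T \<equiv> id + s *\<^sub>o proj_P - s *\<^sub>o (laurent a \<circ> proj_Qn n \<circ> laurent (ptw_inv a))"
    and "R1 \<equiv> id - s\<^sup>2 *\<^sub>o (proj_Qn n \<circ> laurent (ptw_inv a) \<circ> proj_Q \<circ> laurent a \<circ> proj_Qn n)"
    and "R2 \<equiv> id - s\<^sup>2 *\<^sub>o ((id - proj_Qn n) \<circ> laurent (ptw_inv a) \<circ> proj_P \<circ> laurent a
                            \<circ> (id - proj_Qn n))"
  shows "id_plus_trace_class T \<and> id_plus_trace_class R1 \<and> id_plus_trace_class R2 \<and>
    (s \<noteq> -1 \<longrightarrow> fredholm_det T = (1 + s) powi (n * int CARD('n)) * fredholm_det R1) \<and>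
    (s \<noteq> 1 \<longrightarrow> fredholm_det T = (1 - s) powi (- (n * int CARD('n))) * fredholm_det R2)"
proof -
  obtain v u where v: "v \<in> units_in (K11 \<inter> H_minus)" and u: "u \<in> units_in (K11 \<inter> H_plus)"
    and a_eq: "AE t in angle_measure. a (cis t) = v (cis t) ** u (cis t)"
    using assms(1) by (auto simp: Phi_r_def)
  note v = units_in_lmat[OF v] and u = units_in_lmat[OF u]
  have inv_eq: "AE t in angle_measure. ptw_inv a (cis t) = ptw_inv u (cis t) ** ptw_inv v (cis t)"
    using a_eq v(7) u(7) by eventually_elim (simp add: ptw_inv_def matrix_inv_product)
  have wa: "weighted_wiener (fourier_coeff a)"
    by (rule weighted_wiener_product[OF v(3,5) u(3,5) a_eq])
  have wb: "weighted_wiener (fourier_coeff (ptw_inv a))"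
    by (rule weighted_wiener_product[OF u(4,6) v(4,6) inv_eq])
  note w = wa[THEN weighted_wiener_imp_wiener] wb[THEN weighted_wiener_imp_wiener]
  define V U V' U' where "V = lmat (fourier_coeff v)" and "U = lmat (fourier_coeff u)"
    and "V' = lmat (fourier_coeff (ptw_inv v))" and "U' = lmat (fourier_coeff (ptw_inv u))"
  define A B where "A = lmat (fourier_coeff a)" and "B = lmat (fourier_coeff (ptw_inv a))"
  have A: "A = V * U" unfolding A_def V_def U_def
    by (rule lmat_product[OF v(3) _ u(3) _ w(1) a_eq, symmetric]) (intro weighted_wiener_imp_wiener v u)+
  have B: "B = U' * V'" unfolding B_def V'_def U'_def
    by (rule lmat_product[OF u(4) _ v(4) _ w(2) inv_eq, symmetric]) (intro weighted_wiener_imp_wiener v u)+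
  have inverses: "U * U' = 1" "U' * U = 1" "V * V' = 1" "V' * V = 1"
    unfolding U_def U'_def V_def V'_def by (rule u v)+
  have plus: "fourier_coeff f k = 0" if "f \<in> H_plus" "k < 0" for f :: "complex \<Rightarrow> complex^'n^'n" and k
  proof -
    have "\<forall>m>0. fourier_coeff f (- m) = 0" using that(1) by (simp add: H_plus_def)
    then show ?thesis using that(2) by (auto dest: spec[of _ "- k"])
  qed
  have minus: "fourier_coeff f k = 0" if "f \<in> H_minus" "k > 0" for f :: "complex \<Rightarrow> complex^'n^'n" and k
    using that by (simp add: H_minus_def)
  have lowers: "lower fst U" "lower fst U'" "lower (\<lambda>p. - fst p) V" "lower (\<lambda>p. - fst p) V'"
    unfolding U_def U'_def V_def V'_def
    by (intro lower_lmat upper_lmat weighted_wiener_imp_wiener u(5,6) v(5,6)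
        plus[OF u(1)] plus[OF u(2)] minus[OF v(1)] minus[OF v(2)]; assumption)+
  have "A * B = V * (U * U') * V'" by (simp add: A B mult.assoc)
  then have AB: "A * B = 1" by (simp add: inverses)
  have "laurent a (laurent (ptw_inv a) x) = x" if "x \<in> l2" for x
    by (rule laurent_inverse[OF w AB[unfolded A_def B_def] l2_entry_le[OF that]])
  note trace = trace_class_operators[OF wa wb this]
  define X Y :: "(int \<times> 'n) set" where "X = {p. 0 \<le> fst p}" and "Y = {p. n \<le> fst p}"
  note comm = l1mat_commutator[OF u(5), folded U_def] l1mat_commutator[OF v(5), folded V_def]
  have cols: "proj_P (col M q) = col (cut X * M) q" "proj_Qn n (col M q) = col (cut Y * M) q"
    "laurent a (col M q) = col (A * M) q" "laurent (ptw_inv a) (col M q) = col (B * M) q" for M q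
  proof -
    have "proj_P x = proj_Qn 0 x" for x :: "'n sequence" by (simp add: proj_P_def proj_Qn_def)
    then show "proj_P (col M q) = col (cut X * M) q" by (simp only: proj_Qn_col X_def)
  qed (simp_all add: proj_Qn_col Y_def laurent_col w A_def B_def)
  have cols': "(id - proj_Qn n) (col M q) = col ((1 - cut Y) * M) q" "proj_Q (col M q) = col ((1 - cut X) * M) q" for M q
    by (simp_all add: proj_Q_def cols col_diff left_diff_distrib)
  define MT where "MT = 1 + scal s * cut X - scal s * (A * cut Y * B)"
  define M1 where "M1 = 1 - scal (s\<^sup>2) * (cut Y * B * (1 - cut X) * A * cut Y)"
  define M2 where "M2 = 1 - scal (s\<^sup>2) * ((1 - cut Y) * B * cut X * A * (1 - cut Y))"
  have T: "fredholm_det T = op_det MT"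
  proof (rule fredholm_det_eq_op_det)
    fix q :: "int \<times> 'n"
    have "(T - id) (unit_seq q) = seq_scale s (proj_P (col 1 q)) -
       seq_scale s (laurent a (proj_Qn n (laurent (ptw_inv a) (col 1 q))))"
      by (simp add: T_def op_scale_def unit_seq_col fun_eq_iff)
    then show "(T - id) (unit_seq q) = col (MT - 1) q"
      by (simp add: cols scale_col col_diff MT_def mult.assoc)
  qed
  have R: "fredholm_det (id - z *\<^sub>o Z) = op_det (1 - scal z * M)"
    if "\<And>q. Z (col 1 q) = col M q" for Z :: "'n operator" and z M
  proof (rule fredholm_det_eq_op_det)
    fix q :: "int \<times> 'n"
    have "(id - z *\<^sub>o Z - id) (unit_seq q) = seq_scale (- z) (Z (col 1 q))"
      by (simp add: op_scale_def unit_seq_col fun_eq_iff seq_scale_def vector_smult_lneg)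
    also have "\<dots> = col (scal (- z) * M) q" by (simp add: that scale_col)
    also have "scal (- z) * M = 1 - scal z * M - 1"
      by (intro smat_eqI) (simp add: entry_simps entry_scal_times)
    finally show "(id - z *\<^sub>o Z - id) (unit_seq q) = col (1 - scal z * M - 1) q" .
  qed
  have R1: "fredholm_det R1 = op_det M1"
    unfolding R1_def M1_def by (rule R) (simp add: cols cols' mult.assoc)
  have R2: "fredholm_det R2 = op_det M2"
    unfolding R2_def M2_def by (rule R) (simp only: o_apply cols cols' mult.assoc mult_1_right)
  have D: "finite {p. (p \<in> X) \<noteq> (p \<in> Y)}" "finite {p. (p \<in> - X) \<noteq> (p \<in> - Y)}"
    using half_line_factor(1)[where 'n='n and n=n] by (simp_all add: X_def Y_def)
  have first: "fredholm_det T = (1 + s) powi (n * int CARD('n)) * fredholm_det R1" if s: "s \<noteq> -1"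
  proof -
    have "op_det MT = (\<Prod>p | (p \<in> X) \<noteq> (p \<in> Y). (1 + s * of_bool (p \<in> X)) / (1 + s * of_bool (p \<in> Y))) * op_det M1"
      unfolding MT_def M1_def
      by (rule det_idempotent_difference[OF A B inverses lowers _ comm D(1) s]) (auto simp: X_def)
    then show ?thesis
      using half_line_factor(2)[where 'n='n and n=n and s=s] by (simp add: T R1 X_def Y_def)
  qed
  have second: "fredholm_det T = (1 - s) powi (- (n * int CARD('n))) * fredholm_det R2" if s: "s \<noteq> 1"
  proof -
    have s': "- s \<noteq> - 1" using s by auto
    have X': "- X = {p. fst p < 0}" "- Y = {p. fst p < n}" by (auto simp: X_def Y_def)
    \<comment> \<open>The same operator in terms of the complementary projections and \<open>-s\<close>.\<close>
    have scal_neg: "scal (- s) * M = - (scal s * M)" for M :: "(int \<times> 'n) smat"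
      by (intro smat_eqI) (simp add: entry_simps entry_scal_times)
    have MT_eq: "MT = 1 + scal (- s) * cut (- X) - scal (- s) * (A * cut (- Y) * B)"
      unfolding MT_def cut_Compl scal_neg by (simp add: algebra_simps AB)
    have M2_eq: "M2 = 1 - scal ((- s)\<^sup>2) * (cut (- Y) * B * (1 - cut (- X)) * A * cut (- Y))"
      unfolding M2_def cut_Compl by simp
    have "op_det MT = (\<Prod>p | (p \<in> - X) \<noteq> (p \<in> - Y). (1 + - s * of_bool (p \<in> - X)) / (1 + - s * of_bool (p \<in> - Y))) * op_det M2"
      unfolding MT_eq M2_eq
      by (rule det_idempotent_difference[OF A B inverses lowers _ comm D(2) s']) (auto simp: X_def)
    also have "(\<Prod>p | (p \<in> - X) \<noteq> (p \<in> - Y). (1 + - s * of_bool (p \<in> - X)) / (1 + - s * of_bool (p \<in> - Y)))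
       = (1 + - s) powi (- (n * int CARD('n)))"
      unfolding X' mem_Collect_eq by (rule half_line_factor(3))
    finally show ?thesis by (simp add: T R2)
  qed
  show ?thesis
    using trace(1)[where s=s and n=n] trace(2,3)[where z="s\<^sup>2" and n=n] first second
    unfolding T_def R1_def R2_def by blast
qed

end
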